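(* Let $R>0$ and let $\Phi:\mathbb{R}\to\mathbb{R}$ be real-analytic on $(-R,R)$, with majorants $\tilde\Phi',\tilde\Phi''$. Fix parameters $\lambda_0,K,T$ with $$0<T<1,\qquad T<\lambda_0<1,\qquad 0<K<\frac{\lambda_0}{T}-1,$$ and let $M\in(0,R)$. Let $\alpha_0=\|\alpha\|_{H,\lambda_0}$. Assume that $$2(1+\alpha_0)M\Big(\tilde{\Phi}'(M)+2MT\,\tilde{\Phi}''(M)\Big)\,e^{\alpha_0\tilde{\Phi}'(M)MT} < 1 \le K-\lambda_0-5\,\tilde{\Phi}'(M)M,$$ and that $f_0\in C^\infty(\mathbb{R}^2)$ satisfies $$\| \pi(1+v^2)f_0 \|_{H, \lambda_0}\le \frac{M}{2}\, e^{-(5+\alpha_0)\tilde{\Phi}'(M)M}.$$ Then there exists a unique solution $g\in \mathrm{X}_{\lambda_0,K,T}^M$ on $[0,T]$ of $$\partial_t g + v\,\partial_x g - \partial_x\Phi(\rho)\,(\partial_v g+\alpha g)=0,\qquad \rho(t,x)=\int_{\mathbb{R}}\omega(v)\, g(t,x,v)\,dv,\qquad g|_{t=0}=f_0/\omega .$$ In particular, $f:=\omega g$ is a solution on $[0,T]$ of $$\partial_t f+v\,\partial_x f-\partial_x\Phi(\rho)\,\partial_v f=0,\qquad \rho(t,x)=\int_{\mathbb{R}} f(t,x,v)\,dv,\qquad f|_{t=0}=f_0,$$ and it is unique among solutions $f$ of this problem such that $f/\omega\in \mathrm{X}_{\lambda_0,K,T}^M$.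
   Context: Unknowns are functions of $(t,x,v)\in[0,T]\times\mathbb{R}\times\mathbb{R}$. $\|\cdot\|_\infty$ is the supremum norm over the space variables $(x,v)$ (or over $x$ only or $v$ only, if the function depends only on that variable). Real-analytic nonlinearity: $\Phi:\mathbb{R}\to\mathbb{R}$ is real-analytic on $(-R,R)$ if there are real coefficients $(c_n)_{n\ge0}$ with $\Phi(z)=\sum_{n\ge0}c_nz^n$ for all $|z|<R$. Its majorants are, for $0\le r<R$, $\tilde\Phi(r)=\sum_{n\ge0}|c_n|r^n$, $\tilde\Phi'(r)=\sum_{n\ge1}n|c_n|r^{n-1}$, $\tilde\Phi''(r)=\sum_{n\ge2}n(n-1)|c_n|r^{n-2}$. Norms: for $\lambda>0$ and a smooth function $f(x,v)$, $$\|f\|_\lambda=\sum_{k,\ell\ge0}\frac{\lambda^{k+\ell}}{k!\,\ell!}\|\partial_x^k\partial_v^\ell f\|_\infty,\qquad |f|_{\lambda,n}=\frac{d^n}{d\lambda^n}\|f\|_\lambda=\sum_{k+\ell\ge n}\frac{(k+\ell)!}{(k+\ell-n)!}\frac{\lambda^{k+\ell-n}}{k!\,\ell!}\|\partial_x^k\partial_v^\ell f\|_\infty,$$ $$\|f\|_{H,\lambda}=\sum_{n\ge0}\frac{1}{(n!)^2}|f|_{\lambda,n},\qquad |f|_{H,\lambda}=\sum_{n\ge1}\frac{n^2}{(n!)^2}|f|_{\lambda,n}.$$ For functions of $x$ only (resp. $v$ only) only the terms $\ell=0$ (resp. $k=0$) appear. Weight: $\omega(v)=\frac{1}{\pi(1+v^2)}$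 and $\alpha(v)=\omega'(v)/\omega(v)=-\frac{2v}{1+v^2}$; $\alpha_0=\|\alpha\|_{H,\lambda_0}$ is finite for $0<\lambda_0<1$. Space: $\lambda(t)=\lambda_0-(K+1)t$ for $t\in[0,T]$, and $$\mathrm{X}_{\lambda_0,K,T}^M=\Big\{g\in C([0,T];C^\infty(\mathbb{R}^2)):\ \sup_{t\in[0,T]}\|g(t)\|_{H,\lambda(t)}+\int_0^T|g(t)|_{H,\lambda(t)}\,dt\le M\Big\}.$$ *)

theory Defs
  imports "HOL-Analysis.Analysis"
begin

text \<open>Functions of \<open>(x, v)\<close> are curried; so are functions of \<open>(t, x, v)\<close>, of which only
  the values for \<open>t \<in> {0..T}\<close> are meaningful.\<close>

definition pd_x :: "(real \<Rightarrow> real \<Rightarrow> real) \<Rightarrow> real \<Rightarrow> real \<Rightarrow> real" where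
  "pd_x f x v = deriv (\<lambda>y. f y v) x"

definition pd_v :: "(real \<Rightarrow> real \<Rightarrow> real) \<Rightarrow> real \<Rightarrow> real \<Rightarrow> real" where
  "pd_v f x v = deriv (\<lambda>w. f x w) v"

definition pd :: "nat \<Rightarrow> nat \<Rightarrow> (real \<Rightarrow> real \<Rightarrow> real) \<Rightarrow> real \<Rightarrow> real \<Rightarrow> real" where
  "pd k l f = (pd_x ^^ k) ((pd_v ^^ l) f)"

primrec C_k :: "nat \<Rightarrow> (real \<Rightarrow> real \<Rightarrow> real) \<Rightarrow> bool" where
  "C_k 0 f \<longleftrightarrow> continuous_on UNIV (\<lambda>(x, v). f x v)"
| "C_k (Suc n) f \<longleftrightarrow>
     (\<forall>x v. (\<lambda>y. f y v) differentiable (at x) \<and> (\<lambda>w. f x w) differentiable (at v))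
     \<and> C_k n (pd_x f) \<and> C_k n (pd_v f)"

definition C_inf :: "(real \<Rightarrow> real \<Rightarrow> real) \<Rightarrow> bool" where
  "C_inf f \<longleftrightarrow> (\<forall>n. C_k n f)"

text \<open>Continuity in time with values in the Frechet space of smooth functions on the plane,
  i.e. for locally uniform convergence of all partial derivatives.\<close>

definition C_time_C_inf :: "real \<Rightarrow> (real \<Rightarrow> real \<Rightarrow> real \<Rightarrow> real) \<Rightarrow> bool" where
  "C_time_C_inf T g \<longleftrightarrow>
     (\<forall>t\<in>{0..T}. C_inf (g t)) \<and>
     (\<forall>t\<in>{0..T}. \<forall>k l. \<forall>C. compact C \<longrightarrow>
        uniform_limit C (\<lambda>s (x, v). pd k l (g s) x v) (\<lambda>(x, v). pd k l (g t) x v)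
          (at t within {0..T}))"

text \<open>All norms take values in the extended nonnegative reals, so that they are infinite (and
  not some junk real) when a supremum or a series diverges. A function \<open>h\<close> of \<open>v\<close> only is
  treated as \<open>\<lambda>x v. h v\<close>, for which the terms with \<open>k > 0\<close> vanish.\<close>

definition sup_norm :: "(real \<Rightarrow> real \<Rightarrow> real) \<Rightarrow> ennreal" where
  "sup_norm f = (SUP (x, v)\<in>UNIV. ennreal \<bar>f x v\<bar>)"

text \<open>\<open>deriv_norm L n f\<close> is the termwise \<open>n\<close>-th derivative, at \<open>L > 0\<close>, of the power series
  \<open>\<Sum>\<^sub>k\<^sub>,\<^sub>l L ^ (k + l) / (k! l!) * sup_norm (pd k l f)\<close>; that series itself is the case \<open>n = 0\<close>.\<close>

definition deriv_norm :: "real \<Rightarrow> nat \<Rightarrow> (real \<Rightarrow> real \<Rightarrow> real) \<Rightarrow> ennreal" where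
  "deriv_norm L n f = (\<Sum>k. \<Sum>l.
     if n \<le> k + l
     then ennreal (fact (k + l) / fact (k + l - n) * (L ^ (k + l - n) / (fact k * fact l)))
            * sup_norm (pd k l f)
     else 0)"

definition norm_H :: "real \<Rightarrow> (real \<Rightarrow> real \<Rightarrow> real) \<Rightarrow> ennreal" where
  "norm_H L f = (\<Sum>n. ennreal (1 / (fact n)\<^sup>2) * deriv_norm L n f)"

definition seminorm_H :: "real \<Rightarrow> (real \<Rightarrow> real \<Rightarrow> real) \<Rightarrow> ennreal" where
  "seminorm_H L f = (\<Sum>n. ennreal ((real n)\<^sup>2 / (fact n)\<^sup>2) * deriv_norm L n f)"

definition omega :: "real \<Rightarrow> real" where
  "omega v = 1 / (pi * (1 + v\<^sup>2))"

definition alpha :: "real \<Rightarrow> real" where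
  "alpha v = deriv omega v / omega v"

lemma alpha_eq: "alpha v = - (2 * v / (1 + v\<^sup>2))"
proof -
  have pos: "1 + v\<^sup>2 \<noteq> 0"
    using zero_le_power2[of v] by linarith
  have "(omega has_real_derivative - (2 * v) / (pi * (1 + v\<^sup>2)\<^sup>2)) (at v)"
    unfolding omega_def[abs_def] using pos
    by (auto intro!: derivative_eq_intros simp: power2_eq_square divide_simps)
  then have "deriv omega v = - (2 * v) / (pi * (1 + v\<^sup>2)\<^sup>2)"
    by (rule DERIV_imp_deriv)
  with pos show ?thesis
    by (simp add: alpha_def omega_def power2_eq_square)
qed

text \<open>The norm below is finite for \<open>0 < L < 1\<close>.\<close>

definition alpha0 :: "real \<Rightarrow> real" where
  "alpha0 L = enn2real (norm_H L (\<lambda>x v. alpha v))"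

definition has_power_series :: "(real \<Rightarrow> real) \<Rightarrow> (nat \<Rightarrow> real) \<Rightarrow> real \<Rightarrow> bool" where
  "has_power_series \<Phi> c R \<longleftrightarrow> (\<forall>z. \<bar>z\<bar> < R \<longrightarrow> (\<lambda>n. c n * z ^ n) sums \<Phi> z)"

definition majorant_d1 :: "(nat \<Rightarrow> real) \<Rightarrow> real \<Rightarrow> real" where
  "majorant_d1 c r = (\<Sum>n. real n * \<bar>c n\<bar> * r ^ (n - 1))"

definition majorant_d2 :: "(nat \<Rightarrow> real) \<Rightarrow> real \<Rightarrow> real" where
  "majorant_d2 c r = (\<Sum>n. real n * (real n - 1) * \<bar>c n\<bar> * r ^ (n - 2))"

definition X_space ::
    "real \<Rightarrow> real \<Rightarrow> real \<Rightarrow> real \<Rightarrow> (real \<Rightarrow> real \<Rightarrow> real \<Rightarrow> real) set" where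
  "X_space lambda0 K T M = {g. C_time_C_inf T g \<and>
     (SUP t\<in>{0..T}. norm_H (lambda0 - (K + 1) * t) (g t))
       + (\<integral>\<^sup>+t\<in>{0..T}. seminorm_H (lambda0 - (K + 1) * t) (g t) \<partial>lborel) \<le> ennreal M}"

definition rho :: "(real \<Rightarrow> real \<Rightarrow> real \<Rightarrow> real) \<Rightarrow> real \<Rightarrow> real \<Rightarrow> real" where
  "rho f t x = (LINT v|lborel. f t x v)"

text \<open>Classical solutions on \<open>[0, T]\<close>; the time derivative is one-sided at the endpoints. The
  existence of the integral and of all the derivatives in the equation is part of the notion.\<close>

definition solves_f ::
    "(real \<Rightarrow> real) \<Rightarrow> real \<Rightarrow> (real \<Rightarrow> real \<Rightarrow> real) \<Rightarrow> (real \<Rightarrow> real \<Rightarrow> real \<Rightarrow> real) \<Rightarrow> bool" where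
  "solves_f \<Phi> T f\<^sub>0 f \<longleftrightarrow>
     (\<forall>x v. f 0 x v = f\<^sub>0 x v) \<and>
     (\<forall>t\<in>{0..T}. \<forall>x.
        integrable lborel (\<lambda>v. f t x v) \<and>
        (\<lambda>y. \<Phi> (rho f t y)) differentiable (at x) \<and>
        (\<forall>v. (\<lambda>y. f t y v) differentiable (at x) \<and>
             (\<lambda>w. f t x w) differentiable (at v) \<and>
             (\<exists>f_t. ((\<lambda>s. f s x v) has_real_derivative f_t) (at t within {0..T}) \<and>
                f_t + v * pd_x (f t) x v
                  - deriv (\<lambda>y. \<Phi> (rho f t y)) x * pd_v (f t) x v = 0)))"

definition solves_g ::
    "(real \<Rightarrow> real) \<Rightarrow> real \<Rightarrow> (real \<Rightarrow> real \<Rightarrow> real) \<Rightarrow> (real \<Rightarrow> real \<Rightarrow> real \<Rightarrow> real) \<Rightarrow> bool" where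
  "solves_g \<Phi> T f\<^sub>0 g \<longleftrightarrow>
     (let \<rho> = rho (\<lambda>t x v. omega v * g t x v) in
     (\<forall>x v. g 0 x v = f\<^sub>0 x v / omega v) \<and>
     (\<forall>t\<in>{0..T}. \<forall>x.
        integrable lborel (\<lambda>v. omega v * g t x v) \<and>
        (\<lambda>y. \<Phi> (\<rho> t y)) differentiable (at x) \<and>
        (\<forall>v. (\<lambda>y. g t y v) differentiable (at x) \<and>
             (\<lambda>w. g t x w) differentiable (at v) \<and>
             (\<exists>g_t. ((\<lambda>s. g s x v) has_real_derivative g_t) (at t within {0..T}) \<and>
                g_t + v * pd_x (g t) x v
                  - deriv (\<lambda>y. \<Phi> (\<rho> t y)) x * (pd_v (g t) x v + alpha v * g t x v) = 0))))"

end

theory Submission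
  imports Defs
begin

text \<open>
  Let \<open>a\<^sub>m\<close> be the sum over \<open>k + l = m\<close> of the suprema of \<open>\<partial>\<^sub>x\<^sup>k \<partial>\<^sub>v\<^sup>l f / (k! l!)\<close>. The hybrid norm is
  \<open>\<Sum>\<^sub>m W\<^sub>m(L) a\<^sub>m\<close> with \<open>W\<^sub>m(L) = \<Sum>\<^sub>n (m choose n) L\<^bsup>m - n\<^esup> / n!\<close>, and the seminorm is its derivative in
  \<open>L\<close>. These weights form an Appell sequence, are submultiplicative, and satisfy
  \<open>i j W\<^bsub>i + j - 2\<^esub> \<le> W\<^sub>i' W\<^sub>j + W\<^sub>i W\<^sub>j'\<close>, so that a product of two first derivatives costs a single
  derivative in the norm. Free transport over time \<open>\<tau>\<close> multiplies \<open>a\<^sub>m\<close> by at most \<open>(1 + \<tau>)\<^sup>m\<close>; along the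
  shrinking radius \<open>\<lambda>(t)\<close> this growth is absorbed mode by mode, with a gain of \<open>K - \<lambda>\<^sub>0\<close> times the seminorm.

  Hence the explicit Picard iteration, with the whole force term as a source in Duhamel's formula, preserves
  the ball of radius \<open>M / 2\<close> for the norm plus \<open>K - \<lambda>\<^sub>0\<close> times the integrated seminorm. Differences of two
  iterates are measured with a slightly smaller radius, where the seminorms of the iterates are bounded
  uniformly in time; there the iteration contracts for an exponential weight in time. This gives both
  existence and uniqueness. Duhamel's formula is equivalent to the equation by differentiation along
  characteristics.
\<close>

section \<open>Weights of the hybrid norm\<close>

text \<open>Two facts lie behind the weights. Since \<open>n^2 / (n!)^2 = 1 / ((n - 1)!)^2\<close>,
  an index shift turns the seminorm into the derivative of the norm in the radius; a radius
  shrinking at speed \<open>K + 1\<close> thus yields a time-integrated seminorm, which pays for the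
  derivative lost in the force. And \<open>W L m\<close> is \<open>L^m\<close> times the Laguerre
  polynomial of degree \<open>m\<close> at \<open>-1/L\<close>; its inequalities come from the
  binomial form of these polynomials. The obstacle is the contraction: in a difference of two
  forces, the seminorm of an iterate multiplies the norm of the difference, and that seminorm is a
  priori known only integrated in time. At a radius smaller by \<open>eps\<close> it is bounded by
  \<open>M / eps\<close>, and an exponential weight absorbs it; \<open>K < lambda0 / T - 1\<close>
  leaves room for \<open>eps\<close>. The limit is found at the smaller radius, and Fatou's lemma
  returns its bounds at the full one. The other term of the difference,
  \<open>(2 + alpha0) P1 M\<close> times a seminorm, is covered by the gain
  \<open>K - lambda0\<close> because the former factor is below 1 and the latter at least 1.\<close>

definition W :: "real \<Rightarrow> nat \<Rightarrow> real" where
  "W L m = (\<Sum>n\<le>m. real (m choose n) * (L ^ (m - n) / fact n))"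

text \<open>Appell form of the derivative of \<open>W\<close> in \<open>L\<close>. At
  \<open>m = 0\<close> the truncated index \<open>m - 1\<close> is harmless because of the factor
  \<open>m\<close>.\<close>

definition W' :: "real \<Rightarrow> nat \<Rightarrow> real" where
  "W' L m = real m * W L (m - 1)"

lemma W_nonneg: "0 \<le> L \<Longrightarrow> 0 \<le> W L m"
  by (auto simp: W_def intro!: sum_nonneg)

lemma W'_nonneg: "0 \<le> L \<Longrightarrow> 0 \<le> W' L m"
  by (simp add: W'_def W_nonneg)

lemma W_0 [simp]: "W L 0 = 1"
  by (simp add: W_def)

lemma W'_0 [simp]: "W' L 0 = 0"
  by (simp add: W'_def)

text \<open>The term \<open>n = m\<close> carries no power of \<open>L\<close>, so even a norm of
  radius 0 controls every coefficient. This matters at the end of the time interval, where the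
  reduced radius vanishes.\<close>

lemma W_ge_inverse_fact:
  assumes "0 \<le> L"
  shows "1 / fact m \<le> W L m"
proof -
  have "real (m choose m) * (L ^ (m - m) / fact m) \<le> W L m"
    unfolding W_def using assms by (intro member_le_sum) auto
  then show ?thesis by simp
qed

text \<open>Pascal's rule in operator form: with \<open>E\<close> the shift of sequences,
  \<open>(1 + E)^(m + 1) = (1 + E)^m (1 + E)\<close>, evaluated on \<open>u\<close> at 0.\<close>

lemma binomial_sum_Suc:
  fixes u :: "nat \<Rightarrow> real"
  shows "(\<Sum>n\<le>Suc m. real (Suc m choose n) * u n) = (\<Sum>n\<le>m. real (m choose n) * (u n + u (Suc n)))"
proof -
  have "(\<Sum>n\<le>Suc m. real (Suc m choose n) * u n)
      = u 0 + (\<Sum>n\<le>m. (real (m choose n) + real (m choose Suc n)) * u (Suc n))"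
    by (subst sum.atMost_Suc_shift) simp
  also have "\<dots> = (u 0 + (\<Sum>n\<le>m. real (m choose Suc n) * u (Suc n))) + (\<Sum>n\<le>m. real (m choose n) * u (Suc n))"
    by (simp add: algebra_simps sum.distrib)
  also have "u 0 + (\<Sum>n\<le>m. real (m choose Suc n) * u (Suc n)) = (\<Sum>n\<le>Suc m. real (m choose n) * u n)"
    by (subst sum.atMost_Suc_shift) simp
  also have "\<dots> = (\<Sum>n\<le>m. real (m choose n) * u n)"
    by simp
  finally show ?thesis by (simp add: algebra_simps sum.distrib)
qed

text \<open>The same with \<open>(1 + E)^(i + j) = (1 + E)^i (1 + E)^j\<close>, a form of
  Vandermonde's identity valid for any sequence.\<close>

lemma binomial_sum_add:
  fixes u :: "nat \<Rightarrow> real"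
  shows "(\<Sum>n\<le>i + j. real (i + j choose n) * u n)
       = (\<Sum>p\<le>i. \<Sum>q\<le>j. real (i choose p) * real (j choose q) * u (p + q))"
proof (induction i arbitrary: u)
  case 0
  then show ?case by simp
next
  case (Suc i)
  have "(\<Sum>n\<le>Suc i + j. real (Suc i + j choose n) * u n)
      = (\<Sum>n\<le>i + j. real (i + j choose n) * (u n + u (Suc n)))"
    using binomial_sum_Suc[of "i + j" u] by (simp del: binomial_Suc_Suc)
  also have "\<dots> = (\<Sum>p\<le>i. \<Sum>q\<le>j. real (i choose p) * real (j choose q) * (u (p + q) + u (Suc (p + q))))"
    by (rule Suc)
  also have "\<dots> = (\<Sum>p\<le>i. real (i choose p) * ((\<Sum>q\<le>j. real (j choose q) * u (p + q))
        + (\<Sum>q\<le>j. real (j choose q) * u (Suc p + q))))"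
    by (simp add: sum_distrib_left sum.distrib algebra_simps)
  also have "\<dots> = (\<Sum>p\<le>Suc i. real (Suc i choose p) * (\<Sum>q\<le>j. real (j choose q) * u (p + q)))"
    by (rule binomial_sum_Suc[symmetric])
  finally show ?case by (simp add: sum_distrib_left mult.assoc del: binomial_Suc_Suc)
qed

lemma W_add_eq:
  "W L (i + j) = (\<Sum>p\<le>i. \<Sum>q\<le>j. real (i choose p) * real (j choose q) * (L ^ (i - p) * L ^ (j - q) / fact (p + q)))"
proof -
  have "L ^ (i + j - (p + q)) = L ^ (i - p) * L ^ (j - q)" if "p \<le> i" "q \<le> j" for p q
    using that by (simp add: power_add[symmetric])
  then show ?thesis
    unfolding W_def binomial_sum_add by (intro sum.cong refl) simp
qed

lemma fact_mult_le_fact_add: "fact p * fact q \<le> (fact (p + q) :: real)"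
proof -
  have "fact p * fact q dvd (fact (p + q) :: nat)"
    by (rule fact_fact_dvd_fact)
  then have "fact p * fact q \<le> (fact (p + q) :: nat)"
    by (rule dvd_imp_le) simp
  then have "real (fact p * fact q) \<le> real (fact (p + q))"
    by (simp only: of_nat_le_iff)
  then show ?thesis by simp
qed

lemma W_mult_eq:
  "W L i * W L j = (\<Sum>p\<le>i. \<Sum>q\<le>j. real (i choose p) * real (j choose q) * (L ^ (i - p) * L ^ (j - q) / (fact p * fact q)))"
  unfolding W_def sum_product by (intro sum.cong refl) (simp add: mult_ac)

text \<open>Both sides are the same double sum up to the denominators \<open>(p + q)!\<close> and
  \<open>p! q!\<close>.\<close>

lemma W_add_le:
  assumes "0 \<le> L"
  shows "W L (i + j) \<le> W L i * W L j"
  unfolding W_add_eq W_mult_eq using assms fact_mult_le_fact_add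
  by (intro sum_mono mult_left_mono divide_left_mono) auto

text \<open>Equality holds at \<open>p = 0\<close>. Raising \<open>p\<close> by one multiplies the
  binomial coefficient by \<open>(p + q + 3) / (p + 2)\<close> and the left side by only
  \<open>(p + 3) / (p + 2)\<close>.\<close>

lemma Suc_Suc_le_2_binomial: "(Suc p + 1) * (Suc q + 1) \<le> 2 * (Suc p + Suc q choose Suc p)"
proof (induction p)
  case 0
  then show ?case by (simp add: choose_one)
next
  case (Suc p)
  let ?N = "Suc p + Suc q"
  have "Suc (Suc p) * (Suc ?N choose Suc (Suc p)) = Suc ?N * (?N choose Suc p)"
    by (metis Suc_times_binomial_eq mult.commute)
  then have "Suc (Suc p) * (2 * (Suc ?N choose Suc (Suc p))) = Suc ?N * (2 * (?N choose Suc p))"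
    by (metis mult.left_commute)
  also have "\<dots> \<ge> Suc ?N * ((Suc p + 1) * (Suc q + 1))"
    using Suc by (rule mult_le_mono2)
  finally have "Suc ?N * ((Suc p + 1) * (Suc q + 1)) \<le> Suc (Suc p) * (2 * (Suc ?N choose Suc (Suc p)))" .
  moreover have "Suc (Suc p) * ((Suc (Suc p) + 1) * (Suc q + 1)) \<le> Suc ?N * ((Suc p + 1) * (Suc q + 1))"
    by (simp add: algebra_simps)
  ultimately have "Suc (Suc p) * ((Suc (Suc p) + 1) * (Suc q + 1)) \<le> Suc (Suc p) * (2 * (Suc ?N choose Suc (Suc p)))"
    by linarith
  then show ?case by (simp only: Suc_mult_le_cancel1 add_Suc)
qed

text \<open>If \<open>p\<close> or \<open>q\<close> is 0, one summand on the right is already 1.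
  Otherwise the preceding bound gives \<open>2 / (a b)\<close> with \<open>a = p + 1\<close>,
  \<open>b = q + 1\<close>, and \<open>2 / (a b)\<close> is at most the sum of the squared inverses.
  The sum form matters: each summand involves one index only.\<close>

lemma inverse_binomial_le:
  "1 / real (p + q choose p) \<le> 1 / (real (Suc p))\<^sup>2 + 1 / (real (Suc q))\<^sup>2"
proof (cases "p = 0 \<or> q = 0")
  case True
  then show ?thesis by auto
next
  case False
  then obtain p' q' where pq: "p = Suc p'" "q = Suc q'"
    by (metis not0_implies_Suc)
  let ?a = "real (Suc p)" and ?b = "real (Suc q)"
  have "(Suc p) * (Suc q) \<le> 2 * (p + q choose p)"
    using Suc_Suc_le_2_binomial[of p' q'] by (simp only: pq Suc_eq_plus1)
  then have "real ((Suc p) * (Suc q)) \<le> real (2 * (p + q choose p))"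
    by (simp only: of_nat_le_iff)
  then have "?a * ?b \<le> 2 * real (p + q choose p)"
    by (simp only: of_nat_mult of_nat_numeral)
  then have "1 / real (p + q choose p) \<le> 2 / (?a * ?b)"
    by (simp add: divide_simps mult_ac)
  also have "\<dots> \<le> 1 / ?a\<^sup>2 + 1 / ?b\<^sup>2"
  proof -
    have "0 \<le> (1 / ?a - 1 / ?b)\<^sup>2" by simp
    then show ?thesis by (simp add: power2_diff power_divide algebra_simps del: of_nat_Suc)
  qed
  finally show ?thesis .
qed

text \<open>In the double sum for \<open>W L (i + j)\<close>, write \<open>1 / (p + q)!\<close> as
  \<open>1 / (p! q!)\<close> over a binomial coefficient and split the latter's inverse. Each half
  improves one factor by \<open>1 / (q + 1)^2\<close> or \<open>1 / (p + 1)^2\<close>, enough to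
  raise that factor from index \<open>j\<close> or \<open>i\<close> to its successor without a
  derivative; the other factor becomes \<open>W'\<close>.\<close>

lemma W_derivatives_le:
  assumes "0 \<le> L"
  shows "real (Suc i) * real (Suc j) * W L (i + j)
       \<le> W' L (Suc i) * W L (Suc j) + W L (Suc i) * W' L (Suc j)"
proof -
  define e where "e i p = real (i choose p) * L ^ (i - p)" for i p
  have e0: "0 \<le> e i p" for i p using assms by (simp add: e_def)
  \<comment> \<open>By absorption, \<open>Z i\<close> is \<open>W L (Suc i)\<close> without its term
    \<open>n = 0\<close>.\<close>
  define Z where "Z i = (\<Sum>p\<le>i. real (Suc i) * e i p / (real (Suc p) * fact (Suc p)))" for i
  have Z: "Z i \<le> W L (Suc i)" for i
  proof -
    have "Z i = (\<Sum>p\<le>i. real (Suc i choose Suc p) * (L ^ (Suc i - Suc p) / fact (Suc p)))"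
      unfolding Z_def
    proof (intro sum.cong refl)
      fix p
      have "real (Suc p) * real (Suc i choose Suc p) = real (Suc i) * real (i choose p)"
        using Suc_times_binomial_eq[of i p] by (metis of_nat_mult mult.commute)
      then have "real (Suc i choose Suc p) = real (Suc i) * real (i choose p) / real (Suc p)"
        by (simp add: field_simps del: binomial_Suc_Suc of_nat_Suc)
      then show "real (Suc i) * e i p / (real (Suc p) * fact (Suc p))
          = real (Suc i choose Suc p) * (L ^ (Suc i - Suc p) / fact (Suc p))"
        by (simp add: e_def del: binomial_Suc_Suc of_nat_Suc fact_Suc)
    qed
    also have "\<dots> \<le> W L (Suc i)"
      unfolding W_def by (subst sum.atMost_Suc_shift) (use assms in simp)
    finally show ?thesis .
  qed
  have Wi: "W L i = (\<Sum>p\<le>i. e i p / fact p)" for i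
    by (simp add: W_def e_def)
  have "real (Suc i) * real (Suc j) * W L (i + j)
      = (\<Sum>p\<le>i. \<Sum>q\<le>j. real (Suc i) * real (Suc j) * (e i p * e j q) * (1 / fact (p + q)))"
    unfolding W_add_eq sum_distrib_left e_def by (intro sum.cong refl) simp
  also have "\<dots> \<le> (\<Sum>p\<le>i. \<Sum>q\<le>j. real (Suc i) * real (Suc j) * (e i p * e j q)
        * (1 / (fact p * (real (Suc q) * fact (Suc q))) + 1 / (real (Suc p) * fact (Suc p) * fact q)))"
  proof (intro sum_mono mult_left_mono)
    fix p q
    have b: "fact p * fact q * real (p + q choose p) = (fact (p + q) :: real)"
      using binomial_fact_lemma[of p "p + q"]
      by (metis add_diff_cancel_left' le_add1 of_nat_fact of_nat_mult)
    have "1 / fact (p + q) = 1 / (fact p * fact q) * (1 / real (p + q choose p))"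
      unfolding b[symmetric] by simp
    also have "\<dots> \<le> 1 / (fact p * fact q) * (1 / (real (Suc p))\<^sup>2 + 1 / (real (Suc q))\<^sup>2)"
      by (intro mult_left_mono inverse_binomial_le) simp
    \<comment> \<open>Here \<open>(q + 1)^2 q! = (q + 1) (q + 1)!\<close>, the denominator in
      \<open>Z\<close>.\<close>
    also have "\<dots> = 1 / (fact p * (real (Suc q) * fact (Suc q))) + 1 / (real (Suc p) * fact (Suc p) * fact q)"
      by (simp add: distrib_left power2_eq_square mult_ac del: of_nat_Suc)
    finally show "1 / fact (p + q) \<le> 1 / (fact p * (real (Suc q) * fact (Suc q))) + 1 / (real (Suc p) * fact (Suc p) * fact q)" .
  qed (use e0 in simp)
  also have "\<dots> = (\<Sum>p\<le>i. \<Sum>q\<le>j. (real (Suc i) * (e i p / fact p)) * (real (Suc j) * e j q / (real (Suc q) * fact (Suc q))))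
      + (\<Sum>p\<le>i. \<Sum>q\<le>j. (real (Suc i) * e i p / (real (Suc p) * fact (Suc p))) * (real (Suc j) * (e j q / fact q)))"
    unfolding sum.distrib[symmetric]
    by (intro sum.cong refl) (simp add: distrib_left mult_ac del: of_nat_Suc fact_Suc)
  also have "\<dots> = W' L (Suc i) * Z j + Z i * W' L (Suc j)"
    unfolding W'_def Z_def Wi diff_Suc_1 sum_distrib_left[of "real (Suc _)"] sum_product ..
  also have "\<dots> \<le> W' L (Suc i) * W L (Suc j) + W L (Suc i) * W' L (Suc j)"
    using assms by (intro add_mono mult_left_mono mult_right_mono Z W'_nonneg)
  finally show ?thesis .
qed

text \<open>The factor \<open>1 + L\<close> is \<open>W L 1\<close>. It is the price of the growth
  caused by transport and explains why the net gain is
  \<open>(K + 1) - (1 + lambda0)\<close>.\<close>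

lemma W_Suc_le:
  assumes "0 \<le> L"
  shows "W L (Suc m) \<le> (1 + L) * W L m"
proof -
  have "W L (Suc m) \<le> W L 1 * W L m"
    using W_add_le[OF assms, of 1 m] by simp
  also have "W L 1 = 1 + L" by (simp add: W_def)
  finally show ?thesis .
qed

lemma DERIV_W: "((\<lambda>L. W L m) has_real_derivative W' L m) (at L within S)"
proof -
  have "((\<lambda>L. W L m) has_real_derivative (\<Sum>n\<le>m. real (m choose n) * (real (m - n) * L ^ (m - n - 1) / fact n))) (at L within S)"
    unfolding W_def by (auto intro!: derivative_eq_intros sum.cong)
  also have "(\<Sum>n\<le>m. real (m choose n) * (real (m - n) * L ^ (m - n - 1) / fact n)) = W' L m"
  proof (cases m)
    case (Suc k)
    have "real (Suc k choose n) * real (Suc k - n) = real (Suc k) * real (k choose n)" for n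
    proof (cases "n \<le> k")
      case True
      have "(Suc k - n) * (Suc k choose n) = Suc k * (k choose n)"
        by (metis binomial_absorb_comp diff_Suc_1)
      then show ?thesis by (metis of_nat_mult mult.commute)
    qed (simp add: not_le)
    then have eq: "real (Suc k choose n) * (real (Suc k - n) * L ^ (Suc k - n - 1) / fact n)
        = real (Suc k) * (real (k choose n) * (L ^ (k - n) / fact n))" for n
      by (metis (no_types, opaque_lifting) Suc_diff_Suc diff_Suc_Suc diff_commute diff_diff_left mult.assoc plus_1_eq_Suc times_divide_eq_right)
    then show ?thesis
      unfolding W'_def W_def Suc sum_distrib_left eq by simp
  qed simp
  finally show ?thesis .
qed

lemma continuous_on_W [continuous_intros]:
  "continuous_on A f \<Longrightarrow> continuous_on A (\<lambda>x. W (f x) m)"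
  unfolding W_def by (intro continuous_intros) auto

lemma continuous_on_W' [continuous_intros]:
  "continuous_on A f \<Longrightarrow> continuous_on A (\<lambda>x. W' (f x) m)"
  unfolding W'_def by (intro continuous_intros)

lemma W_mono: "0 \<le> L \<Longrightarrow> L \<le> L' \<Longrightarrow> W L m \<le> W L' m"
  unfolding W_def by (intro sum_mono mult_left_mono divide_right_mono power_mono) auto

lemma W'_mono: "0 \<le> L \<Longrightarrow> L \<le> L' \<Longrightarrow> W' L m \<le> W' L' m"
  unfolding W'_def by (intro mult_left_mono W_mono) auto

text \<open>Mean value theorem between \<open>L\<close> and \<open>L + e\<close>, with
  \<open>W'\<close> increasing: a Cauchy estimate trading radius for a derivative.\<close>

lemma W'_le_W:
  assumes "0 \<le> L" "0 \<le> e"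
  shows "e * W' L m \<le> W (L + e) m"
proof (cases "e = 0")
  case False
  then have "L < L + e" using assms by simp
  then obtain z where z: "L < z" "z < L + e" "W (L + e) m - W L m = (L + e - L) * W' z m"
    using MVT2[of L "L + e" "\<lambda>L. W L m" "\<lambda>L. W' L m"] DERIV_W by blast
  have "e * W' L m \<le> e * W' z m"
    using assms z by (intro mult_left_mono W'_mono) auto
  also have "\<dots> \<le> W (L + e) m"
    using z(3) W_nonneg[OF assms(1), of m] by simp
  finally show ?thesis .
qed (use assms in \<open>simp add: W_nonneg\<close>)

section \<open>Weighted sequence norms and the energy inequality\<close>

definition wnorm :: "(nat \<Rightarrow> real) \<Rightarrow> (nat \<Rightarrow> ennreal) \<Rightarrow> ennreal" where
  "wnorm w a = (\<Sum>m. ennreal (w m) * a m)"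

lemma suminf_ennreal_swap: "(\<Sum>i. \<Sum>j. F i j) = (\<Sum>j. \<Sum>i. (F i j :: ennreal))"
proof -
  have "(\<Sum>i. \<Sum>j. F i j) = (\<Sum>i. \<integral>\<^sup>+j. F i j \<partial>count_space UNIV)"
    by (simp add: nn_integral_count_space_nat)
  also have "\<dots> = (\<integral>\<^sup>+j. (\<Sum>i. F i j) \<partial>count_space UNIV)"
    by (rule nn_integral_suminf[symmetric]) simp
  finally show ?thesis by (simp add: nn_integral_count_space_nat)
qed

text \<open>Cauchy-product rearrangement; with nonnegative extended terms no convergence condition
  arises.\<close>

lemma suminf_ennreal_triangle:
  fixes F :: "nat \<Rightarrow> nat \<Rightarrow> ennreal"
  shows "(\<Sum>m. \<Sum>i\<le>m. F i (m - i)) = (\<Sum>i. \<Sum>j. F i j)"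
proof -
  have "(\<Sum>m. \<Sum>i\<le>m. F i (m - i)) = (\<Sum>m. \<Sum>i. if i \<le> m then F i (m - i) else 0)"
  proof (intro suminf_cong)
    fix m
    show "(\<Sum>i\<le>m. F i (m - i)) = (\<Sum>i. if i \<le> m then F i (m - i) else 0)"
      by (subst suminf_finite[of "{..m}"]) auto
  qed
  also have "\<dots> = (\<Sum>i. \<Sum>m. if i \<le> m then F i (m - i) else 0)"
    by (rule suminf_ennreal_swap)
  also have "\<dots> = (\<Sum>i. \<Sum>j. F i j)"
  proof (rule suminf_cong)
    fix i
    show "(\<Sum>m. if i \<le> m then F i (m - i) else 0) = (\<Sum>j. F i j)"
      by (subst suminf_offset[where i = i]) auto
  qed
  finally show ?thesis .
qed

lemma wnorm_mono:
  "(\<And>m. w m \<le> w' m) \<Longrightarrow> (\<And>m. a m \<le> a' m) \<Longrightarrow> wnorm w a \<le> wnorm w' a'"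
  unfolding wnorm_def by (intro suminf_le mult_mono ennreal_leI) auto

lemma wnorm_add: "wnorm w (\<lambda>m. a m + b m) = wnorm w a + wnorm w b"
  unfolding wnorm_def distrib_left by (rule suminf_add[symmetric]) auto

lemma wnorm_cmult: "wnorm w (\<lambda>m. c * a m) = c * wnorm w a"
  unfolding wnorm_def by (simp add: mult.left_commute)

lemma le_wnorm: "ennreal (w m) * a m \<le> wnorm w a"
  unfolding wnorm_def using sum_le_suminf[of "\<lambda>m. ennreal (w m) * a m" "{m}"] by auto

lemma wnorm_conv_le:
  assumes w: "\<And>i j. w (i + j) \<le> u i * v j + u' i * v' j"
    and nn: "\<And>i. 0 \<le> u i" "\<And>i. 0 \<le> v i" "\<And>i. 0 \<le> u' i" "\<And>i. 0 \<le> v' i"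
  shows "wnorm w (\<lambda>m. \<Sum>i\<le>m. a i * b (m - i)) \<le> wnorm u a * wnorm v b + wnorm u' a * wnorm v' b"
proof -
  have "wnorm w (\<lambda>m. \<Sum>i\<le>m. a i * b (m - i))
      = (\<Sum>m. \<Sum>i\<le>m. ennreal (w (i + (m - i))) * (a i * b (m - i)))"
    unfolding wnorm_def by (intro suminf_cong) (simp add: sum_distrib_left)
  also have "\<dots> = (\<Sum>i. \<Sum>j. ennreal (w (i + j)) * (a i * b j))"
    by (rule suminf_ennreal_triangle)
  also have "\<dots> \<le> (\<Sum>i. \<Sum>j. (ennreal (u i) * a i) * (ennreal (v j) * b j) + (ennreal (u' i) * a i) * (ennreal (v' j) * b j))"
  proof (intro suminf_le summableI)
    fix i j
    have "ennreal (w (i + j)) \<le> ennreal (u i) * ennreal (v j) + ennreal (u' i) * ennreal (v' j)"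
      using ennreal_leI[OF w[of i j]] nn by (simp add: ennreal_plus ennreal_mult)
    then have "ennreal (w (i + j)) * (a i * b j)
        \<le> (ennreal (u i) * ennreal (v j) + ennreal (u' i) * ennreal (v' j)) * (a i * b j)"
      by (rule mult_right_mono) simp
    then show "ennreal (w (i + j)) * (a i * b j)
        \<le> (ennreal (u i) * a i) * (ennreal (v j) * b j) + (ennreal (u' i) * a i) * (ennreal (v' j) * b j)"
      by (simp add: distrib_right distrib_left mult_ac)
  qed
  also have "\<dots> = (\<Sum>i. (ennreal (u i) * a i) * wnorm v b + (ennreal (u' i) * a i) * wnorm v' b)"
    unfolding wnorm_def ennreal_suminf_cmult[symmetric] by (intro suminf_cong suminf_add[symmetric]) auto
  also have "\<dots> = wnorm u a * wnorm v b + wnorm u' a * wnorm v' b"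
    unfolding wnorm_def ennreal_suminf_multc[symmetric] by (intro suminf_add[symmetric]) auto
  finally show ?thesis .
qed

lemma wnorm_W_conv:
  assumes "0 \<le> L"
  shows "wnorm (W L) (\<lambda>m. \<Sum>i\<le>m. a i * b (m - i)) \<le> wnorm (W L) a * wnorm (W L) b"
proof -
  have "wnorm (W L) (\<lambda>m. \<Sum>i\<le>m. a i * b (m - i))
      \<le> wnorm (W L) a * wnorm (W L) b + wnorm (\<lambda>_. 0) a * wnorm (\<lambda>_. 0) b"
    using assms by (intro wnorm_conv_le) (auto simp: W_add_le W_nonneg)
  then show ?thesis by (simp add: wnorm_def)
qed

text \<open>Split the factor \<open>i + j\<close> of \<open>W'\<close> and lower the index in the
  matching summand before using submultiplicativity. The case distinction keeps \<open>i - 1\<close>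
  and \<open>j - 1\<close> genuine.\<close>

lemma W'_add_le:
  assumes "0 \<le> L"
  shows "W' L (i + j) \<le> W' L i * W L j + W L i * W' L j"
proof (cases i; cases j)
  fix i' j' assume "i = Suc i'" "j = Suc j'"
  then have "W' L (i + j) = real i * W L (i' + j) + real j * W L (i + j')"
    by (simp add: W'_def distrib_right)
  also have "\<dots> \<le> real i * (W L i' * W L j) + real j * (W L i * W L j')"
    using assms by (intro add_mono mult_left_mono W_add_le) auto
  finally show ?thesis using \<open>i = _\<close> \<open>j = _\<close> by (simp add: W'_def mult_ac)
qed auto

lemma wnorm_W'_conv:
  assumes "0 \<le> L"
  shows "wnorm (W' L) (\<lambda>m. \<Sum>i\<le>m. a i * b (m - i))
    \<le> wnorm (W' L) a * wnorm (W L) b + wnorm (W L) a * wnorm (W' L) b"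
  using assms by (intro wnorm_conv_le) (auto simp: W'_add_le W_nonneg W'_nonneg)

text \<open>Differentiation sends \<open>a i\<close> to \<open>(i + 1) a (i + 1)\<close>; the
  shifted weight is divided by exactly this factor. Only the term of index 0 is lost.\<close>

lemma wnorm_shift_le:
  assumes "\<And>i. 0 \<le> w i"
  shows "wnorm (\<lambda>i. w (Suc i) / real (Suc i)) (\<lambda>i. of_nat (Suc i) * a (Suc i)) \<le> wnorm w a"
proof -
  have "wnorm (\<lambda>i. w (Suc i) / real (Suc i)) (\<lambda>i. of_nat (Suc i) * a (Suc i))
      = (\<Sum>i. ennreal (w (Suc i)) * a (Suc i))"
    unfolding wnorm_def
  proof (intro suminf_cong)
    fix i
    have "ennreal (w (Suc i) / real (Suc i)) * of_nat (Suc i) = ennreal (w (Suc i) / real (Suc i) * real (Suc i))"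
      by (subst ennreal_mult) (use assms in \<open>auto simp: ennreal_of_nat_eq_real_of_nat\<close>)
    then show "ennreal (w (Suc i) / real (Suc i)) * (of_nat (Suc i) * a (Suc i)) = ennreal (w (Suc i)) * a (Suc i)"
      by (simp add: mult.assoc[symmetric] del: of_nat_Suc)
  qed
  also have "\<dots> \<le> wnorm w a"
    unfolding wnorm_def by (subst (2) suminf_offset[where i = 1]) auto
  finally show ?thesis .
qed

lemma wnorm_W_shift:
  assumes "0 \<le> L"
  shows "wnorm (W L) (\<lambda>i. of_nat (Suc i) * a (Suc i)) \<le> wnorm (W' L) a"
  using wnorm_shift_le[of "W' L" a] W'_nonneg[OF assms] by (simp add: W'_def del: of_nat_Suc)

lemma wnorm_W_conv_shift:
  assumes "0 \<le> L"
  shows "wnorm (W L) (\<lambda>m. \<Sum>i\<le>m. (of_nat (Suc i) * a (Suc i)) * (of_nat (Suc (m - i)) * b (Suc (m - i))))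
    \<le> wnorm (W' L) a * wnorm (W L) b + wnorm (W L) a * wnorm (W' L) b"
proof -
  let ?s = "\<lambda>w i. w (Suc i) / real (Suc i)" and ?a = "\<lambda>a i. of_nat (Suc i) * a (Suc i) :: ennreal"
  note nn = W_nonneg[OF assms] W'_nonneg[OF assms]
  have "W L (i + j) \<le> ?s (W' L) i * ?s (W L) j + ?s (W L) i * ?s (W' L) j" for i j
    using W_derivatives_le[OF assms, of i j]
    by (simp add: divide_simps mult_ac del: of_nat_Suc)
  then have "wnorm (W L) (\<lambda>m. \<Sum>i\<le>m. ?a a i * ?a b (m - i))
    \<le> wnorm (?s (W' L)) (?a a) * wnorm (?s (W L)) (?a b) + wnorm (?s (W L)) (?a a) * wnorm (?s (W' L)) (?a b)"
    by (rule wnorm_conv_le) (use nn in auto)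
  also have "\<dots> \<le> wnorm (W' L) a * wnorm (W L) b + wnorm (W L) a * wnorm (W' L) b"
    by (intro add_mono mult_mono wnorm_shift_le nn) auto
  finally show ?thesis .
qed

lemma wnorm_W'_le_W:
  assumes "0 \<le> L" "0 \<le> e"
  shows "ennreal e * wnorm (W' L) a \<le> wnorm (W (L + e)) a"
proof -
  have "ennreal e * wnorm (W' L) a = wnorm (\<lambda>m. e * W' L m) a"
    unfolding wnorm_def ennreal_suminf_cmult[symmetric] using assms
    by (intro suminf_cong) (simp add: ennreal_mult W'_nonneg mult.assoc)
  also have "\<dots> \<le> wnorm (W (L + e)) a"
    using assms by (intro wnorm_mono W'_le_W) auto
  finally show ?thesis .
qed

text \<open>The function \<open>(1 + (r - s))^m W(lam r)_m\<close> of \<open>r\<close> decreases at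
  least at the rate \<open>K - L0\<close> times the same expression with \<open>W'\<close>;
  integrating this from \<open>s\<close> to \<open>t\<close> gives the claim.\<close>

lemma mode_decay:
  fixes K L0 l0 s t :: real
  defines "lam \<equiv> \<lambda>t. l0 - (K + 1) * t"
  assumes st: "0 \<le> s" "s \<le> t" and lam0: "0 \<le> lam t" and l0: "l0 \<le> L0" and K: "0 \<le> K" "L0 \<le> K"
  shows "ennreal ((1 + (t - s)) ^ m * W (lam t) m)
    + ennreal (K - L0) * (\<integral>\<^sup>+r\<in>{s..t}. ennreal ((1 + (r - s)) ^ m * W' (lam r) m) \<partial>lborel)
    \<le> ennreal (W (lam s) m)"
proof -
  define \<phi> where "\<phi> r = (1 + (r - s)) ^ m * W (lam r) m" for r
  define \<phi>' where "\<phi>' r = real m * (1 + (r - s)) ^ (m - 1) * W (lam r) m - (K + 1) * ((1 + (r - s)) ^ m * W' (lam r) m)" for r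
  have deriv: "(\<phi> has_real_derivative \<phi>' r) (at r within S)" for r S
  proof -
    have "((\<lambda>r. W (lam r) m) has_real_derivative W' (lam r) m * (- (K + 1))) (at r within S)"
      unfolding lam_def by (rule DERIV_chain2[OF DERIV_W]) (auto intro!: derivative_eq_intros)
    then show ?thesis
      unfolding \<phi>_def \<phi>'_def by (auto intro!: derivative_eq_intros simp: algebra_simps)
  qed
  have lamr: "0 \<le> lam r" "lam r \<le> L0" if "s \<le> r" "r \<le> t" for r
  proof -
    have "(K + 1) * r \<le> (K + 1) * t" "0 \<le> (K + 1) * r"
      using that st K by (auto intro!: mult_left_mono)
    then show "0 \<le> lam r" "lam r \<le> L0" using lam0 l0 by (auto simp: lam_def)
  qed
  \<comment> \<open>The transport factor contributes \<open>m W_m\<close>, at most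
    \<open>(1 + L0) m W_(m-1) = (1 + L0) W'_m\<close>, while the shrinking radius contributes
    \<open>-(K + 1) W'_m\<close>. The change from exponent \<open>m - 1\<close> to \<open>m\<close>
    uses that the base is at least 1.\<close>
  have neg: "(K - L0) * ((1 + (r - s)) ^ m * W' (lam r) m) \<le> - \<phi>' r" if r: "s \<le> r" "r \<le> t" for r
  proof (cases m)
    case (Suc k)
    let ?x = "1 + (r - s)"
    have "?x ^ k * W (lam r) m \<le> ?x ^ m * ((1 + L0) * W (lam r) k)"
    proof (intro mult_mono)
      have "W (lam r) m \<le> (1 + lam r) * W (lam r) k"
        unfolding Suc using lamr[OF r] by (intro W_Suc_le) auto
      also have "\<dots> \<le> (1 + L0) * W (lam r) k"
        using lamr[OF r] by (intro mult_right_mono W_nonneg) auto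
      finally show "W (lam r) m \<le> (1 + L0) * W (lam r) k" .
    qed (use r lamr[OF r] in \<open>auto simp: Suc W_nonneg intro!: power_increasing\<close>)
    then have "real m * (?x ^ k * W (lam r) m) \<le> real m * (?x ^ m * ((1 + L0) * W (lam r) k))"
      by (rule mult_left_mono) simp
    then show ?thesis
      unfolding \<phi>'_def W'_def using Suc by (simp add: algebra_simps)
  qed (simp add: \<phi>'_def)
  have W'r: "0 \<le> (1 + (r - s)) ^ m * W' (lam r) m" if "s \<le> r" "r \<le> t" for r
    using that lamr[OF that] by (intro mult_nonneg_nonneg W'_nonneg) auto
  have meas: "(\<lambda>r. ennreal ((1 + (r - s)) ^ m * W' (lam r) m) * indicator {s..t} r) \<in> borel_measurable lborel"
  proof -
    have "continuous_on UNIV (\<lambda>r. (1 + (r - s)) ^ m * W' (lam r) m)"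
      unfolding lam_def by (intro continuous_intros)
    then have "(\<lambda>r. (1 + (r - s)) ^ m * W' (lam r) m) \<in> borel_measurable borel"
      by (rule borel_measurable_continuous_onI)
    then show ?thesis by simp
  qed
  have "ennreal (K - L0) * (\<integral>\<^sup>+r\<in>{s..t}. ennreal ((1 + (r - s)) ^ m * W' (lam r) m) \<partial>lborel)
      = (\<integral>\<^sup>+r. ennreal (K - L0) * (ennreal ((1 + (r - s)) ^ m * W' (lam r) m) * indicator {s..t} r) \<partial>lborel)"
    using meas by (rule nn_integral_cmult[symmetric])
  also have "\<dots> \<le> (\<integral>\<^sup>+r. ennreal (- \<phi>' r) * indicator {s..t} r \<partial>lborel)"
  proof (intro nn_integral_mono)
    fix r
    show "ennreal (K - L0) * (ennreal ((1 + (r - s)) ^ m * W' (lam r) m) * indicator {s..t} r)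
        \<le> ennreal (- \<phi>' r) * indicator {s..t} r"
      using neg[of r] W'r[of r] K by (auto simp: indicator_def ennreal_mult[symmetric] intro!: ennreal_leI)
  qed
  also have "\<dots> = ennreal (- \<phi> t - (- \<phi> s))"
  proof (rule nn_integral_has_integral_lebesgue')
    show "((\<lambda>r. - \<phi>' r) has_integral (- \<phi> t - (- \<phi> s))) {s..t}"
    proof (rule fundamental_theorem_of_calculus[OF st(2)])
      show "((\<lambda>r. - \<phi> r) has_vector_derivative - \<phi>' r) (at r within {s..t})" for r
        using deriv[of r "{s..t}"]
        by (auto simp: has_real_derivative_iff_has_vector_derivative intro!: derivative_intros)
    qed
    show "0 \<le> - \<phi>' r" if "r \<in> {s..t}" for r
      using neg[of r] W'r[of r] K that by (smt (verit) mult_nonneg_nonneg atLeastAtMost_iff)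
  qed
  finally have "ennreal (K - L0) * (\<integral>\<^sup>+r\<in>{s..t}. ennreal ((1 + (r - s)) ^ m * W' (lam r) m) \<partial>lborel) \<le> ennreal (\<phi> s - \<phi> t)"
    by simp
  then have "ennreal (\<phi> t) + ennreal (K - L0) * (\<integral>\<^sup>+r\<in>{s..t}. ennreal ((1 + (r - s)) ^ m * W' (lam r) m) \<partial>lborel) \<le> ennreal (\<phi> t) + ennreal (\<phi> s - \<phi> t)"
    by (rule add_left_mono)
  also have "\<dots> = ennreal (\<phi> s)"
  proof (subst ennreal_plus[symmetric])
    show "0 \<le> \<phi> t" unfolding \<phi>_def using lamr[of t] st by (intro mult_nonneg_nonneg W_nonneg) auto
    \<comment> \<open>Without monotonicity \<open>ennreal\<close> would truncate
      \<open>\<phi> s - \<phi> t\<close> at 0 and the sum could exceed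
      \<open>\<phi> s\<close>.\<close>
    have "\<phi> t \<le> \<phi> s"
    proof (rule DERIV_nonpos_imp_nonincreasing[OF st(2)])
      fix r assume "s \<le> r" "r \<le> t"
      then show "\<exists>y. (\<phi> has_real_derivative y) (at r) \<and> y \<le> 0"
        using deriv[of r UNIV] neg[of r] W'r[of r] K by (intro exI[of _ "\<phi>' r"]) (smt (verit) mult_nonneg_nonneg)
    qed
    then show "0 \<le> \<phi> s - \<phi> t" by simp
  qed simp
  finally show ?thesis by (simp add: \<phi>_def)
qed

text \<open>Insert the bound on \<open>A\<close> in both terms, exchange the order of integration,
  and collect what multiplies \<open>f s\<close>: it is the left side of \<open>mode_decay\<close>
  started at time \<open>s\<close>. The initial amplitude is the case of start at time 0.\<close>

lemma mode_energy:
  fixes K L0 l0 t :: real and A f :: "real \<Rightarrow> ennreal" and a0 :: ennreal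
  defines "lam \<equiv> \<lambda>t. l0 - (K + 1) * t"
  assumes t: "0 \<le> t" and lam0: "0 \<le> lam t" and l0: "l0 \<le> L0" and K: "0 \<le> K" "L0 \<le> K"
    and f [measurable]: "f \<in> borel_measurable borel"
    and A: "\<And>r. 0 \<le> r \<Longrightarrow> r \<le> t \<Longrightarrow> A r \<le> ennreal ((1 + r) ^ m) * a0
          + (\<integral>\<^sup>+s\<in>{0..r}. ennreal ((1 + (r - s)) ^ m) * f s \<partial>lborel)"
  shows "ennreal (W (lam t) m) * A t + ennreal (K - L0) * (\<integral>\<^sup>+r\<in>{0..t}. ennreal (W' (lam r) m) * A r \<partial>lborel)
    \<le> ennreal (W l0 m) * a0 + (\<integral>\<^sup>+s\<in>{0..t}. ennreal (W (lam s) m) * f s \<partial>lborel)"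
proof -
  have cW': "continuous_on UNIV (\<lambda>r. W' (lam r) m)" and cW: "continuous_on UNIV (\<lambda>r. W (lam r) m)"
    unfolding lam_def by (intro continuous_intros)+
  note [measurable] = borel_measurable_continuous_onI[OF cW'] borel_measurable_continuous_onI[OF cW]
  have lamr: "0 \<le> lam r" if "0 \<le> r" "r \<le> t" for r
  proof -
    have "(K + 1) * r \<le> (K + 1) * t"
      using that K by (auto intro!: mult_left_mono)
    then show ?thesis using lam0 by (simp add: lam_def)
  qed
  let ?P = "\<lambda>s r. ennreal ((1 + (r - s)) ^ m)"
  let ?k = "ennreal (K - L0)"
  let ?I = "\<lambda>s. (\<integral>\<^sup>+r\<in>{s..t}. ennreal ((1 + (r - s)) ^ m * W' (lam r) m) \<partial>lborel)"
  have prod: "ennreal (W' (lam r) m) * ?P s r = ennreal ((1 + (r - s)) ^ m * W' (lam r) m)"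
    if "0 \<le> s" "s \<le> r" "r \<le> t" for r s
    using that lamr[of r] by (subst ennreal_mult) (auto simp: W'_nonneg mult.commute)
  have prodW: "ennreal (W (lam t) m) * ?P s t = ennreal ((1 + (t - s)) ^ m * W (lam t) m)"
    if "0 \<le> s" "s \<le> t" for s
    using that lam0 by (subst ennreal_mult) (auto simp: W_nonneg mult.commute)
  have one: "(\<integral>\<^sup>+r\<in>{0..t}. ennreal (W' (lam r) m) * A r \<partial>lborel)
      \<le> ?I 0 * a0 + (\<integral>\<^sup>+s\<in>{0..t}. ?I s * f s \<partial>lborel)"
  proof -
    have "(\<integral>\<^sup>+r\<in>{0..t}. ennreal (W' (lam r) m) * A r \<partial>lborel)
      \<le> (\<integral>\<^sup>+r. (ennreal ((1 + (r - 0)) ^ m * W' (lam r) m) * indicator {0..t} r) * a0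
            + (\<integral>\<^sup>+s. indicator {0..t} r * (ennreal (W' (lam r) m) * (?P s r * f s * indicator {0..r} s)) \<partial>lborel) \<partial>lborel)"
    proof (intro nn_integral_mono)
      fix r
      show "ennreal (W' (lam r) m) * A r * indicator {0..t} r
        \<le> (ennreal ((1 + (r - 0)) ^ m * W' (lam r) m) * indicator {0..t} r) * a0
            + (\<integral>\<^sup>+s. indicator {0..t} r * (ennreal (W' (lam r) m) * (?P s r * f s * indicator {0..r} s)) \<partial>lborel)"
      proof (cases "r \<in> {0..t}")
        case True
        then have "ennreal (W' (lam r) m) * A r \<le> ennreal (W' (lam r) m) *
            (ennreal ((1 + r) ^ m) * a0 + (\<integral>\<^sup>+s\<in>{0..r}. ?P s r * f s \<partial>lborel))"
          by (intro mult_left_mono A) auto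
        also have "\<dots> = (ennreal (W' (lam r) m) * ?P 0 r) * a0
            + (\<integral>\<^sup>+s. ennreal (W' (lam r) m) * (?P s r * f s * indicator {0..r} s) \<partial>lborel)"
          by (subst nn_integral_cmult) (auto simp: distrib_left mult_ac)
        finally show ?thesis using True prod[of 0 r] by (simp add: mult_ac)
      qed simp
    qed
    also have "\<dots> = ?I 0 * a0 + (\<integral>\<^sup>+r. (\<integral>\<^sup>+s. indicator {0..t} r * (ennreal (W' (lam r) m) * (?P s r * f s * indicator {0..r} s)) \<partial>lborel) \<partial>lborel)"
    proof (subst nn_integral_add)
      \<comment> \<open>The indicator depends on \<open>r\<close> and \<open>s\<close> together; as
        a condition on the pair its joint measurability is visible.\<close>
      have eq: "indicator {0..r} s = (if 0 \<le> s \<and> s \<le> r then 1 else 0 :: ennreal)" for r s :: real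
        by (auto simp: indicator_def)
      show "(\<lambda>r. \<integral>\<^sup>+ s. indicator {0..t} r * (ennreal (W' (lam r) m) * (?P s r * f s * indicator {0..r} s)) \<partial>lborel) \<in> borel_measurable lborel"
        unfolding eq by measurable
    qed (auto intro!: nn_integral_multc)
    \<comment> \<open>Tonelli on the triangle \<open>0 \<le> s \<le> r \<le> t\<close>.\<close>
    also have "(\<integral>\<^sup>+r. (\<integral>\<^sup>+s. indicator {0..t} r * (ennreal (W' (lam r) m) * (?P s r * f s * indicator {0..r} s)) \<partial>lborel) \<partial>lborel)
        = (\<integral>\<^sup>+s. (\<integral>\<^sup>+r. indicator {0..t} r * (ennreal (W' (lam r) m) * (?P s r * f s * indicator {0..r} s)) \<partial>lborel) \<partial>lborel)"
    proof (rule lborel_pair.Fubini')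
      have eq: "indicator {0..r} s = (if 0 \<le> s \<and> s \<le> r then 1 else 0 :: ennreal)" for r s :: real
        by (auto simp: indicator_def)
      show "(\<lambda>(s, r). indicator {0..t} r * (ennreal (W' (lam r) m) * (?P s r * f s * indicator {0..r} s)))
          \<in> borel_measurable (lborel \<Otimes>\<^sub>M lborel)"
        unfolding eq by measurable
    qed
    also have "\<dots> = (\<integral>\<^sup>+s\<in>{0..t}. ?I s * f s \<partial>lborel)"
    proof (intro nn_integral_cong)
      fix s
      have "(\<integral>\<^sup>+r. indicator {0..t} r * (ennreal (W' (lam r) m) * (?P s r * f s * indicator {0..r} s)) \<partial>lborel)
          = (\<integral>\<^sup>+r. (ennreal ((1 + (r - s)) ^ m * W' (lam r) m) * indicator {s..t} r) * (f s * indicator {0..t} s) \<partial>lborel)"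
      proof (intro nn_integral_cong)
        fix r
        show "indicator {0..t} r * (ennreal (W' (lam r) m) * (?P s r * f s * indicator {0..r} s))
            = (ennreal ((1 + (r - s)) ^ m * W' (lam r) m) * indicator {s..t} r) * (f s * indicator {0..t} s)"
        proof (cases "0 \<le> s \<and> s \<le> r \<and> r \<le> t")
          case True
          then have "indicator {0..t} r * (ennreal (W' (lam r) m) * (?P s r * f s * indicator {0..r} s))
            = (ennreal (W' (lam r) m) * ?P s r) * f s"
            by (simp add: mult_ac)
          with True show ?thesis by (simp add: prod)
        qed (auto simp: indicator_def)
      qed
      also have "\<dots> = ?I s * (f s * indicator {0..t} s)"
        by (intro nn_integral_multc) auto
      finally show "(\<integral>\<^sup>+r. indicator {0..t} r * (ennreal (W' (lam r) m) * (?P s r * f s * indicator {0..r} s)) \<partial>lborel)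
        = ?I s * f s * indicator {0..t} s" by (simp add: mult_ac)
    qed
    finally show ?thesis .
  qed
  have two: "ennreal (W (lam t) m) * A t \<le> ennreal ((1 + (t - 0)) ^ m * W (lam t) m) * a0
      + (\<integral>\<^sup>+s\<in>{0..t}. ennreal ((1 + (t - s)) ^ m * W (lam t) m) * f s \<partial>lborel)"
  proof -
    have "ennreal (W (lam t) m) * A t \<le> ennreal (W (lam t) m) *
        (ennreal ((1 + t) ^ m) * a0 + (\<integral>\<^sup>+s\<in>{0..t}. ?P s t * f s \<partial>lborel))"
      using t by (intro mult_left_mono A) auto
    also have "\<dots> = (ennreal (W (lam t) m) * ?P 0 t) * a0 + (\<integral>\<^sup>+s. ennreal (W (lam t) m) * (?P s t * f s * indicator {0..t} s) \<partial>lborel)"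
      by (subst nn_integral_cmult) (auto simp: distrib_left mult_ac)
    also have "(\<integral>\<^sup>+s. ennreal (W (lam t) m) * (?P s t * f s * indicator {0..t} s) \<partial>lborel)
        = (\<integral>\<^sup>+s\<in>{0..t}. ennreal ((1 + (t - s)) ^ m * W (lam t) m) * f s \<partial>lborel)"
    proof (intro nn_integral_cong)
      fix s
      show "ennreal (W (lam t) m) * (?P s t * f s * indicator {0..t} s)
          = ennreal ((1 + (t - s)) ^ m * W (lam t) m) * f s * indicator {0..t} s"
        using prodW[of s] by (auto simp: indicator_def mult.assoc[symmetric])
    qed
    finally show ?thesis using prodW[of 0] t by simp
  qed
  have decay: "ennreal ((1 + (t - s)) ^ m * W (lam t) m) + ?k * ?I s \<le> ennreal (W (lam s) m)"
    if "0 \<le> s" "s \<le> t" for s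
    using mode_decay[of s t l0 K L0 m] that lam0 l0 K by (simp add: lam_def)
  have measI: "(\<lambda>s. ?I s * f s * indicator {0..t} s) \<in> borel_measurable lborel"
  proof -
    have eq: "indicator {s..t} r = (if s \<le> r \<and> r \<le> t then 1 else 0 :: ennreal)" for r s :: real
      by (auto simp: indicator_def)
    show ?thesis unfolding eq by measurable
  qed
  have "ennreal (W (lam t) m) * A t + ?k * (\<integral>\<^sup>+r\<in>{0..t}. ennreal (W' (lam r) m) * A r \<partial>lborel)
      \<le> (ennreal ((1 + (t - 0)) ^ m * W (lam t) m) * a0
          + (\<integral>\<^sup>+s\<in>{0..t}. ennreal ((1 + (t - s)) ^ m * W (lam t) m) * f s \<partial>lborel))
        + ?k * (?I 0 * a0 + (\<integral>\<^sup>+s\<in>{0..t}. ?I s * f s \<partial>lborel))"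
    by (intro add_mono mult_left_mono one two) auto
  also have "\<dots> = (ennreal ((1 + (t - 0)) ^ m * W (lam t) m) + ?k * ?I 0) * a0
      + ((\<integral>\<^sup>+s\<in>{0..t}. ennreal ((1 + (t - s)) ^ m * W (lam t) m) * f s \<partial>lborel)
        + (\<integral>\<^sup>+s. ?k * (?I s * f s * indicator {0..t} s) \<partial>lborel))"
    by (subst nn_integral_cmult[OF measI]) (simp add: distrib_left distrib_right mult_ac add_ac)
  also have "(\<integral>\<^sup>+s\<in>{0..t}. ennreal ((1 + (t - s)) ^ m * W (lam t) m) * f s \<partial>lborel)
        + (\<integral>\<^sup>+s. ?k * (?I s * f s * indicator {0..t} s) \<partial>lborel)
      = (\<integral>\<^sup>+s. ennreal ((1 + (t - s)) ^ m * W (lam t) m) * f s * indicator {0..t} s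
          + ?k * (?I s * f s * indicator {0..t} s) \<partial>lborel)"
    by (rule nn_integral_add[symmetric]) (use measI in auto)
  also have "(ennreal ((1 + (t - 0)) ^ m * W (lam t) m) + ?k * ?I 0) * a0 + \<dots>
     \<le> ennreal (W l0 m) * a0 + (\<integral>\<^sup>+s\<in>{0..t}. ennreal (W (lam s) m) * f s \<partial>lborel)"
  proof (intro add_mono mult_right_mono nn_integral_mono)
    show "ennreal ((1 + (t - 0)) ^ m * W (lam t) m) + ?k * ?I 0 \<le> ennreal (W l0 m)"
      using decay[of 0] t by (simp add: lam_def)
    fix s
    show "ennreal ((1 + (t - s)) ^ m * W (lam t) m) * f s * indicator {0..t} s
          + ?k * (?I s * f s * indicator {0..t} s) \<le> ennreal (W (lam s) m) * f s * indicator {0..t} s"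
    proof (cases "s \<in> {0..t}")
      case True
      then have "(ennreal ((1 + (t - s)) ^ m * W (lam t) m) + ?k * ?I s) * f s \<le> ennreal (W (lam s) m) * f s"
        by (intro mult_right_mono decay) auto
      with True show ?thesis by (simp add: distrib_right distrib_left mult_ac)
    qed simp
  qed simp
  finally show ?thesis .
qed

section \<open>Jets of smooth functions\<close>

abbreviation cf :: "'a fps fps \<Rightarrow> nat \<Rightarrow> nat \<Rightarrow> 'a" where
  "cf A k l \<equiv> fps_nth (fps_nth A k) l"

text \<open>A jet assigns to \<open>(p, x, v)\<close> the Taylor series of a function of \<open>(x, v)\<close> depending on a parameter
  \<open>p\<close> (usually time): the coefficient \<open>cf J k l\<close> is \<open>\<partial>\<^sub>x\<^sup>k \<partial>\<^sub>v\<^sup>l f / (k! l!)\<close>. Products of functions are then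
  products of formal power series, without binomial coefficients.\<close>

definition smooth_jet :: "('p::topological_space \<Rightarrow> real \<Rightarrow> real \<Rightarrow> real fps fps) \<Rightarrow> bool" where
  "smooth_jet J \<longleftrightarrow> (\<forall>k l. continuous_on UNIV (\<lambda>(p, x, v). cf (J p x v) k l) \<and>
     (\<forall>p x v. ((\<lambda>y. cf (J p y v) k l) has_real_derivative real (Suc k) * cf (J p x v) (Suc k) l) (at x) \<and>
       ((\<lambda>w. cf (J p x w) k l) has_real_derivative real (Suc l) * cf (J p x v) k (Suc l)) (at v)))"

lemma smooth_jetD:
  assumes "smooth_jet J"
  shows smooth_jet_continuous: "continuous_on UNIV (\<lambda>(p, x, v). cf (J p x v) k l)"
    and smooth_jet_x: "((\<lambda>y. cf (J p y v) k l) has_real_derivative real (Suc k) * cf (J p x v) (Suc k) l) (at x)"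
    and smooth_jet_v: "((\<lambda>w. cf (J p x w) k l) has_real_derivative real (Suc l) * cf (J p x v) k (Suc l)) (at v)"
  using assms unfolding smooth_jet_def by blast+

lemma smooth_jetI:
  assumes "\<And>k l. continuous_on UNIV (\<lambda>(p, x, v). cf (J p x v) k l)"
    and "\<And>p x v k l. ((\<lambda>y. cf (J p y v) k l) has_real_derivative real (Suc k) * cf (J p x v) (Suc k) l) (at x)"
    and "\<And>p x v k l. ((\<lambda>w. cf (J p x w) k l) has_real_derivative real (Suc l) * cf (J p x v) k (Suc l)) (at v)"
  shows "smooth_jet J"
  unfolding smooth_jet_def using assms by blast

lemma smooth_jet_continuous_on:
  assumes "smooth_jet J" "continuous_on S f" "continuous_on S g" "continuous_on S h"
  shows "continuous_on S (\<lambda>z. cf (J (f z) (g z) (h z)) k l)"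
  using continuous_on_compose2[OF smooth_jet_continuous[OF assms(1), of k l], of S "\<lambda>z. (f z, g z, h z)"]
  by (simp add: assms(2-) continuous_on_Pair)

section \<open>Algebra of jets\<close>

lemma smooth_jet_add:
  assumes "smooth_jet A" "smooth_jet B"
  shows "smooth_jet (\<lambda>p x v. A p x v + B p x v)"
  by (rule smooth_jetI) (auto simp: case_prod_beta' distrib_left simp del: of_nat_Suc
    intro!: continuous_intros smooth_jet_continuous_on[OF assms(1)] smooth_jet_continuous_on[OF assms(2)]
      derivative_eq_intros smooth_jet_x[OF assms(1)] smooth_jet_x[OF assms(2)] smooth_jet_v[OF assms(1)] smooth_jet_v[OF assms(2)])

lemma smooth_jet_diff:
  assumes "smooth_jet A" "smooth_jet B"
  shows "smooth_jet (\<lambda>p x v. A p x v - B p x v)"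
  by (rule smooth_jetI) (auto simp: case_prod_beta' right_diff_distrib simp del: of_nat_Suc
    intro!: continuous_intros smooth_jet_continuous_on[OF assms(1)] smooth_jet_continuous_on[OF assms(2)]
      derivative_eq_intros smooth_jet_x[OF assms(1)] smooth_jet_x[OF assms(2)] smooth_jet_v[OF assms(1)] smooth_jet_v[OF assms(2)])

lemma cf_const: "cf (fps_const (fps_const c)) k l = (if k = 0 \<and> l = 0 then c else 0)"
  by simp

lemma smooth_jet_const: "smooth_jet (\<lambda>p x v. fps_const (fps_const c))"
  by (rule smooth_jetI) (auto simp: case_prod_beta')

lemma cf_mult: "cf (A * B) k l = (\<Sum>i\<le>k. \<Sum>j\<le>l. cf A i j * cf B (k - i) (l - j))"
  by (simp add: fps_mult_nth fps_sum_nth atLeast0AtMost)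

text \<open>The hypotheses say that differentiation in \<open>x\<close> acts on the Taylor series as
  \<open>fps_deriv\<close>, and \<open>fps_deriv\<close> is a derivation.\<close>

lemma fps_taylor_mult:
  fixes a b :: "real \<Rightarrow> real fps"
  assumes a: "\<And>n. ((\<lambda>y. fps_nth (a y) n) has_real_derivative real (Suc n) * fps_nth (a x) (Suc n)) (at x)"
    and b: "\<And>n. ((\<lambda>y. fps_nth (b y) n) has_real_derivative real (Suc n) * fps_nth (b x) (Suc n)) (at x)"
  shows "((\<lambda>y. fps_nth (a y * b y) n) has_real_derivative real (Suc n) * fps_nth (a x * b x) (Suc n)) (at x)"
proof -
  have "((\<lambda>y. fps_nth (a y * b y) n) has_real_derivative
      (\<Sum>i=0..n. fps_nth (a x) i * (real (Suc (n - i)) * fps_nth (b x) (Suc (n - i)))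
        + real (Suc i) * fps_nth (a x) (Suc i) * fps_nth (b x) (n - i))) (at x)"
    unfolding fps_mult_nth
    by (rule DERIV_sum) (auto intro!: derivative_eq_intros a b simp del: of_nat_Suc)
  also have "(\<Sum>i=0..n. fps_nth (a x) i * (real (Suc (n - i)) * fps_nth (b x) (Suc (n - i)))
        + real (Suc i) * fps_nth (a x) (Suc i) * fps_nth (b x) (n - i))
      = fps_nth (fps_deriv (a x * b x)) n"
    unfolding fps_deriv_mult fps_add_nth fps_mult_nth fps_deriv_nth by (simp add: sum.distrib)
  also have "\<dots> = real (Suc n) * fps_nth (a x * b x) (Suc n)"
    unfolding fps_deriv_nth by simp
  finally show ?thesis .
qed

lemma smooth_jet_mult:
  assumes "smooth_jet A" "smooth_jet B"
  shows "smooth_jet (\<lambda>p x v. A p x v * B p x v)"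
proof (rule smooth_jetI)
  show "continuous_on UNIV (\<lambda>(p, x, v). cf (A p x v * B p x v) k l)" for k l
    unfolding cf_mult case_prod_beta'
    by (intro continuous_intros smooth_jet_continuous_on[OF assms(1)] smooth_jet_continuous_on[OF assms(2)])
next
  fix p x v k l
  \<comment> \<open>The outer series variable belongs to \<open>x\<close>. For fixed
    \<open>v\<close>-degree \<open>j\<close> the coefficients form a single series in that variable,
    to which the one-variable product rule applies.\<close>
  define a where "a A j y = Abs_fps (\<lambda>i. cf (A p y v) i j)" for A :: "'a \<Rightarrow> real \<Rightarrow> real \<Rightarrow> real fps fps" and j y
  have eq: "cf (A p y v * B p y v) k l = (\<Sum>j\<le>l. fps_nth (a A j y * a B (l - j) y) k)" for y k
    unfolding cf_mult a_def by (subst sum.swap) (simp add: fps_mult_nth atLeast0AtMost)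
  have "((\<lambda>y. \<Sum>j\<le>l. fps_nth (a A j y * a B (l - j) y) k) has_real_derivative
      (\<Sum>j\<le>l. real (Suc k) * fps_nth (a A j x * a B (l - j) x) (Suc k))) (at x)"
    by (rule DERIV_sum, rule fps_taylor_mult) (simp_all add: a_def smooth_jet_x[OF assms(1)] smooth_jet_x[OF assms(2)] del: of_nat_Suc)
  then show "((\<lambda>y. cf (A p y v * B p y v) k l) has_real_derivative real (Suc k) * cf (A p x v * B p x v) (Suc k) l) (at x)"
    unfolding eq sum_distrib_left .
next
  fix p x v k l
  have eq: "cf (A p x w * B p x w) k l = (\<Sum>i=0..k. fps_nth (fps_nth (A p x w) i * fps_nth (B p x w) (k - i)) l)" for w l
    by (simp add: fps_mult_nth[of "A p x w"] fps_sum_nth)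
  have "((\<lambda>w. \<Sum>i=0..k. fps_nth (fps_nth (A p x w) i * fps_nth (B p x w) (k - i)) l) has_real_derivative
      (\<Sum>i=0..k. real (Suc l) * fps_nth (fps_nth (A p x v) i * fps_nth (B p x v) (k - i)) (Suc l))) (at v)"
    by (rule DERIV_sum, rule fps_taylor_mult) (simp_all only: smooth_jet_v[OF assms(1)] smooth_jet_v[OF assms(2)])
  then show "((\<lambda>w. cf (A p x w * B p x w) k l) has_real_derivative real (Suc l) * cf (A p x v * B p x v) k (Suc l)) (at v)"
    unfolding eq sum_distrib_left .
qed

lemma smooth_jet_power:
  assumes "smooth_jet A"
  shows "smooth_jet (\<lambda>p x v. A p x v ^ n)"
proof (induction n)
  case 0
  then show ?case using smooth_jet_const[of 1] by simp
next
  case (Suc n)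
  then show ?case using smooth_jet_mult[OF assms Suc] by simp
qed

section \<open>Derivations and reparametrizations of jets\<close>

definition dX :: "real fps fps \<Rightarrow> real fps fps" where
  "dX A = Abs_fps (\<lambda>k. Abs_fps (\<lambda>l. real (Suc k) * cf A (Suc k) l))"

definition dV :: "real fps fps \<Rightarrow> real fps fps" where
  "dV A = Abs_fps (\<lambda>k. Abs_fps (\<lambda>l. real (Suc l) * cf A k (Suc l)))"

lemma cf_dX [simp]: "cf (dX A) k l = real (Suc k) * cf A (Suc k) l"
  and cf_dV [simp]: "cf (dV A) k l = real (Suc l) * cf A k (Suc l)"
  by (simp_all add: dX_def dV_def)

lemma fps_fps_eqI: "(\<And>k l. cf A k l = cf B k l) \<Longrightarrow> A = B"
  by (intro fps_ext)

lemma dX_diff: "dX (A - B) = dX A - dX B" and dV_diff: "dV (A - B) = dV A - dV B"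
  by (rule fps_fps_eqI, simp add: right_diff_distrib)+

lemma smooth_jet_dX:
  assumes "smooth_jet A"
  shows "smooth_jet (\<lambda>p x v. dX (A p x v))"
  by (rule smooth_jetI) (auto simp: case_prod_beta' simp del: of_nat_Suc
    intro!: continuous_intros smooth_jet_continuous_on[OF assms] DERIV_cmult smooth_jet_x[OF assms]
      derivative_eq_intros smooth_jet_v[OF assms])

lemma smooth_jet_dV:
  assumes "smooth_jet A"
  shows "smooth_jet (\<lambda>p x v. dV (A p x v))"
  by (rule smooth_jetI) (auto simp: case_prod_beta' simp del: of_nat_Suc
    intro!: continuous_intros smooth_jet_continuous_on[OF assms] DERIV_cmult smooth_jet_x[OF assms]
      derivative_eq_intros smooth_jet_v[OF assms])

lemma smooth_jet_reparam:
  assumes "smooth_jet J" "continuous_on UNIV \<phi>"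
  shows "smooth_jet (\<lambda>p. J (\<phi> p))"
  by (rule smooth_jetI) (auto simp: case_prod_beta' simp del: of_nat_Suc
    intro!: smooth_jet_continuous_on[OF assms(1)] smooth_jet_x[OF assms(1)] smooth_jet_v[OF assms(1)]
      continuous_on_compose2[OF assms(2)] continuous_intros)

text \<open>Turning \<open>v\<close> into a parameter reduces the integral over \<open>v\<close> in \<open>rho\<close> to \<open>smooth_jet_integral\<close>.\<close>

lemma smooth_jet_freeze:
  assumes "smooth_jet J" and w: "continuous_on UNIV (w :: real \<Rightarrow> real)"
  shows "smooth_jet (\<lambda>(p, v) x _. Abs_fps (\<lambda>k. Abs_fps (\<lambda>l. if l = 0 then w v * cf (J p x v) k 0 else 0)))"
proof (rule smooth_jetI)
  show "continuous_on UNIV (\<lambda>(p, x, v). cf ((case p of (p, v) \<Rightarrow> \<lambda>x _.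
     Abs_fps (\<lambda>k. Abs_fps (\<lambda>l. if l = 0 then w v * cf (J p x v) k 0 else 0))) x v) k l)" for k l
    by (cases "l = 0") (auto simp: case_prod_beta' intro!: continuous_intros smooth_jet_continuous_on[OF assms(1)]
      continuous_on_compose2[OF w])
qed (auto simp: case_prod_beta' simp del: of_nat_Suc intro!: derivative_eq_intros smooth_jet_x[OF assms(1)])

text \<open>Pointwise convergence of the functions is enough because the derivatives converge with a
  rate independent of the point.\<close>

lemma has_real_derivative_uniform_limit:
  fixes f f' :: "nat \<Rightarrow> real \<Rightarrow> real"
  assumes f: "\<And>n x. (f n has_real_derivative f' n x) (at x)"
    and lim: "\<And>x. (\<lambda>n. f n x) \<longlonglongrightarrow> g x"
    and b: "b \<longlonglongrightarrow> 0" "\<And>n x. \<bar>f' n x - g' x\<bar> \<le> b n"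
  shows "(g has_real_derivative g' x) (at x)"
proof -
  have "\<exists>h. \<forall>x\<in>UNIV. (\<lambda>n. f n x) \<longlonglongrightarrow> h x \<and> (h has_derivative (\<lambda>y. g' x * y)) (at x)"
  proof (rule has_derivative_sequence[where ?x0.0 = 0])
    show "(f n has_derivative (\<lambda>y. f' n x * y)) (at x)" for n x
      using f by (rule has_field_derivative_imp_has_derivative)
    show "\<forall>\<^sub>F n in sequentially. \<forall>x\<in>UNIV. \<forall>h. norm (f' n x * h - g' x * h) \<le> e * norm h" if "e > 0" for e
    proof -
      from order_tendstoD(2)[OF b(1) that]
      show ?thesis
      proof eventually_elim
        case (elim n)
        have "norm (f' n x * h - g' x * h) \<le> e * norm h" for x h
        proof -
          have "norm (f' n x * h - g' x * h) = \<bar>f' n x - g' x\<bar> * norm h"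
            by (simp add: left_diff_distrib[symmetric] abs_mult)
          also have "\<dots> \<le> e * norm h"
            using b(2)[of n x] elim by (intro mult_right_mono) auto
          finally show ?thesis .
        qed
        then show ?case by blast
      qed
    qed
  qed (use lim in auto)
  then obtain h where h: "\<And>x. (\<lambda>n. f n x) \<longlonglongrightarrow> h x" "\<And>x. (h has_derivative (\<lambda>y. g' x * y)) (at x)"
    by auto
  have "h = g"
    using LIMSEQ_unique[OF h(1) lim] by auto
  then show ?thesis
    using h(2) by (simp add: has_field_derivative_def)
qed

text \<open>Each derivative relation links just two coefficients, so the rate may depend on
  \<open>k\<close> and \<open>l\<close>; it must be uniform in the parameter and in space.\<close>

lemma smooth_jet_limit:
  assumes J: "\<And>n. smooth_jet (J n)"
    and lim: "\<And>k l. \<exists>b. b \<longlonglongrightarrow> 0 \<and> (\<forall>n p x v. \<bar>cf (J n p x v) k l - cf (H p x v) k l\<bar> \<le> b n)"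
  shows "smooth_jet H"
proof -
  have ptw: "(\<lambda>n. cf (J n p x v) k l) \<longlonglongrightarrow> cf (H p x v) k l" for p x v k l
  proof -
    obtain b where b: "b \<longlonglongrightarrow> 0" "\<And>n. \<bar>cf (J n p x v) k l - cf (H p x v) k l\<bar> \<le> b n"
      using lim[of k l] by blast
    have "(\<lambda>n. cf (J n p x v) k l - cf (H p x v) k l) \<longlonglongrightarrow> 0"
      by (rule Lim_null_comparison[OF _ b(1)]) (use b(2) in auto)
    then show ?thesis by (simp add: LIM_zero_iff)
  qed
  show ?thesis
  proof (rule smooth_jetI)
    fix k l
    obtain b where b: "b \<longlonglongrightarrow> 0" "\<And>n p x v. \<bar>cf (J n p x v) k l - cf (H p x v) k l\<bar> \<le> b n"
      using lim[of k l] by blast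
    have "uniform_limit UNIV (\<lambda>n (p, x, v). cf (J n p x v) k l) (\<lambda>(p, x, v). cf (H p x v) k l) sequentially"
    proof (rule uniform_limitI)
      fix e :: real assume "e > 0"
      from order_tendstoD(2)[OF b(1) this]
      show "\<forall>\<^sub>F n in sequentially. \<forall>z\<in>UNIV. dist (case z of (p, x, v) \<Rightarrow> cf (J n p x v) k l) (case z of (p, x, v) \<Rightarrow> cf (H p x v) k l) < e"
        by eventually_elim (auto simp: dist_real_def intro: le_less_trans[OF b(2)])
    qed
    then show "continuous_on UNIV (\<lambda>(p, x, v). cf (H p x v) k l)"
      by (rule uniform_limit_theorem[rotated]) (intro always_eventually allI smooth_jet_continuous J trivial_limit_sequentially)+
  next
    fix p x v k l
    obtain b where b: "b \<longlonglongrightarrow> 0" "\<And>n p x v. \<bar>cf (J n p x v) (Suc k) l - cf (H p x v) (Suc k) l\<bar> \<le> b n"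
      using lim[of "Suc k" l] by blast
    show "((\<lambda>y. cf (H p y v) k l) has_real_derivative real (Suc k) * cf (H p x v) (Suc k) l) (at x)"
    proof (rule has_real_derivative_uniform_limit)
      show "((\<lambda>y. cf (J n p y v) k l) has_real_derivative real (Suc k) * cf (J n p x v) (Suc k) l) (at x)" for n x
        by (rule smooth_jet_x[OF J])
      show "(\<lambda>n. real (Suc k) * b n) \<longlonglongrightarrow> 0"
        using b(1) by (rule tendsto_mult_right_zero)
      show "\<bar>real (Suc k) * cf (J n p x v) (Suc k) l - real (Suc k) * cf (H p x v) (Suc k) l\<bar> \<le> real (Suc k) * b n" for n x
        using b(2)[of n p x v] by (simp add: right_diff_distrib[symmetric] abs_mult del: of_nat_Suc)
    qed (rule ptw)
  next
    fix p x v k l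
    obtain b where b: "b \<longlonglongrightarrow> 0" "\<And>n p x v. \<bar>cf (J n p x v) k (Suc l) - cf (H p x v) k (Suc l)\<bar> \<le> b n"
      using lim[of k "Suc l"] by blast
    show "((\<lambda>w. cf (H p x w) k l) has_real_derivative real (Suc l) * cf (H p x v) k (Suc l)) (at v)"
    proof (rule has_real_derivative_uniform_limit)
      show "((\<lambda>w. cf (J n p x w) k l) has_real_derivative real (Suc l) * cf (J n p x v) k (Suc l)) (at v)" for n v
        by (rule smooth_jet_v[OF J])
      show "(\<lambda>n. real (Suc l) * b n) \<longlonglongrightarrow> 0"
        using b(1) by (rule tendsto_mult_right_zero)
      show "\<bar>real (Suc l) * cf (J n p x v) k (Suc l) - real (Suc l) * cf (H p x v) k (Suc l)\<bar> \<le> real (Suc l) * b n" for n v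
        using b(2)[of n p x v] by (simp add: right_diff_distrib[symmetric] abs_mult del: of_nat_Suc)
    qed (rule ptw)
  qed
qed

text \<open>Total differentiability at a point follows from one partial derivative there plus a
  continuous second partial derivative. Time regularity is thus asked at the single time
  \<open>t\<close>, one-sidedly if \<open>S\<close> is an interval with endpoint \<open>t\<close>,
  which matches the notion of classical solution.\<close>

lemma has_real_derivative_along_curve:
  fixes u :: "real \<Rightarrow> real \<Rightarrow> real"
  assumes t: "t \<in> S"
    and ut: "((\<lambda>s. u s (\<phi> t)) has_real_derivative ut) (at t within S)"
    and uy: "\<And>s y. s \<in> S \<Longrightarrow> (u s has_real_derivative uy s y) (at y)"
    and cont: "continuous_on (S \<times> UNIV) (\<lambda>(s, y). uy s y)"
    and \<phi>: "(\<phi> has_real_derivative \<phi>') (at t within S)"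
  shows "((\<lambda>s. u s (\<phi> s)) has_real_derivative ut + uy t (\<phi> t) * \<phi>') (at t within S)"
proof -
  have D: "((\<lambda>(s, y). u s y) has_derivative (\<lambda>(a, b). ut * a + blinfun_mult_right (uy t (\<phi> t)) b)) (at (t, \<phi> t) within S \<times> UNIV)"
  proof (rule has_derivative_partialsI)
    show "((\<lambda>s. u s (\<phi> t)) has_derivative (*) ut) (at t within S)"
      using ut by (simp add: has_field_derivative_def)
    show "(u s has_derivative blinfun_apply (blinfun_mult_right (uy s y))) (at y within UNIV)" if "s \<in> S" for s y
      using uy[OF that, of y] by (simp add: has_field_derivative_def)
    have "continuous (at (t, \<phi> t) within S \<times> UNIV) (\<lambda>z. uy (fst z) (snd z))"
      using cont t by (auto simp: continuous_on_eq_continuous_within case_prod_beta')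
    then show "continuous (at (t, \<phi> t) within S \<times> UNIV) (\<lambda>(x, y). blinfun_mult_right (uy x y))"
      unfolding case_prod_beta' by (rule bounded_linear.continuous[OF bounded_linear_blinfun_mult_right])
  qed auto
  have "((\<lambda>s. (s, \<phi> s)) has_derivative (\<lambda>h. (h, \<phi>' * h))) (at t within S)"
    using \<phi> by (auto simp: has_field_derivative_def intro!: derivative_eq_intros)
  moreover have "(\<lambda>s. (s, \<phi> s)) ` S \<subseteq> S \<times> UNIV" by auto
  ultimately have "((\<lambda>s. case (s, \<phi> s) of (s, y) \<Rightarrow> u s y) has_derivative
      (\<lambda>h. case (h, \<phi>' * h) of (a, b) \<Rightarrow> ut * a + blinfun_mult_right (uy t (\<phi> t)) b)) (at t within S)"
    using has_derivative_in_compose[of "\<lambda>s. (s, \<phi> s)" "\<lambda>h. (h, \<phi>' * h)" t S "\<lambda>(s, y). u s y"]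
      has_derivative_subset[OF D] by blast
  moreover have "(\<lambda>h. case (h, \<phi>' * h) of (a, b) \<Rightarrow> ut * a + blinfun_mult_right (uy t (\<phi> t)) b) = (*) (ut + uy t (\<phi> t) * \<phi>')"
    by (auto simp: fun_eq_iff algebra_simps)
  ultimately show ?thesis
    by (simp add: has_field_derivative_def)
qed

text \<open>Jet of \<open>(x, v) \<mapsto> f (x - \<tau> v, v)\<close>: expand \<open>f (x + \<xi> - \<tau> (v + \<eta>), v + \<eta>)\<close> in powers of \<open>\<xi>\<close> and \<open>\<eta>\<close>.\<close>

definition transport :: "real \<Rightarrow> (real \<Rightarrow> real \<Rightarrow> real fps fps) \<Rightarrow> real \<Rightarrow> real \<Rightarrow> real fps fps" where
  "transport \<tau> J x v = Abs_fps (\<lambda>k. Abs_fps (\<lambda>l. \<Sum>j\<le>l.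
     real (k + j choose j) * (- \<tau>) ^ j * cf (J (x - \<tau> * v) v) (k + j) (l - j)))"

lemma cf_transport:
  "cf (transport \<tau> J x v) k l = (\<Sum>j\<le>l. real (k + j choose j) * (- \<tau>) ^ j * cf (J (x - \<tau> * v) v) (k + j) (l - j))"
  by (simp add: transport_def)

text \<open>In \<open>x\<close> the coefficients match by
  \<open>(k + j + 1) (k + j choose j) = (k + 1) (k + 1 + j choose j)\<close>. In \<open>v\<close>
  the chain rule along \<open>x - \<tau> v\<close> yields a second family of terms, which lands on
  the first after an index shift.\<close>

lemma smooth_jet_transport:
  assumes J: "smooth_jet J" and \<tau>: "continuous_on UNIV \<tau>"
  shows "smooth_jet (\<lambda>p. transport (\<tau> p) (J p))"
proof (rule smooth_jetI)
  show "continuous_on UNIV (\<lambda>(p, x, v). cf (transport (\<tau> p) (J p) x v) k l)" for k l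
    unfolding cf_transport case_prod_beta'
    by (intro continuous_intros smooth_jet_continuous_on[OF J] continuous_on_compose2[OF \<tau>]) auto
next
  fix p x v k l
  have "((\<lambda>y. cf (transport (\<tau> p) (J p) y v) k l) has_real_derivative
      (\<Sum>j\<le>l. real (k + j choose j) * (- \<tau> p) ^ j * (real (Suc (k + j)) * cf (J p (x - \<tau> p * v) v) (Suc (k + j)) (l - j) * 1))) (at x)"
    unfolding cf_transport
    by (intro DERIV_sum DERIV_cmult DERIV_chain2[OF smooth_jet_x[OF J]]) (auto intro!: derivative_eq_intros)
  also have "(\<Sum>j\<le>l. real (k + j choose j) * (- \<tau> p) ^ j * (real (Suc (k + j)) * cf (J p (x - \<tau> p * v) v) (Suc (k + j)) (l - j) * 1))
      = real (Suc k) * cf (transport (\<tau> p) (J p) x v) (Suc k) l"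
    unfolding cf_transport sum_distrib_left
  proof (intro sum.cong refl)
    fix j
    have "Suc (k + j) * (k + j choose j) = Suc k * (Suc k + j choose j)"
      using Suc_times_binomial_eq[of "k + j" k] binomial_symmetric[of j "k + j"] binomial_symmetric[of j "Suc k + j"]
      by (simp add: mult.commute)
    then have "real (Suc (k + j)) * real (k + j choose j) = real (Suc k) * real (Suc k + j choose j)"
      by (metis of_nat_mult)
    then show "real (k + j choose j) * (- \<tau> p) ^ j * (real (Suc (k + j)) * cf (J p (x - \<tau> p * v) v) (Suc (k + j)) (l - j) * 1)
        = real (Suc k) * (real (Suc k + j choose j) * (- \<tau> p) ^ j * cf (J p (x - \<tau> p * v) v) (Suc k + j) (l - j))"
      by (simp add: algebra_simps del: of_nat_Suc)
  qed
  finally show "((\<lambda>y. cf (transport (\<tau> p) (J p) y v) k l) has_real_derivative real (Suc k) * cf (transport (\<tau> p) (J p) x v) (Suc k) l) (at x)" .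
next
  fix p x v k l
  let ?J = "J p (x - \<tau> p * v) v"
  have curve: "((\<lambda>w. cf (J p (x - \<tau> p * w) w) i j) has_real_derivative
      real (Suc j) * cf ?J i (Suc j) + real (Suc i) * cf ?J (Suc i) j * (- \<tau> p)) (at v)" for i j
  proof (rule has_real_derivative_along_curve[where S = UNIV and u = "\<lambda>w y. cf (J p y w) i j" and \<phi> = "\<lambda>w. x - \<tau> p * w"
        and uy = "\<lambda>w y. real (Suc i) * cf (J p y w) (Suc i) j"])
    show "continuous_on (UNIV \<times> UNIV) (\<lambda>(w, y). real (Suc i) * cf (J p y w) (Suc i) j)"
      unfolding case_prod_beta' by (intro continuous_intros smooth_jet_continuous_on[OF J])
  qed (auto intro!: smooth_jet_x[OF J] smooth_jet_v[OF J] derivative_eq_intros simp del: of_nat_Suc)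
  let ?c = "\<lambda>j. real (k + j choose j) * (- \<tau> p) ^ j"
  have "((\<lambda>w. cf (transport (\<tau> p) (J p) x w) k l) has_real_derivative
      (\<Sum>j\<le>l. ?c j * (real (Suc (l - j)) * cf ?J (k + j) (Suc (l - j)) + real (Suc (k + j)) * cf ?J (Suc (k + j)) (l - j) * (- \<tau> p)))) (at v)"
    unfolding cf_transport by (intro DERIV_sum DERIV_cmult curve)
  also have "(\<Sum>j\<le>l. ?c j * (real (Suc (l - j)) * cf ?J (k + j) (Suc (l - j)) + real (Suc (k + j)) * cf ?J (Suc (k + j)) (l - j) * (- \<tau> p)))
     = (\<Sum>j\<le>l. real (Suc l - j) * (?c j * cf ?J (k + j) (Suc l - j)))
       + (\<Sum>j\<le>l. real (Suc j) * (?c (Suc j) * cf ?J (k + Suc j) (Suc l - Suc j)))"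
    unfolding sum.distrib[symmetric]
  proof (intro sum.cong refl)
    fix j assume "j \<in> {..l}"
    then have "Suc l - j = Suc (l - j)" by (simp add: Suc_diff_le)
    have "Suc j * (k + Suc j choose Suc j) = Suc (k + j) * (k + j choose j)"
      using Suc_times_binomial_eq[of "k + j" j] by (simp add: mult.commute)
    then have "real (Suc j) * real (k + Suc j choose Suc j) = real (Suc (k + j)) * real (k + j choose j)"
      by (metis of_nat_mult)
    then have "real (Suc j) * (?c (Suc j) * cf ?J (k + Suc j) (Suc l - Suc j))
      = (real (Suc (k + j)) * real (k + j choose j)) * (- \<tau> p) ^ Suc j * cf ?J (Suc (k + j)) (l - j)"
      by (simp only: mult.assoc[symmetric] diff_Suc_Suc add_Suc_right)
    with \<open>Suc l - j = Suc (l - j)\<close>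
    show "?c j * (real (Suc (l - j)) * cf ?J (k + j) (Suc (l - j)) + real (Suc (k + j)) * cf ?J (Suc (k + j)) (l - j) * (- \<tau> p))
      = real (Suc l - j) * (?c j * cf ?J (k + j) (Suc l - j)) + real (Suc j) * (?c (Suc j) * cf ?J (k + Suc j) (Suc l - Suc j))"
      by (simp add: algebra_simps del: of_nat_Suc binomial_Suc_Suc)
  qed
  \<comment> \<open>Both sums extend to \<open>j \<le> Suc l\<close> with zero terms, at the last
    and the first index respectively; their factors \<open>Suc l - j\<close> and \<open>j\<close>
    then add up to \<open>Suc l\<close>.\<close>
  also have "(\<Sum>j\<le>l. real (Suc l - j) * (?c j * cf ?J (k + j) (Suc l - j)))
      = (\<Sum>j\<le>Suc l. real (Suc l - j) * (?c j * cf ?J (k + j) (Suc l - j)))"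
    by simp
  also have "(\<Sum>j\<le>l. real (Suc j) * (?c (Suc j) * cf ?J (k + Suc j) (Suc l - Suc j)))
      = (\<Sum>j\<le>Suc l. real j * (?c j * cf ?J (k + j) (Suc l - j)))"
    by (subst sum.atMost_Suc_shift) simp
  also have "(\<Sum>j\<le>Suc l. real (Suc l - j) * (?c j * cf ?J (k + j) (Suc l - j)))
      + (\<Sum>j\<le>Suc l. real j * (?c j * cf ?J (k + j) (Suc l - j)))
      = real (Suc l) * cf (transport (\<tau> p) (J p) x v) k (Suc l)"
    unfolding cf_transport sum_distrib_left sum.distrib[symmetric]
  proof (intro sum.cong refl)
    fix j assume "j \<in> {..Suc l}"
    then have "real (Suc l - j) + real j = real (Suc l)" by simp
    then show "real (Suc l - j) * (?c j * cf ?J (k + j) (Suc l - j)) + real j * (?c j * cf ?J (k + j) (Suc l - j))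
        = real (Suc l) * (?c j * cf ?J (k + j) (Suc l - j))"
      by (metis distrib_right)
  qed
  finally show "((\<lambda>w. cf (transport (\<tau> p) (J p) x w) k l) has_real_derivative real (Suc l) * cf (transport (\<tau> p) (J p) x v) k (Suc l)) (at v)" .
qed

text \<open>The integration variable is part of the parameter, so \<open>smooth_jet\<close> already
  includes joint continuity in it; on a compact interval this permits differentiation under the
  integral.\<close>

lemma smooth_jet_integral:
  fixes J :: "'p::topological_space \<times> real \<Rightarrow> real \<Rightarrow> real \<Rightarrow> real fps fps"
  assumes J: "smooth_jet J"
  shows "smooth_jet (\<lambda>p x v. Abs_fps (\<lambda>k. Abs_fps (\<lambda>l. integral {a..b} (\<lambda>s. cf (J (p, s) x v) k l))))"
proof (rule smooth_jetI)
  show "continuous_on UNIV (\<lambda>(p, x, v). cf (Abs_fps (\<lambda>k. Abs_fps (\<lambda>l. integral {a..b} (\<lambda>s. cf (J (p, s) x v) k l)))) k l)" for k l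
  proof -
    have "continuous_on (UNIV \<times> cbox a b) (\<lambda>(z, s). cf (J (fst z, s) (fst (snd z)) (snd (snd z))) k l)"
      unfolding case_prod_beta' by (intro smooth_jet_continuous_on[OF J] continuous_intros)
    from integral_continuous_on_param[OF this] show ?thesis
      by (simp add: case_prod_beta')
  qed
next
  fix p x v k l
  have "((\<lambda>y. integral (cbox a b) (\<lambda>s. cf (J (p, s) y v) k l)) has_real_derivative
      integral (cbox a b) (\<lambda>s. real (Suc k) * cf (J (p, s) x v) (Suc k) l)) (at x within UNIV)"
  proof (rule leibniz_rule_field_derivative)
    show "(\<lambda>s. cf (J (p, s) y v) k l) integrable_on cbox a b" for y
      by (intro integrable_continuous smooth_jet_continuous_on[OF J] continuous_intros)
    show "continuous_on (UNIV \<times> cbox a b) (\<lambda>(y, s). real (Suc k) * cf (J (p, s) y v) (Suc k) l)"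
      unfolding case_prod_beta' by (intro smooth_jet_continuous_on[OF J] continuous_intros)
  qed (auto intro!: smooth_jet_x[OF J] simp del: of_nat_Suc)
  then show "((\<lambda>y. cf (Abs_fps (\<lambda>k. Abs_fps (\<lambda>l. integral {a..b} (\<lambda>s. cf (J (p, s) y v) k l)))) k l) has_real_derivative
      real (Suc k) * cf (Abs_fps (\<lambda>k. Abs_fps (\<lambda>l. integral {a..b} (\<lambda>s. cf (J (p, s) x v) k l)))) (Suc k) l) (at x)"
    by (simp del: of_nat_Suc)
next
  fix p x v k l
  have "((\<lambda>w. integral (cbox a b) (\<lambda>s. cf (J (p, s) x w) k l)) has_real_derivative
      integral (cbox a b) (\<lambda>s. real (Suc l) * cf (J (p, s) x v) k (Suc l))) (at v within UNIV)"
  proof (rule leibniz_rule_field_derivative)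
    show "(\<lambda>s. cf (J (p, s) x w) k l) integrable_on cbox a b" for w
      by (intro integrable_continuous smooth_jet_continuous_on[OF J] continuous_intros)
    show "continuous_on (UNIV \<times> cbox a b) (\<lambda>(w, s). real (Suc l) * cf (J (p, s) x w) k (Suc l))"
      unfolding case_prod_beta' by (intro smooth_jet_continuous_on[OF J] continuous_intros)
  qed (auto intro!: smooth_jet_v[OF J] simp del: of_nat_Suc)
  then show "((\<lambda>w. cf (Abs_fps (\<lambda>k. Abs_fps (\<lambda>l. integral {a..b} (\<lambda>s. cf (J (p, s) x w) k l)))) k l) has_real_derivative
      real (Suc l) * cf (Abs_fps (\<lambda>k. Abs_fps (\<lambda>l. integral {a..b} (\<lambda>s. cf (J (p, s) x v) k l)))) k (Suc l)) (at v)"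
    by (simp del: of_nat_Suc)
qed

section \<open>Norms of jets\<close>

definition amp :: "(real \<Rightarrow> real \<Rightarrow> real fps fps) \<Rightarrow> nat \<Rightarrow> nat \<Rightarrow> ennreal" where
  "amp J k l = (SUP (x, v)\<in>UNIV. ennreal \<bar>cf (J x v) k l\<bar>)"

definition am :: "(real \<Rightarrow> real \<Rightarrow> real fps fps) \<Rightarrow> nat \<Rightarrow> ennreal" where
  "am J m = (\<Sum>k\<le>m. amp J k (m - k))"

abbreviation norm_W :: "real \<Rightarrow> (real \<Rightarrow> real \<Rightarrow> real fps fps) \<Rightarrow> ennreal" where
  "norm_W L J \<equiv> wnorm (W L) (am J)"

abbreviation seminorm_W :: "real \<Rightarrow> (real \<Rightarrow> real \<Rightarrow> real fps fps) \<Rightarrow> ennreal" where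
  "seminorm_W L J \<equiv> wnorm (W' L) (am J)"

lemma le_amp: "ennreal \<bar>cf (J x v) k l\<bar> \<le> amp J k l"
  unfolding amp_def by (rule SUP_upper2[of "(x, v)"]) auto

lemma amp_leI: "(\<And>x v. ennreal \<bar>cf (J x v) k l\<bar> \<le> B) \<Longrightarrow> amp J k l \<le> B"
  unfolding amp_def by (rule SUP_least) auto

lemma amp_le_am: "amp J k l \<le> am J (k + l)"
  unfolding am_def by (rule order_trans[OF _ member_le_sum[of k]]) auto

lemma amp_add: "amp (\<lambda>x v. A x v + B x v) k l \<le> amp A k l + amp B k l"
proof (rule amp_leI)
  fix x v
  have "ennreal \<bar>cf (A x v + B x v) k l\<bar> \<le> ennreal (\<bar>cf (A x v) k l\<bar> + \<bar>cf (B x v) k l\<bar>)"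
    by (intro ennreal_leI) (simp add: abs_triangle_ineq)
  also have "\<dots> \<le> amp A k l + amp B k l"
    by (simp add: ennreal_plus add_mono le_amp)
  finally show "ennreal \<bar>cf (A x v + B x v) k l\<bar> \<le> amp A k l + amp B k l" .
qed

lemma am_add: "am (\<lambda>x v. A x v + B x v) m \<le> am A m + am B m"
  unfolding am_def sum.distrib[symmetric] by (intro sum_mono amp_add)

lemma am_diff_commute: "am (\<lambda>x v. A x v - B x v) m = am (\<lambda>x v. B x v - A x v) m"
  unfolding am_def amp_def by (simp add: abs_minus_commute)

lemma wnorm_am_add: "wnorm w (am (\<lambda>x v. A x v + B x v)) \<le> wnorm w (am A) + wnorm w (am B)"
  unfolding wnorm_add[symmetric] by (intro wnorm_mono am_add) auto

lemma amp_mult: "amp (\<lambda>x v. A x v * B x v) k l \<le> (\<Sum>i\<le>k. \<Sum>j\<le>l. amp A i j * amp B (k - i) (l - j))"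
proof (rule amp_leI)
  fix x v
  have "\<bar>cf (A x v * B x v) k l\<bar> \<le> (\<Sum>i\<le>k. \<Sum>j\<le>l. \<bar>cf (A x v) i j\<bar> * \<bar>cf (B x v) (k - i) (l - j)\<bar>)"
    unfolding cf_mult by (intro order_trans[OF sum_abs] sum_mono) (simp add: abs_mult)
  then have "ennreal \<bar>cf (A x v * B x v) k l\<bar> \<le> ennreal (\<Sum>i\<le>k. \<Sum>j\<le>l. \<bar>cf (A x v) i j\<bar> * \<bar>cf (B x v) (k - i) (l - j)\<bar>)"
    by (rule ennreal_leI)
  also have "\<dots> = (\<Sum>i\<le>k. \<Sum>j\<le>l. ennreal \<bar>cf (A x v) i j\<bar> * ennreal \<bar>cf (B x v) (k - i) (l - j)\<bar>)"
    by (simp add: sum_nonneg ennreal_mult flip: sum_ennreal)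
  also have "\<dots> \<le> (\<Sum>i\<le>k. \<Sum>j\<le>l. amp A i j * amp B (k - i) (l - j))"
    by (intro sum_mono mult_mono le_amp) auto
  finally show "ennreal \<bar>cf (A x v * B x v) k l\<bar> \<le> \<dots>" .
qed

text \<open>Summing over total degree turns the two-variable Cauchy product into a one-variable
  one.\<close>

lemma am_mult: "am (\<lambda>x v. A x v * B x v) m \<le> (\<Sum>i\<le>m. am A i * am B (m - i))"
proof -
  have "am (\<lambda>x v. A x v * B x v) m \<le> (\<Sum>k\<le>m. \<Sum>i\<le>k. \<Sum>j\<le>m - k. amp A i j * amp B (k - i) (m - k - j))"
    unfolding am_def by (intro sum_mono amp_mult)
  also have "\<dots> = (\<Sum>(k, i, j)\<in>(SIGMA k:{..m}. SIGMA i:{..k}. {..m - k}). amp A i j * amp B (k - i) (m - k - j))"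
    by (simp add: sum.Sigma)
  also have "\<dots> = (\<Sum>(s, i, i')\<in>(SIGMA s:{..m}. SIGMA i:{..s}. {..m - s}). amp A i (s - i) * amp B i' (m - s - i'))"
    \<comment> \<open>New indices: \<open>s = i + j\<close> is the total degree in the first factor,
      \<open>i' = k - i\<close> the \<open>x\<close>-degree in the second.\<close>
    by (rule sum.reindex_bij_witness[where j = "\<lambda>(k, i, j). (i + j, i, k - i)" and i = "\<lambda>(s, i, i'). (i + i', i, s - i)"]) (auto simp: add.commute)
  also have "\<dots> = (\<Sum>s\<le>m. \<Sum>i\<le>s. \<Sum>i'\<le>m - s. amp A i (s - i) * amp B i' (m - s - i'))"
    by (simp add: sum.Sigma)
  also have "\<dots> = (\<Sum>i\<le>m. am A i * am B (m - i))"
    by (simp add: am_def sum_product)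
  finally show ?thesis .
qed

lemma wnorm_W_mult:
  "0 \<le> L \<Longrightarrow> norm_W L (\<lambda>x v. A x v * B x v) \<le> norm_W L A * norm_W L B"
  by (rule order_trans[OF wnorm_mono[OF order_refl am_mult] wnorm_W_conv])

lemma wnorm_W'_mult:
  "0 \<le> L \<Longrightarrow> seminorm_W L (\<lambda>x v. A x v * B x v)
    \<le> seminorm_W L A * norm_W L B + norm_W L A * seminorm_W L B"
  by (rule order_trans[OF wnorm_mono[OF order_refl am_mult] wnorm_W'_conv])

lemma ennreal_abs_mult_nat: "ennreal \<bar>real n * c\<bar> = of_nat n * ennreal \<bar>c\<bar>"
  by (simp add: abs_mult ennreal_mult ennreal_of_nat_eq_real_of_nat)

lemma amp_dX: "amp (\<lambda>x v. dX (J x v)) k l \<le> of_nat (Suc k) * amp J (Suc k) l"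
  by (rule amp_leI) (simp only: cf_dX ennreal_abs_mult_nat, intro mult_left_mono le_amp, simp)

lemma amp_dV: "amp (\<lambda>x v. dV (J x v)) k l \<le> of_nat (Suc l) * amp J k (Suc l)"
  by (rule amp_leI) (simp only: cf_dV ennreal_abs_mult_nat, intro mult_left_mono le_amp, simp)

text \<open>The factor \<open>k + 1\<close> is enlarged to \<open>m + 1\<close> so that the bound
  depends on the total degree alone.\<close>

lemma am_dX: "am (\<lambda>x v. dX (J x v)) m \<le> of_nat (Suc m) * am J (Suc m)"
proof -
  have "am (\<lambda>x v. dX (J x v)) m \<le> (\<Sum>k\<le>m. of_nat (Suc m) * amp J (Suc k) (Suc m - Suc k))"
    unfolding am_def
    by (intro sum_mono order_trans[OF amp_dX]) (auto intro!: mult_right_mono simp del: of_nat_Suc simp add: of_nat_mono)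
  also have "\<dots> \<le> of_nat (Suc m) * am J (Suc m)"
    unfolding am_def sum_distrib_left[symmetric] sum.atMost_Suc_shift[of "\<lambda>k. amp J k (Suc m - k)"]
    by (intro mult_left_mono) auto
  finally show ?thesis .
qed

lemma am_dV: "am (\<lambda>x v. dV (J x v)) m \<le> of_nat (Suc m) * am J (Suc m)"
proof -
  have "am (\<lambda>x v. dV (J x v)) m \<le> (\<Sum>k\<le>m. of_nat (Suc m) * amp J k (Suc m - k))"
    unfolding am_def
    by (intro sum_mono order_trans[OF amp_dV]) (auto intro!: mult_mono of_nat_mono simp del: of_nat_Suc simp add: Suc_diff_le)
  also have "\<dots> \<le> of_nat (Suc m) * am J (Suc m)"
    unfolding am_def sum_distrib_left[symmetric] by (simp add: distrib_left del: of_nat_Suc)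
  finally show ?thesis .
qed

lemma wnorm_W_dX_dV:
  assumes "0 \<le> L"
  shows "norm_W L (\<lambda>x v. dX (A x v) * dV (B x v))
    \<le> seminorm_W L A * norm_W L B + norm_W L A * seminorm_W L B"
proof (rule order_trans[OF wnorm_mono[OF order_refl] wnorm_W_conv_shift[OF assms]])
  fix m
  show "am (\<lambda>x v. dX (A x v) * dV (B x v)) m
    \<le> (\<Sum>i\<le>m. of_nat (Suc i) * am A (Suc i) * (of_nat (Suc (m - i)) * am B (Suc (m - i))))"
    by (intro order_trans[OF am_mult] sum_mono mult_mono am_dX am_dV) auto
qed

lemma wnorm_W_dX: "0 \<le> L \<Longrightarrow> norm_W L (\<lambda>x v. dX (J x v)) \<le> seminorm_W L J"
  by (rule order_trans[OF wnorm_mono[OF order_refl am_dX] wnorm_W_shift])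

text \<open>Grouping by the \<open>x\<close>-degree \<open>K = k + j\<close> before transport, the
  binomial theorem gives \<open>(1 + \<tau>)^K\<close>, at most \<open>(1 + \<tau>)^m\<close>. Total
  degree is preserved by transport, hence there is no coupling between modes.\<close>

lemma transport_coeffs_sum_le:
  fixes a :: "nat \<Rightarrow> nat \<Rightarrow> ennreal"
  assumes "0 \<le> \<tau>"
  shows "(\<Sum>k\<le>m. \<Sum>j\<le>m - k. ennreal (real (k + j choose j) * \<tau> ^ j) * a (k + j) (m - k - j))
    \<le> ennreal ((1 + \<tau>) ^ m) * (\<Sum>k\<le>m. a k (m - k))"
proof -
  have "(\<Sum>k\<le>m. \<Sum>j\<le>m - k. ennreal (real (k + j choose j) * \<tau> ^ j) * a (k + j) (m - k - j))
      = (\<Sum>(k, j)\<in>(SIGMA k:{..m}. {..m - k}). ennreal (real (k + j choose j) * \<tau> ^ j) * a (k + j) (m - k - j))"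
    by (simp add: sum.Sigma)
  also have "\<dots> = (\<Sum>(K, j)\<in>(SIGMA K:{..m}. {..K}). ennreal (real (K choose j) * \<tau> ^ j) * a K (m - K))"
    by (rule sum.reindex_bij_witness[where j = "\<lambda>(k, j). (k + j, j)" and i = "\<lambda>(K, j). (K - j, j)"]) auto
  also have "\<dots> = (\<Sum>K\<le>m. (\<Sum>j\<le>K. ennreal (real (K choose j) * \<tau> ^ j)) * a K (m - K))"
    by (simp add: sum.Sigma sum_distrib_right)
  also have "\<dots> = (\<Sum>K\<le>m. ennreal ((1 + \<tau>) ^ K) * a K (m - K))"
    using assms binomial_ring[of \<tau> 1] by (intro sum.cong refl) (simp add: add.commute sum_ennreal)
  also have "\<dots> \<le> (\<Sum>K\<le>m. ennreal ((1 + \<tau>) ^ m) * a K (m - K))"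
    using assms by (intro sum_mono mult_right_mono ennreal_leI power_increasing) auto
  finally show ?thesis by (simp add: sum_distrib_left)
qed

lemma abs_cf_transport_le:
  assumes "0 \<le> \<tau>"
  shows "ennreal \<bar>cf (transport \<tau> J x v) k l\<bar>
    \<le> (\<Sum>j\<le>l. ennreal (real (k + j choose j) * \<tau> ^ j) * amp J (k + j) (l - j))"
proof -
  have "\<bar>cf (transport \<tau> J x v) k l\<bar> \<le> (\<Sum>j\<le>l. (real (k + j choose j) * \<tau> ^ j) * \<bar>cf (J (x - \<tau> * v) v) (k + j) (l - j)\<bar>)"
    unfolding cf_transport using assms
    by (intro order_trans[OF sum_abs] sum_mono) (simp add: abs_mult power_abs)
  then have "ennreal \<bar>cf (transport \<tau> J x v) k l\<bar> \<le> ennreal \<dots>"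
    by (rule ennreal_leI)
  also have "\<dots> = (\<Sum>j\<le>l. ennreal (real (k + j choose j) * \<tau> ^ j) * ennreal \<bar>cf (J (x - \<tau> * v) v) (k + j) (l - j)\<bar>)"
    using assms by (subst sum_ennreal[symmetric]) (auto intro!: sum.cong simp: ennreal_mult)
  also have "\<dots> \<le> (\<Sum>j\<le>l. ennreal (real (k + j choose j) * \<tau> ^ j) * amp J (k + j) (l - j))"
    by (intro sum_mono mult_left_mono le_amp) auto
  finally show ?thesis .
qed

lemma am_transport:
  assumes "0 \<le> \<tau>"
  shows "am (transport \<tau> J) m \<le> ennreal ((1 + \<tau>) ^ m) * am J m"
proof -
  have "am (transport \<tau> J) m \<le> (\<Sum>k\<le>m. \<Sum>j\<le>m - k. ennreal (real (k + j choose j) * \<tau> ^ j) * amp J (k + j) (m - k - j))"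
    unfolding am_def using assms by (intro sum_mono amp_leI abs_cf_transport_le)
  also have "\<dots> \<le> ennreal ((1 + \<tau>) ^ m) * am J m"
    unfolding am_def by (rule transport_coeffs_sum_le[OF assms])
  finally show ?thesis .
qed

text \<open>A supremum of continuous functions of the parameter is lower semicontinuous: its
  superlevel sets are unions of open sets, even though the supremum is uncountable.\<close>

lemma borel_measurable_amp:
  assumes J: "smooth_jet J"
  shows "(\<lambda>s. amp (J s) k l) \<in> borel_measurable borel"
proof (rule borel_measurableI_greater)
  fix y :: ennreal
  have "{s. y < amp (J s) k l} = (\<Union>z. {s. y < ennreal \<bar>cf (J s (fst z) (snd z)) k l\<bar>})"
    by (auto simp: amp_def less_SUP_iff) blast
  moreover have "open {s. y < ennreal \<bar>cf (J s (fst z) (snd z)) k l\<bar>}" for z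
    by (intro open_Collect_less continuous_on_const continuous_on_ennreal continuous_on_rabs
        smooth_jet_continuous_on[OF J] continuous_on_id)
  ultimately have "open {s. y < amp (J s) k l}"
    by auto
  then show "{s \<in> space borel. y < amp (J s) k l} \<in> sets borel"
    by simp
qed

lemma borel_measurable_am:
  "smooth_jet J \<Longrightarrow> (\<lambda>s. am (J s) m) \<in> borel_measurable borel"
  unfolding am_def by (intro borel_measurable_sum borel_measurable_amp)

lemma borel_measurable_wnorm:
  assumes "smooth_jet J" and "\<And>m. continuous_on UNIV (\<lambda>s. w s m)"
  shows "(\<lambda>s. wnorm (w s) (am (J s))) \<in> borel_measurable borel"
proof -
  have [measurable]: "(\<lambda>s. w s m) \<in> borel_measurable borel" for m
    using assms(2) by (rule borel_measurable_continuous_onI)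
  note [measurable] = borel_measurable_am[OF assms(1)]
  show ?thesis
    unfolding wnorm_def by measurable
qed

text \<open>Duhamel's integral over \<open>s = t \<theta>\<close>; the fixed interval allows differentiation under the integral and
  makes sense for all real \<open>t\<close>.\<close>

definition duhamel :: "(real \<Rightarrow> real \<Rightarrow> real \<Rightarrow> real fps fps) \<Rightarrow> real \<Rightarrow> real \<Rightarrow> real \<Rightarrow> real fps fps" where
  "duhamel F t x v = Abs_fps (\<lambda>k. Abs_fps (\<lambda>l. integral {0..1} (\<lambda>\<theta>.
     t * cf (transport (t - t * \<theta>) (F (t * \<theta>)) x v) k l)))"

lemma cf_fps_const_mult: "cf (fps_const (fps_const c) * A) k l = (c :: real) * cf A k l"
  by simp

lemma smooth_jet_cmult:
  assumes "smooth_jet J" "continuous_on UNIV c"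
  shows "smooth_jet (\<lambda>p x v. fps_const (fps_const (c p)) * J p x v)"
proof (rule smooth_jet_mult[OF _ assms(1)], rule smooth_jetI)
  show "continuous_on UNIV (\<lambda>(p, x, v). cf (fps_const (fps_const (c p))) k l)" for k l
    unfolding cf_const case_prod_beta'
    by (cases "k = 0 \<and> l = 0") (auto intro!: continuous_on_compose2[OF assms(2)] continuous_intros)
qed auto

lemma smooth_jet_duhamel:
  assumes F: "smooth_jet F"
  shows "smooth_jet (duhamel F)"
proof -
  have "smooth_jet (\<lambda>p. transport (fst p - fst p * snd p) (F (fst p * snd p)))"
    by (intro smooth_jet_transport smooth_jet_reparam[OF F] continuous_intros)
  then have "smooth_jet (\<lambda>p x v. fps_const (fps_const (fst p)) * transport (fst p - fst p * snd p) (F (fst p * snd p)) x v)"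
    by (rule smooth_jet_cmult) (intro continuous_intros)
  from smooth_jet_integral[OF this, of 0 1] show ?thesis
    unfolding duhamel_def[abs_def] by simp
qed

text \<open>The substitution \<open>s = t \<theta>\<close> restores the usual form, on which the
  estimates act. It degenerates at \<open>t = 0\<close>, where both sides vanish.\<close>

lemma cf_duhamel:
  assumes F: "smooth_jet F" and t: "0 \<le> t"
  shows "cf (duhamel F t x v) k l = integral {0..t} (\<lambda>s. cf (transport (t - s) (F s) x v) k l)"
    and "continuous_on A (\<lambda>s. cf (transport (t - s) (F s) x v) k l)"
proof -
  have "smooth_jet (\<lambda>s. transport (t - s) (F s))"
    by (intro smooth_jet_transport F continuous_intros)
  then show c: "continuous_on A (\<lambda>s. cf (transport (t - s) (F s) x v) k l)" for A
    by (intro smooth_jet_continuous_on[where J = "\<lambda>s. transport (t - s) (F s)"] continuous_intros)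
  let ?f = "\<lambda>s. cf (transport (t - s) (F s) x v) k l"
  show "cf (duhamel F t x v) k l = integral {0..t} ?f"
  proof (cases "t = 0")
    case False
    then have "t > 0" using t by simp
    have "(?f has_integral integral {0..t} ?f) (cbox 0 t)"
      using integrable_integral[OF integrable_continuous_real[OF c[of "{0..t}"]]] by simp
    from has_integral_affinity'[OF this \<open>t > 0\<close>, of 0]
    have "((\<lambda>\<theta>. ?f (t * \<theta>)) has_integral integral {0..t} ?f / t) {0..1}"
      using \<open>t > 0\<close> by (simp add: divide_inverse mult.commute)
    from has_integral_mult_right[OF this, of t]
    have "((\<lambda>\<theta>. t * ?f (t * \<theta>)) has_integral integral {0..t} ?f) {0..1}"
      using \<open>t > 0\<close> by simp
    then show ?thesis
      unfolding duhamel_def by (simp only: fps_nth_Abs_fps integral_unique)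
  qed (simp add: duhamel_def)
qed

lemma ennreal_abs_integral_le:
  fixes f :: "real \<Rightarrow> real"
  assumes "continuous_on {a..b} f"
  shows "ennreal \<bar>integral {a..b} f\<bar> \<le> (\<integral>\<^sup>+s\<in>{a..b}. ennreal \<bar>f s\<bar> \<partial>lborel)"
proof -
  have i: "set_integrable lborel {a..b} f"
    by (rule borel_integrable_atLeastAtMost') (rule assms)
  have "ennreal \<bar>integral {a..b} f\<bar> = ennreal (norm (LINT s|lborel. indicator {a..b} s *\<^sub>R f s))"
    using set_borel_integral_eq_integral(2)[OF i] by (simp add: set_lebesgue_integral_def)
  also have "\<dots> \<le> (\<integral>\<^sup>+s. ennreal (norm (indicator {a..b} s *\<^sub>R f s)) \<partial>lborel)"
    using i unfolding set_integrable_def by (rule integral_norm_bound_ennreal)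
  also have "\<dots> = (\<integral>\<^sup>+s\<in>{a..b}. ennreal \<bar>f s\<bar> \<partial>lborel)"
    by (intro nn_integral_cong) (auto simp: indicator_def)
  finally show ?thesis .
qed

text \<open>The bound on single coefficients must keep all terms under the time integral until the
  sum over \<open>k + l = m\<close> is formed, since the factor \<open>(1 + \<tau>)^m\<close>
  appears only in that sum.\<close>

lemma am_duhamel:
  assumes F: "smooth_jet F" and t: "0 \<le> t"
  shows "am (duhamel F t) m \<le> (\<integral>\<^sup>+s\<in>{0..t}. ennreal ((1 + (t - s)) ^ m) * am (F s) m \<partial>lborel)"
proof -
  note [measurable] = borel_measurable_amp[OF F]
  let ?b = "\<lambda>k l s. \<Sum>j\<le>l. ennreal (real (k + j choose j) * (t - s) ^ j) * amp (F s) (k + j) (l - j)"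
  have "amp (duhamel F t) k l \<le> (\<integral>\<^sup>+s\<in>{0..t}. ?b k l s \<partial>lborel)" for k l
  proof (rule amp_leI)
    fix x v
    have "ennreal \<bar>cf (duhamel F t x v) k l\<bar> \<le> (\<integral>\<^sup>+s\<in>{0..t}. ennreal \<bar>cf (transport (t - s) (F s) x v) k l\<bar> \<partial>lborel)"
      unfolding cf_duhamel(1)[OF F t] by (rule ennreal_abs_integral_le[OF cf_duhamel(2)[OF F t]])
    also have "\<dots> \<le> (\<integral>\<^sup>+s\<in>{0..t}. ?b k l s \<partial>lborel)"
      by (intro nn_integral_mono) (auto simp: indicator_def intro!: abs_cf_transport_le)
    finally show "ennreal \<bar>cf (duhamel F t x v) k l\<bar> \<le> (\<integral>\<^sup>+s\<in>{0..t}. ?b k l s \<partial>lborel)" .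
  qed
  then have "am (duhamel F t) m \<le> (\<Sum>k\<le>m. \<integral>\<^sup>+s\<in>{0..t}. ?b k (m - k) s \<partial>lborel)"
    unfolding am_def by (intro sum_mono)
  also have "\<dots> = (\<integral>\<^sup>+s. (\<Sum>k\<le>m. ?b k (m - k) s * indicator {0..t} s) \<partial>lborel)"
    by (rule nn_integral_sum[symmetric]) measurable
  also have "\<dots> \<le> (\<integral>\<^sup>+s\<in>{0..t}. ennreal ((1 + (t - s)) ^ m) * am (F s) m \<partial>lborel)"
  proof (intro nn_integral_mono)
    fix s
    show "(\<Sum>k\<le>m. ?b k (m - k) s * indicator {0..t} s) \<le> ennreal ((1 + (t - s)) ^ m) * am (F s) m * indicator {0..t} s"
      using transport_coeffs_sum_le[of "t - s" "amp (F s)" m]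
      by (cases "s \<in> {0..t}") (auto simp: am_def)
  qed
  finally show ?thesis .
qed

section \<open>The density as an average against the weight\<close>

definition jrho :: "(real \<Rightarrow> real \<Rightarrow> real fps fps) \<Rightarrow> real \<Rightarrow> real \<Rightarrow> real fps fps" where
  "jrho J x v = Abs_fps (\<lambda>k. Abs_fps (\<lambda>l. if l = 0 then LINT w|lborel. omega w * cf (J x w) k 0 else 0))"

lemma continuous_on_omega: "continuous_on A omega"
proof -
  have "1 + v\<^sup>2 \<noteq> 0" for v :: real
    using zero_le_power2[of v] by linarith
  then show ?thesis unfolding omega_def[abs_def] by (intro continuous_intros) auto
qed

lemma omega_pos: "0 < omega v"
  unfolding omega_def using zero_le_power2[of v] by (simp add: add_pos_nonneg)

lemma integral_omega: "integral {a..b} omega = (arctan b - arctan a) / pi" if "a \<le> b"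
proof (rule integral_unique)
  have "((\<lambda>v. arctan v / pi) has_vector_derivative omega v) (at v within {a..b})" for v
    using DERIV_cdivide[OF DERIV_subset[OF DERIV_arctan[of v]], of "{a..b}" pi]
    by (simp add: has_real_derivative_iff_has_vector_derivative omega_def divide_inverse mult.commute)
  from fundamental_theorem_of_calculus[OF that this]
  show "(omega has_integral (arctan b - arctan a) / pi) {a..b}"
    by (simp add: diff_divide_distrib)
qed

text \<open>Exhaustion by \<open>[-n, n]\<close>, where the integral is
  \<open>2 arctan n / \<pi>\<close>.\<close>

lemma nn_integral_omega: "(\<integral>\<^sup>+w. ennreal (omega w) \<partial>lborel) = 1"
proof -
  have [measurable]: "omega \<in> borel_measurable borel"
    by (intro borel_measurable_continuous_onI continuous_on_omega)
  have "(\<integral>\<^sup>+w. ennreal (omega w) \<partial>lborel) = (\<integral>\<^sup>+w. (SUP n. ennreal (omega w) * indicator {- real n..real n} w) \<partial>lborel)"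
  proof (intro nn_integral_cong)
    fix w :: real
    obtain n where n: "\<bar>w\<bar> \<le> real n" using real_arch_simple by blast
    show "ennreal (omega w) = (SUP n. ennreal (omega w) * indicator {- real n..real n} w)"
    proof (rule antisym)
      show "ennreal (omega w) \<le> (SUP n. ennreal (omega w) * indicator {- real n..real n} w)"
        by (rule SUP_upper2[of n]) (use n in \<open>auto simp: indicator_def abs_le_iff\<close>)
    qed (auto intro!: SUP_least simp: indicator_def)
  qed
  also have "\<dots> = (SUP n. \<integral>\<^sup>+w. ennreal (omega w) * indicator {- real n..real n} w \<partial>lborel)"
    by (rule nn_integral_monotone_convergence_SUP) (auto simp: incseq_def le_fun_def indicator_def)
  also have "\<dots> = (SUP n. ennreal (2 * arctan (real n) / pi))"
  proof (intro SUP_cong refl)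
    fix n
    have "(omega has_integral (arctan (real n) - arctan (- real n)) / pi) {- real n..real n}"
      using integral_omega[of "- real n" "real n"] integrable_integral[OF integrable_continuous_real[OF continuous_on_omega[of "{- real n..real n}"]]]
      by simp
    then show "(\<integral>\<^sup>+w. ennreal (omega w) * indicator {- real n..real n} w \<partial>lborel) = ennreal (2 * arctan (real n) / pi)"
      using omega_pos by (subst nn_integral_has_integral_lebesgue') (auto simp: arctan_minus less_imp_le)
  qed
  also have "\<dots> = ennreal 1"
  proof (rule LIMSEQ_unique[OF LIMSEQ_SUP])
    show "incseq (\<lambda>n. ennreal (2 * arctan (real n) / pi))"
      by (auto simp: incseq_def intro!: ennreal_leI divide_right_mono arctan_monotone')
    have "((\<lambda>n. arctan (real n)) \<longlongrightarrow> pi / 2) sequentially"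
      by (rule filterlim_compose[OF tendsto_arctan_at_top filterlim_real_sequentially])
    then have "(\<lambda>n. 2 * arctan (real n) / pi) \<longlonglongrightarrow> 2 * (pi / 2) / pi"
      by (intro tendsto_intros) auto
    then show "(\<lambda>n. ennreal (2 * arctan (real n) / pi)) \<longlonglongrightarrow> ennreal 1"
      by (intro tendsto_ennrealI) simp
  qed
  finally show ?thesis by simp
qed

lemma borel_measurable_omega [measurable]: "omega \<in> borel_measurable borel"
  by (intro borel_measurable_continuous_onI continuous_on_omega)

lemma integrable_omega: "integrable lborel omega"
  using nn_integral_omega omega_pos by (intro integrableI_nonneg) (auto simp: less_imp_le)

lemma integral_omega_UNIV: "(LINT w|lborel. omega w) = 1"
  using nn_integral_eq_integral[OF integrable_omega] nn_integral_omega omega_pos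
  by (simp add: less_imp_le)

lemma integrable_omega_mult:
  assumes "continuous_on UNIV f" "\<And>w. \<bar>f w\<bar> \<le> B"
  shows "integrable lborel (\<lambda>w. omega w * f w)"
proof (rule Bochner_Integration.integrable_bound)
  have "f \<in> borel_measurable borel"
    using assms(1) by (rule borel_measurable_continuous_onI)
  then show "(\<lambda>w. omega w * f w) \<in> borel_measurable lborel" by simp
  show "integrable lborel (\<lambda>w. B * omega w)" using integrable_omega by simp
  have "\<bar>omega w * f w\<bar> \<le> \<bar>B * omega w\<bar>" for w
    using assms(2)[of w] omega_pos[of w] by (auto simp: abs_mult mult.commute intro!: mult_right_mono)
  then show "AE w in lborel. norm (omega w * f w) \<le> norm (B * omega w)" by simp
qed

text \<open>The weight is a probability density, so averaging in \<open>v\<close> does not increase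
  suprema. An infinite amplitude leaves nothing to show; a finite one supplies
  integrability.\<close>

lemma amp_jrho:
  assumes J: "smooth_jet J"
  shows "amp (jrho (J p)) k l \<le> amp (J p) k l"
proof (rule amp_leI)
  fix x v
  show "ennreal \<bar>cf (jrho (J p) x v) k l\<bar> \<le> amp (J p) k l"
  proof (cases "l = 0")
    case True
    have c: "continuous_on UNIV (\<lambda>w. cf (J p x w) k 0)"
      by (intro smooth_jet_continuous_on[OF J] continuous_intros)
    show ?thesis
    proof (cases "amp (J p) k 0")
      case (real B)
      have B: "\<bar>cf (J p x w) k 0\<bar> \<le> B" for w
        using le_amp[of "J p" x w k 0] real by simp
      have "\<bar>LINT w|lborel. omega w * cf (J p x w) k 0\<bar> \<le> (LINT w|lborel. \<bar>omega w * cf (J p x w) k 0\<bar>)"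
        by (rule integral_abs_bound)
      also have "\<dots> \<le> (LINT w|lborel. omega w * B)"
      proof (rule integral_mono)
        show "integrable lborel (\<lambda>w. \<bar>omega w * cf (J p x w) k 0\<bar>)"
          using integrable_omega_mult[OF c B] by (rule integrable_abs)
        show "\<bar>omega w * cf (J p x w) k 0\<bar> \<le> omega w * B" for w
          using B omega_pos[of w] by (auto simp: abs_mult intro!: mult_left_mono)
      qed (use integrable_omega in simp)
      also have "\<dots> = B"
        using integral_omega_UNIV by simp
      finally show ?thesis
        using True real by (simp add: jrho_def)
    qed (use True in simp)
  qed (simp add: jrho_def)
qed

lemma am_jrho: "smooth_jet J \<Longrightarrow> am (jrho (J p)) m \<le> am (J p) m"
  unfolding am_def by (intro sum_mono amp_jrho)

text \<open>Truncating the integral to \<open>[-n, n]\<close> gives smooth jets, and the tail is at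
  most \<open>B\<close> times the mass of the weight outside, uniformly in all variables. Freezing
  \<open>v\<close> as a parameter makes the truncation an instance of
  \<open>smooth_jet_integral\<close>.\<close>

lemma smooth_jet_jrho:
  assumes J: "smooth_jet J" and bd: "\<And>k. \<exists>B. \<forall>p x v. \<bar>cf (J p x v) k 0\<bar> \<le> B"
  shows "smooth_jet (\<lambda>p. jrho (J p))"
proof (rule smooth_jet_limit)
  let ?F = "\<lambda>(p, v) x _. Abs_fps (\<lambda>k. Abs_fps (\<lambda>l. if l = 0 then omega v * cf (J p x v) k 0 else 0))"
  let ?A = "\<lambda>n p x v. Abs_fps (\<lambda>k. Abs_fps (\<lambda>l. integral {- real n..real n} (\<lambda>w. cf (?F (p, w) x v) k l)))"
  show "smooth_jet (?A n)" for n
    by (rule smooth_jet_integral[OF smooth_jet_freeze[OF J continuous_on_omega]])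
  fix k l :: nat
  obtain B where B: "\<And>p x v. \<bar>cf (J p x v) k 0\<bar> \<le> B" using bd by blast
  have B0: "0 \<le> B" using B[of undefined 0 0] by linarith
  let ?b = "\<lambda>n. B * (1 - 2 * arctan (real n) / pi)"
  have "((\<lambda>n. arctan (real n)) \<longlongrightarrow> pi / 2) sequentially"
    by (rule filterlim_compose[OF tendsto_arctan_at_top filterlim_real_sequentially])
  then have "?b \<longlonglongrightarrow> B * (1 - 2 * (pi / 2) / pi)"
    by (intro tendsto_intros) auto
  then have lim: "?b \<longlonglongrightarrow> 0" by simp
  have b0: "0 \<le> ?b n" for n
  proof -
    have "2 * arctan (real n) / pi \<le> 1"
      using arctan_ubound[of "real n"] by (simp add: divide_simps)
    then show ?thesis using B0 by simp
  qed
  have "\<bar>cf (?A n p x v) k l - cf (jrho (J p) x v) k l\<bar> \<le> ?b n" for n p x v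
  proof (cases "l = 0")
    case True
    let ?g = "\<lambda>w. omega w * cf (J p x w) k 0" and ?S = "{- real n..real n}"
    have c: "continuous_on UNIV (\<lambda>w. cf (J p x w) k 0)"
      by (intro smooth_jet_continuous_on[OF J] continuous_intros)
    have ig: "integrable lborel ?g"
      by (rule integrable_omega_mult[OF c B])
    have sg: "set_integrable lborel ?S f" if "integrable lborel f" for f :: "real \<Rightarrow> real"
      using integrable_mult_indicator[OF _ that, of ?S] by (simp add: set_integrable_def)
    have eq: "integral ?S ?g - (LINT w|lborel. ?g w) = (LINT w|lborel. indicator ?S w *\<^sub>R ?g w - ?g w)"
      using set_borel_integral_eq_integral(2)[OF sg[OF ig]] sg[OF ig] ig
      by (subst Bochner_Integration.integral_diff) (auto simp: set_lebesgue_integral_def set_integrable_def)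
    have "\<bar>integral ?S ?g - (LINT w|lborel. ?g w)\<bar> \<le> (LINT w|lborel. \<bar>indicator ?S w *\<^sub>R ?g w - ?g w\<bar>)"
      unfolding eq by (rule integral_abs_bound)
    also have "\<dots> \<le> (LINT w|lborel. B * (omega w - indicator ?S w *\<^sub>R omega w))"
    proof (rule integral_mono)
      show "integrable lborel (\<lambda>w. \<bar>indicator ?S w *\<^sub>R ?g w - ?g w\<bar>)"
        using sg[OF ig] ig by (auto simp: set_integrable_def)
      show "integrable lborel (\<lambda>w. B * (omega w - indicator ?S w *\<^sub>R omega w))"
        using sg[OF integrable_omega] integrable_omega by (auto simp: set_integrable_def)
      fix w
      show "\<bar>indicator ?S w *\<^sub>R ?g w - ?g w\<bar> \<le> B * (omega w - indicator ?S w *\<^sub>R omega w)"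
        using B[of p x w] omega_pos[of w] by (auto simp: indicator_def abs_mult mult.commute intro!: mult_right_mono)
    qed
    also have "\<dots> = B * (1 - integral ?S omega)"
      using set_borel_integral_eq_integral(2)[OF sg[OF integrable_omega]] sg[OF integrable_omega] integrable_omega
      by (simp add: set_lebesgue_integral_def set_integrable_def integral_omega_UNIV)
    also have "\<dots> = ?b n"
      by (simp add: integral_omega arctan_minus)
    finally show ?thesis using True by (simp add: jrho_def)
  qed (use b0 in \<open>simp add: jrho_def\<close>)
  with lim show "\<exists>b. b \<longlonglongrightarrow> 0 \<and> (\<forall>n p x v. \<bar>cf (?A n p x v) k l - cf (jrho (J p) x v) k l\<bar> \<le> b n)"
    by blast
qed

section \<open>Jets and partial derivatives\<close>

text \<open>The constant \<open>c\<close> and the indices are general because each differentiation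
  moves to the next coefficient and changes the factor; only so does the induction close.\<close>

lemma C_k_smooth_jet:
  assumes J: "smooth_jet J"
  shows "C_k n (\<lambda>x v. c * cf (J p x v) k l)"
proof (induction n arbitrary: c k l)
  case 0
  show ?case
    unfolding C_k.simps case_prod_beta' by (intro continuous_intros smooth_jet_continuous_on[OF J])
next
  case (Suc n)
  have x: "((\<lambda>y. c * cf (J p y v) k l) has_real_derivative (c * real (Suc k)) * cf (J p x v) (Suc k) l) (at x)" for x v
    using DERIV_cmult[OF smooth_jet_x[OF J]] by (simp add: mult.assoc)
  have v: "((\<lambda>w. c * cf (J p x w) k l) has_real_derivative (c * real (Suc l)) * cf (J p x v) k (Suc l)) (at v)" for x v
    using DERIV_cmult[OF smooth_jet_v[OF J]] by (simp add: mult.assoc)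
  have "pd_x (\<lambda>x v. c * cf (J p x v) k l) = (\<lambda>x v. (c * real (Suc k)) * cf (J p x v) (Suc k) l)"
    "pd_v (\<lambda>x v. c * cf (J p x v) k l) = (\<lambda>x v. (c * real (Suc l)) * cf (J p x v) k (Suc l))"
    using DERIV_imp_deriv[OF x] DERIV_imp_deriv[OF v] by (auto simp: pd_x_def pd_v_def fun_eq_iff)
  moreover have "(\<lambda>y. c * cf (J p y v) k l) differentiable (at x)" for x v
    using x[of v x] unfolding real_differentiable_def by blast
  moreover have "(\<lambda>w. c * cf (J p x w) k l) differentiable (at v)" for x v
    using v[of x v] unfolding real_differentiable_def by blast
  ultimately show ?case
    unfolding C_k.simps using Suc by (simp del: of_nat_Suc)
qed

lemma C_inf_smooth_jet: "smooth_jet J \<Longrightarrow> C_inf (\<lambda>x v. cf (J p x v) 0 0)"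
  using C_k_smooth_jet[of J _ 1 p 0 0] by (simp add: C_inf_def)

lemma pd_smooth_jet:
  assumes J: "smooth_jet J"
  shows "pd k l (\<lambda>x v. cf (J p x v) 0 0) = (\<lambda>x v. fact k * fact l * cf (J p x v) k l)"
proof -
  have v: "(pd_v ^^ l) (\<lambda>x v. cf (J p x v) 0 0) = (\<lambda>x v. fact l * cf (J p x v) 0 l)" for l
  proof (induction l)
    case (Suc l)
    have "((\<lambda>w. fact l * cf (J p x w) 0 l) has_real_derivative fact (Suc l) * cf (J p x v) 0 (Suc l)) (at v)" for x v
      using DERIV_cmult[OF smooth_jet_v[OF J], of "fact l"] by (simp add: mult_ac)
    then show ?case
      unfolding funpow.simps o_apply Suc by (auto simp: pd_v_def fun_eq_iff intro!: DERIV_imp_deriv simp del: fact_Suc)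
  qed simp
  show ?thesis
  proof (induction k)
    case (Suc k)
    have "((\<lambda>y. fact k * fact l * cf (J p y v) k l) has_real_derivative fact (Suc k) * fact l * cf (J p x v) (Suc k) l) (at x)" for x v
      using DERIV_cmult[OF smooth_jet_x[OF J], of "fact k * fact l"] by (simp add: mult_ac)
    then show ?case
      using Suc unfolding pd_def funpow.simps o_apply
      by (auto simp: pd_x_def fun_eq_iff intro!: DERIV_imp_deriv simp del: fact_Suc)
  qed (simp add: pd_def v)
qed

section \<open>Symmetry of mixed partial derivatives\<close>

lemma C_inf_pd_x: "C_inf f \<Longrightarrow> C_inf (pd_x f)" and C_inf_pd_v: "C_inf f \<Longrightarrow> C_inf (pd_v f)"
  unfolding C_inf_def by (metis C_k.simps(2))+

lemma C_inf_continuous: "C_inf f \<Longrightarrow> continuous_on UNIV (\<lambda>(x, v). f x v)"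
  unfolding C_inf_def by (metis C_k.simps(1))

lemma C_inf_DERIV_x: "C_inf f \<Longrightarrow> ((\<lambda>y. f y v) has_real_derivative pd_x f x v) (at x)"
  and C_inf_DERIV_v: "C_inf f \<Longrightarrow> ((\<lambda>w. f x w) has_real_derivative pd_v f x v) (at v)"
  unfolding C_inf_def pd_x_def pd_v_def by (metis C_k.simps(2) DERIV_deriv_iff_real_differentiable)+

lemma C_inf_continuous_on:
  assumes "C_inf f" "continuous_on S g" "continuous_on S h"
  shows "continuous_on S (\<lambda>z. f (g z) (h z))"
  using continuous_on_compose2[OF C_inf_continuous[OF assms(1)], of S "\<lambda>z. (g z, h z)"]
  by (simp add: assms continuous_on_Pair)

text \<open>Write \<open>f\<close> as its value at a base point plus the integral of its
  \<open>v\<close>-derivative, differentiate in \<open>x\<close> under the integral, then in the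
  upper limit.\<close>

lemma pd_x_pd_v_commute:
  assumes f: "C_inf f"
  shows "pd_v (pd_x f) = pd_x (pd_v f)"
proof (intro ext)
  fix x v :: real
  \<comment> \<open>The base point lies strictly to the left of \<open>v\<close>, so that
    \<open>v\<close> is interior and a two-sided derivative results.\<close>
  let ?u = "pd_v f" and ?a = "v - 1"
  note u = C_inf_pd_v[OF f] and uu = C_inf_pd_x[OF C_inf_pd_v[OF f]]
  define D where "D w = pd_x f x ?a + integral {?a..w} (pd_x ?u x)" for w
  have feq: "f y w = f y ?a + integral {?a..w} (?u y)" if "?a \<le> w" for y w
  proof -
    have "(?u y has_integral f y w - f y ?a) {?a..w}"
      by (rule fundamental_theorem_of_calculus[OF that])
        (simp add: has_real_derivative_iff_has_vector_derivative[symmetric] DERIV_subset[OF C_inf_DERIV_v[OF f]])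
    then show ?thesis by (simp add: integral_unique)
  qed
  have Dw: "pd_x f x w = D w" if "?a \<le> w" for w
  proof -
    have "((\<lambda>y. integral (cbox ?a w) (?u y)) has_real_derivative integral (cbox ?a w) (pd_x ?u x)) (at x within UNIV)"
    proof (rule leibniz_rule_field_derivative)
      show "?u y integrable_on cbox ?a w" for y
        by (intro integrable_continuous C_inf_continuous_on[OF u] continuous_intros)
      show "continuous_on (UNIV \<times> cbox ?a w) (\<lambda>(y, s). pd_x ?u y s)"
        unfolding case_prod_beta' by (intro C_inf_continuous_on[OF uu] continuous_intros)
    qed (auto intro: C_inf_DERIV_x[OF u])
    then have "((\<lambda>y. f y ?a + integral {?a..w} (?u y)) has_real_derivative D w) (at x)"
      unfolding D_def by (auto intro!: derivative_eq_intros C_inf_DERIV_x[OF f])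
    then have "((\<lambda>y. f y w) has_real_derivative D w) (at x)"
      using feq[OF that] by simp
    then show ?thesis unfolding pd_x_def by (rule DERIV_imp_deriv)
  qed
  have "((\<lambda>w. integral {?a..w} (pd_x ?u x)) has_real_derivative pd_x ?u x v) (at v within {?a..v + 1})"
    by (intro integral_has_real_derivative C_inf_continuous_on[OF uu] continuous_intros) auto
  then have "(D has_real_derivative pd_x ?u x v) (at v within {?a..v + 1})"
    unfolding D_def by (auto intro!: derivative_eq_intros)
  then have "(D has_real_derivative pd_x ?u x v) (at v)"
    by (simp add: at_within_Icc_at)
  then have "((\<lambda>w. pd_x f x w) has_real_derivative pd_x ?u x v) (at v)"
    by (rule has_field_derivative_transform_within_open[of _ _ _ "{?a<..}"]) (auto simp: Dw)
  then show "pd_v (pd_x f) x v = pd_x (pd_v f) x v"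
    unfolding pd_v_def[of "pd_x f"] by (rule DERIV_imp_deriv)
qed

text \<open>\<open>pd\<close> applies the \<open>v\<close>-derivatives first; a further one must be
  moved past all \<open>x\<close>-derivatives.\<close>

lemma pd_v_pd:
  assumes "C_inf f"
  shows "pd_v (pd k l f) = pd k (Suc l) f"
proof -
  have "pd_v ((pd_x ^^ k) h) = (pd_x ^^ k) (pd_v h) \<and> C_inf ((pd_x ^^ k) h)" if "C_inf h" for h
    using that by (induction k) (auto simp: pd_x_pd_v_commute C_inf_pd_x)
  moreover have "C_inf ((pd_v ^^ l) f)"
    using assms by (induction l) (auto simp: C_inf_pd_v)
  ultimately show ?thesis by (simp add: pd_def)
qed

lemma C_inf_pd: "C_inf f \<Longrightarrow> C_inf (pd k l f)"
proof -
  assume "C_inf f"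
  then have "C_inf ((pd_v ^^ l) f)" by (induction l) (auto simp: C_inf_pd_v)
  then show ?thesis unfolding pd_def by (induction k) (auto simp: C_inf_pd_x)
qed

definition jet_of :: "(real \<Rightarrow> real \<Rightarrow> real) \<Rightarrow> real \<Rightarrow> real \<Rightarrow> real fps fps" where
  "jet_of f x v = Abs_fps (\<lambda>k. Abs_fps (\<lambda>l. pd k l f x v / (fact k * fact l)))"

lemma cf_jet_of: "cf (jet_of f x v) k l = pd k l f x v / (fact k * fact l)"
  by (simp add: jet_of_def)

lemma smooth_jet_jet_of:
  assumes g: "\<And>p. C_inf (g p)"
    and cont: "\<And>k l. continuous_on UNIV (\<lambda>(p, x, v). pd k l (g p) x v)"
  shows "smooth_jet (\<lambda>p. jet_of (g p))"
proof (rule smooth_jetI)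
  show "continuous_on UNIV (\<lambda>(p, x, v). cf (jet_of (g p) x v) k l)" for k l
    using cont[of k l] unfolding cf_jet_of case_prod_beta' by (intro continuous_intros) auto
next
  fix p x v k l
  have "((\<lambda>y. pd k l (g p) y v) has_real_derivative pd (Suc k) l (g p) x v) (at x)"
    using C_inf_DERIV_x[OF C_inf_pd[OF g]] by (simp add: pd_def)
  from DERIV_cdivide[OF this, of "fact k * fact l"]
  show "((\<lambda>y. cf (jet_of (g p) y v) k l) has_real_derivative real (Suc k) * cf (jet_of (g p) x v) (Suc k) l) (at x)"
    by (simp add: cf_jet_of mult_ac del: of_nat_Suc)
next
  fix p x v k l
  have "((\<lambda>w. pd k l (g p) x w) has_real_derivative pd k (Suc l) (g p) x v) (at v)"
    using C_inf_DERIV_v[OF C_inf_pd[OF g]] by (simp add: pd_v_pd[OF g])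
  from DERIV_cdivide[OF this, of "fact k * fact l"]
  show "((\<lambda>w. cf (jet_of (g p) x w) k l) has_real_derivative real (Suc l) * cf (jet_of (g p) x v) k (Suc l)) (at v)"
    by (simp add: cf_jet_of mult_ac del: of_nat_Suc)
qed

text \<open>All coefficients are derivatives of the one of index \<open>(0, 0)\<close>.\<close>

lemma smooth_jet_eqI:
  assumes A: "smooth_jet A" and B: "smooth_jet B"
    and eq: "\<And>x v. cf (A p x v) 0 0 = cf (B p x v) 0 0"
  shows "A p = B p"
proof (intro ext fps_fps_eqI)
  fix x v k l
  have "(\<lambda>x v. fact k * fact l * cf (A p x v) k l) = (\<lambda>x v. fact k * fact l * cf (B p x v) k l)"
    unfolding pd_smooth_jet[OF A, symmetric] pd_smooth_jet[OF B, symmetric] eq ..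
  then show "cf (A p x v) k l = cf (B p x v) k l"
    by (auto dest!: fun_cong)
qed

section \<open>Continuity in time with values in smooth functions, versus joint continuity\<close>

definition clamp_time :: "real \<Rightarrow> real \<Rightarrow> real" where
  "clamp_time T t = max 0 (min T t)"

lemma clamp_time_in: "0 \<le> T \<Longrightarrow> clamp_time T t \<in> {0..T}"
  and clamp_time_eq: "t \<in> {0..T} \<Longrightarrow> clamp_time T t = t"
  and continuous_clamp_time: "continuous_on S (clamp_time T)"
  unfolding clamp_time_def[abs_def] by (auto intro!: continuous_intros)

lemma clamp_time_idem [simp]: "clamp_time T (clamp_time T t) = clamp_time T t"
  unfolding clamp_time_def by auto

text \<open>Joint continuity is uniform on the compact set \<open>{0..T} \<times> C\<close>.\<close>

lemma C_time_C_inf_smooth_jet: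
  assumes J: "smooth_jet J"
  shows "C_time_C_inf T (\<lambda>t x v. cf (J t x v) 0 0)"
  unfolding C_time_C_inf_def
proof (intro conjI ballI allI impI)
  show "C_inf (\<lambda>x v. cf (J t x v) 0 0)" for t
    by (rule C_inf_smooth_jet[OF J])
  fix t k l and C :: "(real \<times> real) set"
  assume t: "t \<in> {0..T}" and C: "compact C"
  let ?h = "\<lambda>z. fact k * fact l * cf (J (fst z) (fst (snd z)) (snd (snd z))) k l :: real"
  have "uniformly_continuous_on ({0..T} \<times> C) ?h"
    by (intro compact_uniformly_continuous compact_Times C continuous_intros smooth_jet_continuous_on[OF J]) auto
  then have uc: "\<exists>d>0. \<forall>x\<in>{0..T} \<times> C. \<forall>x'\<in>{0..T} \<times> C. dist x' x < d \<longrightarrow> dist (?h x') (?h x) < e" if "e > 0" for e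
    using that unfolding uniformly_continuous_on_def by blast
  show "uniform_limit C (\<lambda>s (x, v). pd k l (\<lambda>x v. cf (J s x v) 0 0) x v)
     (\<lambda>(x, v). pd k l (\<lambda>x v. cf (J t x v) 0 0) x v) (at t within {0..T})"
  proof (rule uniform_limitI)
    fix e :: real assume "e > 0"
    from uc[OF this] obtain d where d: "d > 0"
      "\<And>z z'. z \<in> {0..T} \<times> C \<Longrightarrow> z' \<in> {0..T} \<times> C \<Longrightarrow> dist z' z < d \<Longrightarrow> dist (?h z') (?h z) < e" by blast
    have "\<forall>\<^sub>F s in at t within {0..T}. s \<in> {0..T} \<and> dist s t < d"
      using d(1) by (auto simp: eventually_at)
    then show "\<forall>\<^sub>F s in at t within {0..T}. \<forall>z\<in>C.
        dist (case z of (x, v) \<Rightarrow> pd k l (\<lambda>x v. cf (J s x v) 0 0) x v) (case z of (x, v) \<Rightarrow> pd k l (\<lambda>x v. cf (J t x v) 0 0) x v) < e"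
    proof eventually_elim
      case (elim s)
      show ?case
      proof
        fix z assume "z \<in> C"
        have "dist (s, z) (t, z) < d" using elim by (simp add: dist_Pair_Pair)
        then have "dist (?h (s, z)) (?h (t, z)) < e"
          using d(2)[of "(t, z)" "(s, z)"] t elim \<open>z \<in> C\<close> by auto
        then show "dist (case z of (x, v) \<Rightarrow> pd k l (\<lambda>x v. cf (J s x v) 0 0) x v) (case z of (x, v) \<Rightarrow> pd k l (\<lambda>x v. cf (J t x v) 0 0) x v) < e"
          by (simp add: pd_smooth_jet[OF J] case_prod_beta')
      qed
    qed
  qed
qed

text \<open>Joint continuity at \<open>(t, x, v)\<close>: first move in time, uniformly on the
  closed unit ball around \<open>(x, v)\<close>, then in space at the fixed time \<open>t\<close>.
  Clamping carries this from \<open>{0..T}\<close> to all times.\<close>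

lemma smooth_jet_C_time_C_inf:
  assumes g: "C_time_C_inf T g" and T: "0 \<le> T"
  shows "smooth_jet (\<lambda>t. jet_of (g (clamp_time T t)))"
proof (rule smooth_jet_jet_of)
  show "C_inf (g (clamp_time T t))" for t
    using g clamp_time_in[OF T] by (auto simp: C_time_C_inf_def)
  fix k l
  let ?h = "\<lambda>t z. pd k l (g t) (fst z) (snd z)"
  have c: "continuous_on UNIV (?h t)" if "t \<in> {0..T}" for t
    using that g by (intro C_inf_continuous_on[OF C_inf_pd] continuous_intros) (auto simp: C_time_C_inf_def)
  have "continuous_on ({0..T} \<times> UNIV) (\<lambda>(t, z). ?h t z)"
    unfolding continuous_on_eq_continuous_within
  proof safe
    fix t x v assume t: "t \<in> {0..T}"
    show "continuous (at (t, x, v) within {0..T} \<times> UNIV) (\<lambda>(t, z). ?h t z)"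
      unfolding continuous_within_eps_delta
    proof (intro allI impI)
      fix e :: real assume e: "e > 0"
      have "uniform_limit (cball (x, v) 1) (\<lambda>s (x, v). pd k l (g s) x v) (\<lambda>(x, v). pd k l (g t) x v) (at t within {0..T})"
        using g t by (auto simp: C_time_C_inf_def)
      from uniform_limitD[OF this, of "e / 2"] e
      have "\<forall>\<^sub>F s in at t within {0..T}. \<forall>z\<in>cball (x, v) 1. dist (?h s z) (?h t z) < e / 2"
        by (simp add: case_prod_beta')
      then obtain d where d: "d > 0"
        "\<And>s z. s \<in> {0..T} \<Longrightarrow> s \<noteq> t \<Longrightarrow> dist s t < d \<Longrightarrow> z \<in> cball (x, v) 1 \<Longrightarrow> dist (?h s z) (?h t z) < e / 2"
        unfolding eventually_at by blast
      have "continuous (at (x, v)) (?h t)"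
        using c[OF t] by (simp add: continuous_on_eq_continuous_at)
      then obtain d' where d': "d' > 0" "\<And>z. dist z (x, v) < d' \<Longrightarrow> dist (?h t z) (?h t (x, v)) < e / 2"
        unfolding continuous_at_eps_delta using e by (metis half_gt_zero)
      \<comment> \<open>The 1 in the minimum keeps \<open>z\<close> in the unit ball; the limit in
        time excludes \<open>s = t\<close>, which is treated apart.\<close>
      show "\<exists>d>0. \<forall>y\<in>{0..T} \<times> UNIV. dist y (t, x, v) < d \<longrightarrow>
          dist (case y of (t, z) \<Rightarrow> ?h t z) (case (t, x, v) of (t, z) \<Rightarrow> ?h t z) < e"
      proof (intro exI[of _ "min d (min d' 1)"] conjI ballI impI)
        fix y assume y: "y \<in> {0..T} \<times> (UNIV :: (real \<times> real) set)" "dist y (t, x, v) < min d (min d' 1)"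
        obtain s z where [simp]: "y = (s, z)" by (cases y)
        have ds: "dist s t < min d (min d' 1)" "dist z (x, v) < min d (min d' 1)"
          using y(2) dist_fst_le[of y "(t, x, v)"] dist_snd_le[of y "(t, x, v)"] by auto
        have "dist (?h s z) (?h t z) < e / 2"
        proof (cases "s = t")
          case False
          then show ?thesis using d(2)[of s z] ds y by (auto simp: dist_commute)
        qed (use e in simp)
        moreover have "dist (?h t z) (?h t (x, v)) < e / 2"
          using d'(2)[of z] ds by simp
        ultimately show "dist (case y of (t, z) \<Rightarrow> ?h t z) (case (t, x, v) of (t, z) \<Rightarrow> ?h t z) < e"
          using dist_triangle[of "?h s z" "?h t (x, v)" "?h t z"] by simp
      qed (use d d' in auto)
    qed
  qed
  then have "continuous_on UNIV (\<lambda>w. case (clamp_time T (fst w), snd w) of (t, z) \<Rightarrow> ?h t z)"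
    by (rule continuous_on_compose2)
      (auto intro!: continuous_intros continuous_on_compose2[OF continuous_clamp_time] simp: clamp_time_in[OF T] simp del: atLeastAtMost_iff)
  then show "continuous_on UNIV (\<lambda>(t, x, v). pd k l (g (clamp_time T t)) x v)"
    by (simp add: case_prod_beta')
qed

text \<open>The factor \<open>k! l!\<close> between derivatives and Taylor coefficients cancels the
  denominator of the norm; what remains depends on \<open>k + l\<close> only, and the double series
  collapses along diagonals.\<close>

lemma deriv_norm_jet:
  assumes pd: "\<And>k l x v. pd k l f x v = fact k * fact l * cf (J x v) k l" and L: "0 \<le> L"
  shows "deriv_norm L n f = (\<Sum>m. ennreal (if n \<le> m then fact m / fact (m - n) * L ^ (m - n) else 0) * am J m)"
proof -
  let ?b = "\<lambda>m. ennreal (if n \<le> m then fact m / fact (m - n) * L ^ (m - n) else 0)"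
  have sup: "sup_norm (pd k l f) = ennreal (fact k * fact l) * amp J k l" for k l
    unfolding sup_norm_def amp_def SUP_mult_left_ennreal
    by (auto simp: pd abs_mult ennreal_mult split: prod.splits intro!: SUP_cong)
  have "deriv_norm L n f = (\<Sum>k. \<Sum>l. ?b (k + l) * amp J k l)"
    unfolding deriv_norm_def
  proof (intro suminf_cong)
    fix k l
    have "ennreal (fact (k + l) / fact (k + l - n) * (L ^ (k + l - n) / (fact k * fact l))) * (ennreal (fact k * fact l) * amp J k l)
        = ennreal (fact (k + l) / fact (k + l - n) * L ^ (k + l - n)) * amp J k l"
      using L by (simp add: mult.assoc[symmetric] ennreal_mult[symmetric])
    then show "(if n \<le> k + l then ennreal (fact (k + l) / fact (k + l - n) * (L ^ (k + l - n) / (fact k * fact l)))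
            * sup_norm (pd k l f) else 0) = ?b (k + l) * amp J k l"
      by (simp add: sup)
  qed
  also have "\<dots> = (\<Sum>m. \<Sum>k\<le>m. ?b (k + (m - k)) * amp J k (m - k))"
    by (rule suminf_ennreal_triangle[symmetric])
  also have "\<dots> = (\<Sum>m. ?b m * am J m)"
    by (intro suminf_cong) (simp add: am_def sum_distrib_left)
  finally show ?thesis .
qed

lemma sum_deriv_norm_jet:
  assumes pd: "\<And>k l x v. pd k l f x v = fact k * fact l * cf (J x v) k l" and L: "0 \<le> L"
    and c: "\<And>n. 0 \<le> c n"
    and w: "\<And>m. (\<Sum>n\<le>m. c n * (fact m / fact (m - n) * L ^ (m - n))) = w m"
  shows "(\<Sum>n. ennreal (c n) * deriv_norm L n f) = wnorm w (am J)"
proof -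
  let ?b = "\<lambda>n m. if n \<le> m then fact m / fact (m - n) * L ^ (m - n) else 0"
  have "(\<Sum>n. ennreal (c n) * deriv_norm L n f) = (\<Sum>n. \<Sum>m. ennreal (c n * ?b n m) * am J m)"
    unfolding deriv_norm_jet[OF pd L] ennreal_suminf_cmult[symmetric]
    using c L by (intro suminf_cong) (auto simp: ennreal_mult mult.assoc)
  also have "\<dots> = (\<Sum>m. \<Sum>n. ennreal (c n * ?b n m) * am J m)"
    by (rule suminf_ennreal_swap)
  also have "\<dots> = wnorm w (am J)"
    unfolding wnorm_def ennreal_suminf_multc
  proof (intro suminf_cong arg_cong2[where f = "(*)"] refl)
    fix m
    have "(\<Sum>n. ennreal (c n * ?b n m)) = (\<Sum>n\<le>m. ennreal (c n * ?b n m))"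
      by (rule suminf_finite) auto
    also have "\<dots> = ennreal (w m)"
      using c L by (subst sum_ennreal) (auto simp: w[symmetric] intro!: arg_cong[where f = ennreal] sum.cong)
    finally show "(\<Sum>n. ennreal (c n * ?b n m)) = ennreal (w m)" .
  qed
  finally show ?thesis .
qed

text \<open>The weight arises from
  \<open>m! / ((n!)^2 (m - n)!) = (m choose n) / n!\<close>.\<close>

lemma norm_H_jet:
  assumes pd: "\<And>k l x v. pd k l f x v = fact k * fact l * cf (J x v) k l" and L: "0 \<le> L"
  shows "norm_H L f = norm_W L J"
  unfolding norm_H_def
proof (rule sum_deriv_norm_jet[OF pd L])
  fix m
  show "(\<Sum>n\<le>m. 1 / (fact n)\<^sup>2 * (fact m / fact (m - n) * L ^ (m - n))) = W L m"
    unfolding W_def by (intro sum.cong refl) (simp add: binomial_fact power2_eq_square)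
qed simp

text \<open>The term \<open>n = 0\<close> vanishes, and
  \<open>(n + 1)^2 / ((n + 1)!)^2 = 1 / (n!)^2\<close> leads back to the weight of the norm at
  \<open>m - 1\<close>, times \<open>m\<close>.\<close>

lemma seminorm_H_jet:
  assumes pd: "\<And>k l x v. pd k l f x v = fact k * fact l * cf (J x v) k l" and L: "0 \<le> L"
  shows "seminorm_H L f = seminorm_W L J"
  unfolding seminorm_H_def
proof (rule sum_deriv_norm_jet[OF pd L])
  fix m
  show "(\<Sum>n\<le>m. (real n)\<^sup>2 / (fact n)\<^sup>2 * (fact m / fact (m - n) * L ^ (m - n))) = W' L m"
  proof (cases m)
    case (Suc i)
    have "(\<Sum>n\<le>Suc i. (real n)\<^sup>2 / (fact n)\<^sup>2 * (fact (Suc i) / fact (Suc i - n) * L ^ (Suc i - n)))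
        = (\<Sum>n\<le>i. (real (Suc n))\<^sup>2 / (fact (Suc n))\<^sup>2 * (fact (Suc i) / fact (i - n) * L ^ (i - n)))"
      by (subst sum.atMost_Suc_shift) (simp del: of_nat_Suc fact_Suc)
    also have "\<dots> = W' L (Suc i)"
      unfolding W'_def W_def diff_Suc_1 sum_distrib_left
    proof (intro sum.cong refl)
      fix n assume "n \<in> {..i}"
      have "(real (Suc n))\<^sup>2 / (fact (Suc n))\<^sup>2 = 1 / (fact n :: real)\<^sup>2"
        by (simp add: fact_Suc power_mult_distrib del: of_nat_Suc)
      then show "(real (Suc n))\<^sup>2 / (fact (Suc n))\<^sup>2 * (fact (Suc i) / fact (i - n) * L ^ (i - n))
          = real (Suc i) * (real (i choose n) * (L ^ (i - n) / fact n))"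
        using \<open>n \<in> {..i}\<close> by (simp add: binomial_fact power2_eq_square mult_ac del: of_nat_Suc)
    qed
    finally show ?thesis unfolding Suc .
  qed simp
qed simp

text \<open>\<open>alpha v = - 2 Re (1 / (v - i))\<close>, whose Taylor coefficients are explicit and bounded by 2.\<close>

definition jalpha :: "real \<Rightarrow> real \<Rightarrow> real fps fps" where
  "jalpha x v = Abs_fps (\<lambda>k. Abs_fps (\<lambda>l. if k = 0 then - 2 * (- 1) ^ l * Re (inverse (complex_of_real v - \<i>) ^ Suc l) else 0))"

lemma of_real_minus_ii_nonzero: "complex_of_real v - \<i> \<noteq> 0"
  by (auto simp: complex_eq_iff)

lemma norm_inverse_of_real_minus_ii: "norm (inverse (complex_of_real v - \<i>)) \<le> 1"
proof -
  have "1 \<le> norm (complex_of_real v - \<i>)"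
    using abs_Im_le_cmod[of "complex_of_real v - \<i>"] by simp
  then show ?thesis by (simp add: norm_inverse inverse_le_1_iff)
qed

lemma smooth_jet_jalpha: "smooth_jet (\<lambda>p :: 'a :: topological_space. jalpha)"
proof (rule smooth_jetI)
  fix k l
  have "continuous_on UNIV (\<lambda>z :: 'a \<times> real \<times> real. - 2 * (- 1) ^ l * Re (inverse (complex_of_real (snd (snd z)) - \<i>) ^ Suc l))"
    by (intro continuous_intros ballI of_real_minus_ii_nonzero)
  then show "continuous_on UNIV (\<lambda>(p :: 'a, x, v). cf (jalpha x v) k l)"
    unfolding jalpha_def case_prod_beta' by (cases "k = 0") (simp_all del: power_Suc)
next
  fix x v k l
  have "((\<lambda>w. inverse (complex_of_real w - \<i>) ^ Suc l) has_vector_derivative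
      - (of_nat (Suc l) * inverse (complex_of_real v - \<i>) ^ Suc (Suc l))) (at v)"
  proof -
    have "((\<lambda>z. inverse (z - \<i>) ^ Suc l) has_field_derivative
        - (of_nat (Suc l) * inverse (complex_of_real v - \<i>) ^ Suc (Suc l))) (at (complex_of_real v))"
    proof -
      have "((\<lambda>z. inverse (z - \<i>)) has_field_derivative - (inverse (complex_of_real v - \<i>) ^ Suc (Suc 0))) (at (complex_of_real v))"
        using of_real_minus_ii_nonzero[of v] by (auto intro!: derivative_eq_intros simp: power2_eq_square)
      from DERIV_power_Suc[OF this, of l] show ?thesis by (simp add: mult_ac)
    qed
    from has_vector_derivative_real_field[OF this] show ?thesis .
  qed
  then have "((\<lambda>w. Re (inverse (complex_of_real w - \<i>) ^ Suc l)) has_real_derivative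
      Re (- (of_nat (Suc l) * inverse (complex_of_real v - \<i>) ^ Suc (Suc l)))) (at v)"
    by (rule has_field_derivative_Re)
  from DERIV_cmult[OF this, of "- 2 * (- 1) ^ l"]
  show "((\<lambda>w. cf (jalpha x w) k l) has_real_derivative real (Suc l) * cf (jalpha x v) k (Suc l)) (at v)"
    by (cases "k = 0") (simp_all add: jalpha_def algebra_simps del: power_Suc of_nat_Suc add: power_Suc[of "- 1"])
qed (simp add: jalpha_def)

lemma cf_jalpha_0: "cf (jalpha x v) 0 0 = alpha v"
proof -
  have "Re (inverse (complex_of_real v - \<i>)) = v / (1 + v\<^sup>2)"
    by (simp add: Re_inverse power2_eq_square)
  then show ?thesis by (simp add: jalpha_def alpha_eq)
qed

text \<open>The pole \<open>i\<close> has distance at least 1 from the real line, so every power of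
  \<open>1 / (v - i)\<close> has modulus at most 1; only \<open>k = 0\<close> contributes.\<close>

lemma am_jalpha: "am jalpha m \<le> 2"
proof -
  have "amp jalpha k l \<le> (if k = 0 then 2 else 0)" for k l
  proof (rule amp_leI)
    fix x v
    let ?z = "inverse (complex_of_real v - \<i>)"
    have "\<bar>Re (?z ^ Suc l)\<bar> \<le> norm (?z ^ Suc l)" by (rule abs_Re_le_cmod)
    also have "\<dots> \<le> 1"
      unfolding norm_power by (intro power_le_one norm_inverse_of_real_minus_ii) simp
    finally have "\<bar>Re (?z ^ Suc l)\<bar> \<le> 1" .
    then have "k = 0 \<Longrightarrow> \<bar>cf (jalpha x v) k l\<bar> \<le> 2"
      by (simp add: jalpha_def abs_mult power_abs)
    from ennreal_leI[OF this] show "ennreal \<bar>cf (jalpha x v) k l\<bar> \<le> (if k = 0 then 2 else 0)"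
      by (cases "k = 0") (auto simp: jalpha_def)
  qed
  then have "am jalpha m \<le> (\<Sum>k\<le>m. if k = 0 then 2 else 0)"
    unfolding am_def by (intro sum_mono)
  then show ?thesis by simp
qed

lemma sum_choose_const_lower: "(\<Sum>i\<le>j. n + i choose n) = (Suc n + j choose Suc n)"
  by (induction j) auto

text \<open>Passing from \<open>n\<close> to \<open>n + 1\<close> is a Cauchy product with the
  geometric series, the coefficients being partial sums of the preceding ones.\<close>

lemma suminf_negative_binomial:
  assumes "0 \<le> L" "L < 1"
  shows "(\<Sum>j. ennreal (real (n + j choose n) * L ^ j)) = ennreal ((1 / (1 - L)) ^ Suc n)"
proof -
  have geo: "(\<Sum>j. ennreal (L ^ j)) = ennreal (1 / (1 - L))"
    using assms by (intro suminf_ennreal_eq geometric_sums) auto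
  show ?thesis
  proof (induction n)
    case 0
    show ?case using geo by simp
  next
    case (Suc n)
    have "(\<Sum>j. ennreal (real (Suc n + j choose Suc n) * L ^ j))
        = (\<Sum>j. \<Sum>i\<le>j. ennreal (real (n + i choose n) * L ^ i) * ennreal (L ^ (j - i)))"
    proof (intro suminf_cong)
      fix j
      have "real (Suc n + j choose Suc n) * L ^ j = (\<Sum>i\<le>j. real (n + i choose n) * L ^ i * L ^ (j - i))"
        unfolding sum_choose_const_lower[symmetric] of_nat_sum sum_distrib_right
        by (intro sum.cong refl) (simp add: mult.assoc power_add[symmetric])
      then show "ennreal (real (Suc n + j choose Suc n) * L ^ j)
          = (\<Sum>i\<le>j. ennreal (real (n + i choose n) * L ^ i) * ennreal (L ^ (j - i)))"
        using assms by (simp only: ennreal_mult[symmetric] sum_ennreal zero_le_power mult_nonneg_nonneg of_nat_0_le_iff)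
    qed
    also have "\<dots> = (\<Sum>i. \<Sum>m. ennreal (real (n + i choose n) * L ^ i) * ennreal (L ^ m))"
      by (rule suminf_ennreal_triangle)
    also have "\<dots> = ennreal ((1 / (1 - L)) ^ Suc n) * ennreal (1 / (1 - L))"
      by (simp only: ennreal_suminf_cmult ennreal_suminf_multc geo Suc.IH)
    also have "\<dots> = ennreal ((1 / (1 - L)) ^ Suc (Suc n))"
      using assms by (simp add: ennreal_mult[symmetric] mult.commute)
    finally show ?case .
  qed
qed

text \<open>Generating function of the Laguerre polynomials: summing over \<open>m\<close> first
  leaves \<open>(1 - L)^(-n - 1) / n!\<close>, and the sum over \<open>n\<close> is an exponential
  series.\<close>

lemma wnorm_W_const_finite:
  assumes "0 \<le> L" "L < 1"
  shows "wnorm (W L) (\<lambda>_. 1) < top"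
proof -
  have "wnorm (W L) (\<lambda>_. 1) = (\<Sum>m. \<Sum>n\<le>m. ennreal (1 / fact n) * ennreal (real (n + (m - n) choose n) * L ^ (m - n)))"
    unfolding wnorm_def W_def using assms by (intro suminf_cong) (simp add: ennreal_mult[symmetric] mult_ac)
  also have "\<dots> = (\<Sum>n. \<Sum>j. ennreal (1 / fact n) * ennreal (real (n + j choose n) * L ^ j))"
    by (rule suminf_ennreal_triangle)
  also have "\<dots> = (\<Sum>n. ennreal ((1 / (1 - L)) * ((1 / (1 - L)) ^ n / fact n)))"
    unfolding ennreal_suminf_cmult suminf_negative_binomial[OF assms]
    using assms by (intro suminf_cong) (simp add: ennreal_mult[symmetric])
  also have "\<dots> < top"
  proof -
    have "summable (\<lambda>n. (1 / (1 - L)) * ((1 / (1 - L)) ^ n / fact n))"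
      using summable_exp[of "1 / (1 - L)"] by (intro summable_mult) (simp add: divide_inverse mult.commute)
    then have "(\<Sum>n. ennreal ((1 / (1 - L)) * ((1 / (1 - L)) ^ n / fact n))) \<noteq> top"
      using assms by (intro ennreal_suminf_neq_top) auto
    then show ?thesis by (simp add: top.not_eq_extremum)
  qed
  finally show ?thesis .
qed

text \<open>Finiteness is the point: \<open>enn2real\<close> would send an infinite norm to
  0.\<close>

lemma alpha0_eq:
  assumes "0 \<le> L" "L < 1"
  shows "ennreal (alpha0 L) = norm_W L jalpha"
proof -
  have "pd k l (\<lambda>x v. alpha v) x v = fact k * fact l * cf (jalpha x v) k l" for k l x v
    using pd_smooth_jet[OF smooth_jet_jalpha, where k = k and l = l] by (simp add: cf_jalpha_0)
  then have eq: "norm_H L (\<lambda>x v. alpha v) = norm_W L jalpha"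
    by (rule norm_H_jet) (rule assms)
  have "norm_W L jalpha \<le> wnorm (W L) (\<lambda>m. 2 * 1)"
    by (intro wnorm_mono) (auto simp: am_jalpha)
  also have "\<dots> = 2 * wnorm (W L) (\<lambda>_. 1)" by (rule wnorm_cmult)
  also have "\<dots> < top"
    using wnorm_W_const_finite[OF assms] by (simp add: ennreal_mult_less_top)
  finally show ?thesis
    unfolding alpha0_def eq by (simp add: ennreal_enn2real_if)
qed

section \<open>The analytic nonlinearity\<close>

text \<open>Follows from \<open>W_ge_inverse_fact\<close>; the radius may be 0. Norm convergence
  thereby gives uniform convergence of each coefficient.\<close>

lemma abs_cf_le_wnorm:
  assumes "0 \<le> L"
  shows "ennreal \<bar>cf (A x v) k l\<bar> \<le> ennreal (fact (k + l)) * norm_W L A"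
proof -
  let ?m = "k + l"
  have "ennreal \<bar>cf (A x v) k l\<bar> \<le> am A ?m"
    by (rule order_trans[OF le_amp amp_le_am])
  also have "\<dots> = ennreal (fact ?m * (1 / fact ?m)) * am A ?m"
    by simp
  also have "\<dots> \<le> ennreal (fact ?m * W L ?m) * am A ?m"
    using W_ge_inverse_fact[OF assms, of ?m] by (intro mult_right_mono ennreal_leI mult_left_mono) auto
  also have "\<dots> = ennreal (fact ?m) * (ennreal (W L ?m) * am A ?m)"
    using assms by (simp add: ennreal_mult W_nonneg mult.assoc)
  also have "\<dots> \<le> ennreal (fact ?m) * norm_W L A"
    by (intro mult_left_mono le_wnorm) simp
  finally show ?thesis .
qed

lemma abs_cf_le_real:
  assumes "0 \<le> L" "norm_W L A \<le> ennreal B" "0 \<le> B"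
  shows "\<bar>cf (A x v) k l\<bar> \<le> fact (k + l) * B"
proof -
  have "ennreal \<bar>cf (A x v) k l\<bar> \<le> ennreal (fact (k + l)) * ennreal B"
    using assms(2) by (intro order_trans[OF abs_cf_le_wnorm[OF assms(1)]] mult_left_mono) auto
  then show ?thesis using assms(3) by (simp add: ennreal_mult[symmetric])
qed

lemma am_const: "am (\<lambda>x v. fps_const (fps_const c)) m = (if m = 0 then ennreal \<bar>c\<bar> else 0)"
proof -
  have "amp (\<lambda>x v. fps_const (fps_const c)) k l = (if k = 0 \<and> l = 0 then ennreal \<bar>c\<bar> else 0)" for k l
    unfolding amp_def by (cases "k = 0 \<and> l = 0") (auto simp: case_prod_beta')
  then have "am (\<lambda>x v. fps_const (fps_const c)) m = (\<Sum>k\<le>m. if k = 0 \<and> m - k = 0 then ennreal \<bar>c\<bar> else 0)"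
    unfolding am_def by simp
  also have "\<dots> = (if m = 0 then ennreal \<bar>c\<bar> else 0)"
    by (cases m) auto
  finally show ?thesis .
qed

lemma wnorm_W_one: "norm_W L (\<lambda>x v. 1) = 1"
proof -
  have "am (\<lambda>x v. 1 :: real fps fps) m = (if m = 0 then 1 else 0)" for m
    using am_const[of 1 m] by simp
  then have "norm_W L (\<lambda>x v. 1) = (\<Sum>m. ennreal (W L m) * (if m = 0 then 1 else 0))"
    by (simp add: wnorm_def)
  also have "\<dots> = (\<Sum>m\<in>{0}. ennreal (W L m) * (if m = 0 then 1 else 0))"
    by (rule suminf_finite) auto
  finally show ?thesis by simp
qed

section \<open>Powers of a jet and their differences\<close>

context
  fixes L :: real and A :: "real \<Rightarrow> real \<Rightarrow> real fps fps" and m :: ennreal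
  assumes L: "0 \<le> L" and A: "norm_W L A \<le> m"
begin

lemma wnorm_W_power: "norm_W L (\<lambda>x v. A x v ^ n) \<le> m ^ n"
proof (induction n)
  case (Suc n)
  have "norm_W L (\<lambda>x v. A x v ^ Suc n) \<le> norm_W L A * norm_W L (\<lambda>x v. A x v ^ n)"
    unfolding power_Suc by (rule wnorm_W_mult[OF L])
  also have "\<dots> \<le> m * m ^ n"
    using A Suc by (intro mult_mono) auto
  finally show ?case by simp
qed (simp add: wnorm_W_one)

lemma wnorm_W_power_Suc: "norm_W L (\<lambda>x v. A x v ^ Suc n) \<le> m ^ n * norm_W L A"
proof -
  have "norm_W L (\<lambda>x v. A x v ^ Suc n) \<le> norm_W L A * norm_W L (\<lambda>x v. A x v ^ n)"
    unfolding power_Suc by (rule wnorm_W_mult[OF L])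
  also have "\<dots> \<le> norm_W L A * m ^ n"
    by (intro mult_left_mono wnorm_W_power) auto
  finally show ?thesis by (simp add: mult.commute)
qed

lemma wnorm_W'_power_Suc:
  "seminorm_W L (\<lambda>x v. A x v ^ Suc n) \<le> of_nat (Suc n) * m ^ n * seminorm_W L A"
proof (induction n)
  case (Suc n)
  have "seminorm_W L (\<lambda>x v. A x v ^ Suc (Suc n))
      \<le> seminorm_W L A * norm_W L (\<lambda>x v. A x v ^ Suc n) + norm_W L A * seminorm_W L (\<lambda>x v. A x v ^ Suc n)"
    unfolding power_Suc[of _ "Suc n"] by (rule wnorm_W'_mult[OF L])
  also have "\<dots> \<le> seminorm_W L A * m ^ Suc n + m * (of_nat (Suc n) * m ^ n * seminorm_W L A)"
    using A by (intro add_mono mult_mono Suc wnorm_W_power) auto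
  finally show ?case by (simp add: algebra_simps)
qed simp

end

context
  fixes L :: real and A B :: "real \<Rightarrow> real \<Rightarrow> real fps fps" and m Q :: ennreal
  assumes L: "0 \<le> L" and A: "norm_W L A \<le> m" and B: "norm_W L B \<le> m"
begin

text \<open>The telescoping that drives both inductions: one factor \<open>A\<close> is peeled off
  on the left, so the remaining power of \<open>B\<close> stays on the right.\<close>

lemma power_diff_Suc_eq:
  "(\<lambda>x v. A x v ^ Suc (Suc n) - B x v ^ Suc (Suc n))
    = (\<lambda>x v. A x v * (A x v ^ Suc n - B x v ^ Suc n) + (A x v - B x v) * B x v ^ Suc n)"
  by (simp add: algebra_simps)

lemma wnorm_W_power_diff:
  "norm_W L (\<lambda>x v. A x v ^ Suc n - B x v ^ Suc n)
    \<le> of_nat (Suc n) * m ^ n * norm_W L (\<lambda>x v. A x v - B x v)"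
proof (induction n)
  case (Suc n)
  let ?N = "\<lambda>A. norm_W L A" and ?D = "\<lambda>x v. A x v - B x v"
  have "?N (\<lambda>x v. A x v ^ Suc (Suc n) - B x v ^ Suc (Suc n))
      \<le> ?N (\<lambda>x v. A x v * (A x v ^ Suc n - B x v ^ Suc n)) + ?N (\<lambda>x v. ?D x v * B x v ^ Suc n)"
    unfolding power_diff_Suc_eq by (rule wnorm_am_add)
  also have "\<dots> \<le> ?N A * ?N (\<lambda>x v. A x v ^ Suc n - B x v ^ Suc n) + ?N ?D * ?N (\<lambda>x v. B x v ^ Suc n)"
    by (intro add_mono wnorm_W_mult[OF L])
  also have "\<dots> \<le> m * (of_nat (Suc n) * m ^ n * ?N ?D) + ?N ?D * m ^ Suc n"
    using A by (intro add_mono mult_mono Suc wnorm_W_power[OF L B]) auto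
  finally show ?case by (simp add: algebra_simps)
qed simp

text \<open>The extra derivative falls either on the difference or on one of the \<open>n\<close>
  remaining factors in each of the \<open>n + 1\<close> telescoped products. The resulting
  coefficients are those of the first and second majorants.\<close>

lemma wnorm_W'_power_diff:
  assumes A': "seminorm_W L A \<le> Q" and B': "seminorm_W L B \<le> Q"
  shows "seminorm_W L (\<lambda>x v. A x v ^ Suc n - B x v ^ Suc n)
    \<le> of_nat (Suc n) * m ^ n * seminorm_W L (\<lambda>x v. A x v - B x v)
      + of_nat (n * Suc n) * m ^ (n - 1) * Q * norm_W L (\<lambda>x v. A x v - B x v)"
proof (induction n)
  case (Suc n)
  let ?N = "\<lambda>A. norm_W L A" and ?N' = "\<lambda>A. seminorm_W L A" and ?D = "\<lambda>x v. A x v - B x v"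
  let ?d = "\<lambda>x v. A x v ^ Suc n - B x v ^ Suc n"
  have "?N' (\<lambda>x v. A x v ^ Suc (Suc n) - B x v ^ Suc (Suc n))
      \<le> ?N' (\<lambda>x v. A x v * ?d x v) + ?N' (\<lambda>x v. ?D x v * B x v ^ Suc n)"
    unfolding power_diff_Suc_eq by (rule wnorm_am_add)
  also have "\<dots> \<le> (?N' A * ?N ?d + ?N A * ?N' ?d) + (?N' ?D * ?N (\<lambda>x v. B x v ^ Suc n) + ?N ?D * ?N' (\<lambda>x v. B x v ^ Suc n))"
    by (intro add_mono wnorm_W'_mult[OF L])
  also have "\<dots> \<le> (Q * (of_nat (Suc n) * m ^ n * ?N ?D) + m * (of_nat (Suc n) * m ^ n * ?N' ?D + of_nat (n * Suc n) * m ^ (n - 1) * Q * ?N ?D))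
      + (?N' ?D * m ^ Suc n + ?N ?D * (of_nat (Suc n) * m ^ n * Q))"
    using A A' order_trans[OF wnorm_W'_power_Suc[OF L B] mult_left_mono[OF B']]
    by (intro add_mono mult_mono Suc wnorm_W_power[OF L B] wnorm_W_power_diff) auto
  also have "\<dots> = of_nat (Suc (Suc n)) * m ^ Suc n * ?N' ?D + of_nat (Suc n * Suc (Suc n)) * m ^ n * Q * ?N ?D"
  proof -
    have "m * (of_nat (n * Suc n) * m ^ (n - 1) * Q * ?N ?D) = of_nat (n * Suc n) * m ^ n * Q * ?N ?D"
      by (cases n) (simp_all add: mult_ac)
    then show ?thesis by (simp add: algebra_simps)
  qed
  finally show ?case by simp
qed simp

end

text \<open>\<open>jpsi\<close> is the jet of \<open>\<Phi> \<circ> A - \<Phi> 0\<close>.\<close>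

definition jpsi :: "(nat \<Rightarrow> real) \<Rightarrow> (real \<Rightarrow> real \<Rightarrow> real fps fps) \<Rightarrow> real \<Rightarrow> real \<Rightarrow> real fps fps" where
  "jpsi c A x v = Abs_fps (\<lambda>k. Abs_fps (\<lambda>l. \<Sum>n. c (Suc n) * cf (A x v ^ Suc n) k l))"

lemma cf_jpsi: "cf (jpsi c A x v) k l = (\<Sum>n. c (Suc n) * cf (A x v ^ Suc n) k l)"
  by (simp add: jpsi_def)

text \<open>Countable triangle inequality. Absolute summability is what lets the real series be
  compared with the extended one.\<close>

lemma wnorm_suminf_le:
  assumes S: "\<And>x v k l. cf (S x v) k l = (\<Sum>n. d n * cf (B n x v) k l)"
    and sm: "\<And>x v k l. summable (\<lambda>n. \<bar>d n * cf (B n x v) k l\<bar>)"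
  shows "wnorm w (am S) \<le> (\<Sum>n. ennreal \<bar>d n\<bar> * wnorm w (am (B n)))"
proof -
  have amp: "amp S k l \<le> (\<Sum>n. ennreal \<bar>d n\<bar> * amp (B n) k l)" for k l
  proof (rule amp_leI)
    fix x v
    have "ennreal \<bar>cf (S x v) k l\<bar> \<le> ennreal (\<Sum>n. \<bar>d n * cf (B n x v) k l\<bar>)"
      unfolding S by (intro ennreal_leI summable_rabs sm)
    also have "\<dots> = (\<Sum>n. ennreal \<bar>d n * cf (B n x v) k l\<bar>)"
      by (rule suminf_ennreal2[symmetric]) (auto intro: sm)
    also have "\<dots> \<le> (\<Sum>n. ennreal \<bar>d n\<bar> * amp (B n) k l)"
      by (intro suminf_le summableI) (simp add: abs_mult ennreal_mult mult_left_mono le_amp)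
    finally show "ennreal \<bar>cf (S x v) k l\<bar> \<le> \<dots>" .
  qed
  have am: "am S m \<le> (\<Sum>n. ennreal \<bar>d n\<bar> * am (B n) m)" for m
  proof -
    have "am S m \<le> (\<Sum>k\<le>m. \<Sum>n. ennreal \<bar>d n\<bar> * amp (B n) k (m - k))"
      unfolding am_def by (intro sum_mono amp)
    also have "\<dots> = (\<Sum>n. \<Sum>k\<le>m. ennreal \<bar>d n\<bar> * amp (B n) k (m - k))"
      by (rule suminf_sum[symmetric]) simp
    finally show ?thesis by (simp add: am_def sum_distrib_left)
  qed
  have "wnorm w (am S) \<le> (\<Sum>m. \<Sum>n. ennreal (w m) * (ennreal \<bar>d n\<bar> * am (B n) m))"
    unfolding wnorm_def ennreal_suminf_cmult by (intro suminf_le mult_left_mono am summableI) auto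
  also have "\<dots> = (\<Sum>n. \<Sum>m. ennreal (w m) * (ennreal \<bar>d n\<bar> * am (B n) m))"
    by (rule suminf_ennreal_swap)
  also have "\<dots> = (\<Sum>n. ennreal \<bar>d n\<bar> * wnorm w (am (B n)))"
    unfolding wnorm_def ennreal_suminf_cmult[symmetric] by (simp add: mult.left_commute)
  finally show ?thesis .
qed

text \<open>Weierstrass M-test for each coefficient; the rate of convergence is the tail of the
  majorant.\<close>

lemma smooth_jet_suminf:
  assumes J: "\<And>n. smooth_jet (J n)"
    and b: "\<And>n p x v k l. \<bar>cf (J n p x v) k l\<bar> \<le> b k l n" "\<And>k l. summable (b k l)"
  shows "smooth_jet (\<lambda>p x v. Abs_fps (\<lambda>k. Abs_fps (\<lambda>l. \<Sum>n. cf (J n p x v) k l)))"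
proof (rule smooth_jet_limit)
  show "smooth_jet (\<lambda>p x v. \<Sum>i<n. J i p x v)" for n
  proof (induction n)
    case 0
    show ?case using smooth_jet_const[of 0] by simp
  next
    case (Suc n)
    then show ?case using smooth_jet_add[OF Suc J[of n]] by simp
  qed
  fix k l
  let ?r = "\<lambda>n. (\<Sum>i. b k l (i + n))"
  have "?r \<longlonglongrightarrow> 0"
    using suminf_exist_split2[OF b(2)] by simp
  moreover have "\<bar>cf (\<Sum>i<n. J i p x v) k l - cf (Abs_fps (\<lambda>k. Abs_fps (\<lambda>l. \<Sum>n. cf (J n p x v) k l))) k l\<bar> \<le> ?r n" for n p x v
  proof -
    have sb: "summable (\<lambda>i. b k l (i + n))"
      using b(2) by (rule summable_ignore_initial_segment)
    have sJ: "summable (\<lambda>i. cf (J i p x v) k l)"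
      by (rule summable_comparison_test'[OF b(2)[of k l], of 0]) (use b(1) in simp)
    have "cf (Abs_fps (\<lambda>k. Abs_fps (\<lambda>l. \<Sum>n. cf (J n p x v) k l))) k l = (\<Sum>i. cf (J (i + n) p x v) k l) + (\<Sum>i<n. cf (J i p x v) k l)"
      using suminf_split_initial_segment[OF sJ, of n] by simp
    then have "\<bar>cf (\<Sum>i<n. J i p x v) k l - cf (Abs_fps (\<lambda>k. Abs_fps (\<lambda>l. \<Sum>n. cf (J n p x v) k l))) k l\<bar>
        = norm (\<Sum>i. cf (J (i + n) p x v) k l)"
      by (simp add: fps_sum_nth)
    also have "\<dots> \<le> ?r n"
      by (rule norm_suminf_le[OF _ sb]) (use b(1) in simp)
    finally show ?thesis .
  qed
  ultimately show "\<exists>e. e \<longlonglongrightarrow> 0 \<and> (\<forall>n p x v. \<bar>cf (\<Sum>i<n. J i p x v) k l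
      - cf (Abs_fps (\<lambda>k. Abs_fps (\<lambda>l. \<Sum>n. cf (J n p x v) k l))) k l\<bar> \<le> e n)"
    by blast
qed

section \<open>Composition with the analytic function\<close>

locale analytic_nonlinearity =
  fixes R :: real and \<Phi> :: "real \<Rightarrow> real" and c :: "nat \<Rightarrow> real" and M :: real
  assumes M0: "0 < M" and MR: "M < R" and power_series: "has_power_series \<Phi> c R"
begin

abbreviation P1 :: real where "P1 \<equiv> majorant_d1 c M"
abbreviation P2 :: real where "P2 \<equiv> majorant_d2 c M"

lemma summable_c: "\<bar>z\<bar> < R \<Longrightarrow> summable (\<lambda>n. c n * z ^ n)"
  using power_series unfolding has_power_series_def sums_iff by blast

text \<open>An intermediate radius between \<open>M\<close> and \<open>R\<close> gives absolute
  convergence in a disc containing \<open>M\<close> in its interior, where the series can be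
  differentiated termwise twice.\<close>

lemma summable_majorants:
  shows summable_d1: "summable (\<lambda>n. real (Suc n) * \<bar>c (Suc n)\<bar> * M ^ n)"
    and summable_d2: "summable (\<lambda>n. real (n * Suc n) * \<bar>c (Suc n)\<bar> * M ^ (n - 1))"
proof -
  define r where "r = (M + R) / 2"
  have r: "M < r" "r < R" using MR by (auto simp: r_def)
  have s: "summable (\<lambda>n. \<bar>c n\<bar> * z ^ n)" if "norm z < r" for z
    using powser_insidea[OF summable_c[of r], of z] that r M0
    by (intro summable_rabs_cancel[of "\<lambda>n. \<bar>c n\<bar> * z ^ n"]) (simp add: abs_mult power_abs)
  have s1: "summable (\<lambda>n. diffs (\<lambda>n. \<bar>c n\<bar>) n * z ^ n)" if "norm z < r" for z
    using termdiff_converges[OF that s] .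
  have s2: "summable (\<lambda>n. diffs (diffs (\<lambda>n. \<bar>c n\<bar>)) n * z ^ n)" if "norm z < r" for z
    using termdiff_converges[OF that s1] .
  show "summable (\<lambda>n. real (Suc n) * \<bar>c (Suc n)\<bar> * M ^ n)"
    using s1[of M] r M0 by (simp add: diffs_def del: of_nat_Suc)
  have "summable (\<lambda>n. real (Suc n * Suc (Suc n)) * \<bar>c (Suc (Suc n))\<bar> * M ^ n)"
    using s2[of M] r M0 unfolding of_nat_mult by (simp add: diffs_def mult.assoc del: of_nat_Suc)
  then show "summable (\<lambda>n. real (n * Suc n) * \<bar>c (Suc n)\<bar> * M ^ (n - 1))"
    by (subst summable_Suc_iff[symmetric]) (simp del: of_nat_Suc mult_Suc mult_Suc_right)
qed

lemma P1_eq: "P1 = (\<Sum>n. real (Suc n) * \<bar>c (Suc n)\<bar> * M ^ n)"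
proof -
  have "summable (\<lambda>n. real n * \<bar>c n\<bar> * M ^ (n - 1))"
    by (subst summable_Suc_iff[symmetric]) (use summable_d1 in simp)
  from suminf_split_head[OF this] show ?thesis by (simp add: majorant_d1_def)
qed

lemma P2_eq: "P2 = (\<Sum>n. real (n * Suc n) * \<bar>c (Suc n)\<bar> * M ^ (n - 1))"
proof -
  \<comment> \<open>At \<open>n = 0\<close> both exponents are truncated, but the factors in front
    are zero.\<close>
  have eq: "real (Suc n) * (real (Suc n) - 1) * \<bar>c (Suc n)\<bar> * M ^ (Suc n - 2) = real (n * Suc n) * \<bar>c (Suc n)\<bar> * M ^ (n - 1)" for n
    by (cases n) (auto simp: numeral_2_eq_2 algebra_simps)
  have "summable (\<lambda>n. real n * (real n - 1) * \<bar>c n\<bar> * M ^ (n - 2))"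
    by (subst summable_Suc_iff[symmetric]) (use summable_d2 in \<open>simp only: eq\<close>)
  from suminf_split_head[OF this] show ?thesis
    unfolding majorant_d2_def eq by simp
qed

lemma P1_nonneg: "0 \<le> P1" and P2_nonneg: "0 \<le> P2"
  unfolding P1_eq P2_eq using M0 by (intro suminf_nonneg summable_d1 summable_d2; simp)+

lemma ennreal_P1: "(\<Sum>n. ennreal \<bar>c (Suc n)\<bar> * (of_nat (Suc n) * ennreal M ^ n)) = ennreal P1"
proof -
  have "(\<Sum>n. ennreal \<bar>c (Suc n)\<bar> * (of_nat (Suc n) * ennreal M ^ n)) = (\<Sum>n. ennreal (real (Suc n) * \<bar>c (Suc n)\<bar> * M ^ n))"
    using M0 by (intro suminf_cong)
      (simp add: ennreal_of_nat_eq_real_of_nat ennreal_power ennreal_mult[symmetric] mult_ac del: of_nat_Suc)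
  also have "\<dots> = ennreal P1"
    unfolding P1_eq using M0 by (intro suminf_ennreal2 summable_d1) simp
  finally show ?thesis .
qed

lemma ennreal_P2: "(\<Sum>n. ennreal \<bar>c (Suc n)\<bar> * (of_nat (n * Suc n) * ennreal M ^ (n - 1))) = ennreal P2"
proof -
  have "(\<Sum>n. ennreal \<bar>c (Suc n)\<bar> * (of_nat (n * Suc n) * ennreal M ^ (n - 1))) = (\<Sum>n. ennreal (real (n * Suc n) * \<bar>c (Suc n)\<bar> * M ^ (n - 1)))"
    using M0 by (intro suminf_cong)
      (simp add: ennreal_of_nat_eq_real_of_nat ennreal_power ennreal_mult[symmetric] mult_ac del: of_nat_Suc of_nat_mult mult_Suc mult_Suc_right)
  also have "\<dots> = ennreal P2"
    unfolding P2_eq using M0 by (intro suminf_ennreal2 summable_d2) simp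
  finally show ?thesis .
qed

lemma abs_cf_power_le:
  assumes "0 \<le> L" "norm_W L A \<le> ennreal M"
  shows "\<bar>c (Suc n) * cf (A x v ^ Suc n) k l\<bar> \<le> fact (k + l) * (M * (real (Suc n) * \<bar>c (Suc n)\<bar> * M ^ n))"
proof -
  have "norm_W L (\<lambda>x v. A x v ^ Suc n) \<le> ennreal (M ^ Suc n)"
    using wnorm_W_power[OF assms(1,2), where n = "Suc n"] M0 by (simp add: ennreal_power[symmetric] del: power_Suc)
  then have "\<bar>cf (A x v ^ Suc n) k l\<bar> \<le> fact (k + l) * M ^ Suc n"
    using abs_cf_le_real[OF assms(1), of "\<lambda>x v. A x v ^ Suc n"] M0 by (simp del: power_Suc)
  then have "\<bar>c (Suc n)\<bar> * \<bar>cf (A x v ^ Suc n) k l\<bar> \<le> \<bar>c (Suc n)\<bar> * (fact (k + l) * M ^ Suc n)"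
    by (rule mult_left_mono) simp
  \<comment> \<open>The factor \<open>n + 1\<close> is inserted so that the summability behind
    \<open>P1\<close> can be reused.\<close>
  also have "\<dots> \<le> real (Suc n) * (\<bar>c (Suc n)\<bar> * (fact (k + l) * M ^ Suc n))"
    using M0 mult_right_mono[of 1 "real (Suc n)" "\<bar>c (Suc n)\<bar> * (fact (k + l) * M ^ Suc n)"] by simp
  finally show ?thesis by (simp add: abs_mult mult_ac)
qed

lemma summable_bound: "summable (\<lambda>n. fact (k + l) * (M * (real (Suc n) * \<bar>c (Suc n)\<bar> * M ^ n)))"
  by (intro summable_mult summable_d1)

lemma summable_jpsi:
  assumes "0 \<le> L" "norm_W L A \<le> ennreal M"
  shows "summable (\<lambda>n. \<bar>c (Suc n) * cf (A x v ^ Suc n) k l\<bar>)"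
  by (rule summable_comparison_test'[OF summable_bound[of k l], of 0]) (use abs_cf_power_le[OF assms] in simp)

lemma smooth_jet_jpsi:
  assumes A: "smooth_jet A" and L: "\<And>p. 0 \<le> L p" "\<And>p. norm_W (L p) (A p) \<le> ennreal M"
  shows "smooth_jet (\<lambda>p. jpsi c (A p))"
proof -
  have "smooth_jet (\<lambda>p x v. Abs_fps (\<lambda>k. Abs_fps (\<lambda>l. \<Sum>n. cf (fps_const (fps_const (c (Suc n))) * A p x v ^ Suc n) k l)))"
  proof (rule smooth_jet_suminf)
    show "smooth_jet (\<lambda>p x v. fps_const (fps_const (c (Suc n))) * A p x v ^ Suc n)" for n
      by (intro smooth_jet_mult smooth_jet_const smooth_jet_power A)
    show "\<bar>cf (fps_const (fps_const (c (Suc n))) * A p x v ^ Suc n) k l\<bar>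
        \<le> fact (k + l) * (M * (real (Suc n) * \<bar>c (Suc n)\<bar> * M ^ n))" for n p x v k l
      unfolding cf_fps_const_mult by (rule abs_cf_power_le[OF L])
  qed (rule summable_bound)
  then show ?thesis
    unfolding jpsi_def[abs_def] cf_fps_const_mult .
qed

text \<open>The bounds are proportional to the size of \<open>A\<close> because the constant term of
  the series is left out. For the norm the factor \<open>n + 1\<close> is inserted, so that one
  constant \<open>P1\<close> serves both estimates.\<close>

lemma wnorm_jpsi:
  assumes L: "0 \<le> L" "norm_W L A \<le> ennreal M"
  shows wnorm_W_jpsi: "norm_W L (jpsi c A) \<le> ennreal P1 * norm_W L A"
    and wnorm_W'_jpsi: "seminorm_W L (jpsi c A) \<le> ennreal P1 * seminorm_W L A"
proof -
  have le: "wnorm w (am (jpsi c A)) \<le> (\<Sum>n. ennreal \<bar>c (Suc n)\<bar> * wnorm w (am (\<lambda>x v. A x v ^ Suc n)))" for w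
    by (rule wnorm_suminf_le[OF cf_jpsi summable_jpsi[OF L]])
  have "norm_W L (\<lambda>x v. A x v ^ Suc n) \<le> of_nat (Suc n) * ennreal M ^ n * norm_W L A" for n
  proof -
    have "norm_W L (\<lambda>x v. A x v ^ Suc n) \<le> 1 * (ennreal M ^ n * norm_W L A)"
      using wnorm_W_power_Suc[OF L] by simp
    also have "\<dots> \<le> of_nat (Suc n) * (ennreal M ^ n * norm_W L A)"
      by (intro mult_right_mono) auto
    finally show ?thesis by (simp add: mult.assoc)
  qed
  then have "(\<Sum>n. ennreal \<bar>c (Suc n)\<bar> * norm_W L (\<lambda>x v. A x v ^ Suc n))
      \<le> (\<Sum>n. ennreal \<bar>c (Suc n)\<bar> * (of_nat (Suc n) * ennreal M ^ n) * norm_W L A)"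
    by (intro suminf_le summableI) (auto simp: mult.assoc intro!: mult_left_mono)
  also have "\<dots> = ennreal P1 * norm_W L A"
    by (simp only: ennreal_suminf_multc ennreal_P1)
  finally show "norm_W L (jpsi c A) \<le> ennreal P1 * norm_W L A"
    using le by (rule order_trans[rotated])
  have "(\<Sum>n. ennreal \<bar>c (Suc n)\<bar> * seminorm_W L (\<lambda>x v. A x v ^ Suc n))
      \<le> (\<Sum>n. ennreal \<bar>c (Suc n)\<bar> * (of_nat (Suc n) * ennreal M ^ n) * seminorm_W L A)"
    using wnorm_W'_power_Suc[OF L] by (intro suminf_le summableI) (simp only: mult.assoc, intro mult_left_mono, auto simp: mult.assoc)
  also have "\<dots> = ennreal P1 * seminorm_W L A"
    by (simp only: ennreal_suminf_multc ennreal_P1)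
  finally show "seminorm_W L (jpsi c A) \<le> ennreal P1 * seminorm_W L A"
    using le by (rule order_trans[rotated])
qed

lemma wnorm_jpsi_diff:
  assumes L: "0 \<le> L" and A: "norm_W L A \<le> ennreal M" and B: "norm_W L B \<le> ennreal M"
  shows wnorm_W_jpsi_diff: "norm_W L (\<lambda>x v. jpsi c A x v - jpsi c B x v)
      \<le> ennreal P1 * norm_W L (\<lambda>x v. A x v - B x v)"
    and wnorm_W'_jpsi_diff: "seminorm_W L A \<le> Q \<Longrightarrow> seminorm_W L B \<le> Q \<Longrightarrow>
      seminorm_W L (\<lambda>x v. jpsi c A x v - jpsi c B x v)
      \<le> ennreal P1 * seminorm_W L (\<lambda>x v. A x v - B x v) + ennreal P2 * Q * norm_W L (\<lambda>x v. A x v - B x v)"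
proof -
  let ?D = "\<lambda>x v. A x v - B x v"
  have s: "summable (\<lambda>n. c (Suc n) * cf (A x v ^ Suc n) k l)" "summable (\<lambda>n. c (Suc n) * cf (B x v ^ Suc n) k l)" for x v k l
    using summable_jpsi[OF L A] summable_jpsi[OF L B] by (auto intro: summable_rabs_cancel)
  have "wnorm w (am (\<lambda>x v. jpsi c A x v - jpsi c B x v)) \<le> (\<Sum>n. ennreal \<bar>c (Suc n)\<bar> * wnorm w (am (\<lambda>x v. A x v ^ Suc n - B x v ^ Suc n)))" for w
  proof (rule wnorm_suminf_le)
    fix x v k l
    show "cf (jpsi c A x v - jpsi c B x v) k l = (\<Sum>n. c (Suc n) * cf (A x v ^ Suc n - B x v ^ Suc n) k l)"
      using suminf_diff[OF s] by (simp add: cf_jpsi right_diff_distrib del: power_Suc)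
    show "summable (\<lambda>n. \<bar>c (Suc n) * cf (A x v ^ Suc n - B x v ^ Suc n) k l\<bar>)"
    proof (rule summable_comparison_test'[OF summable_add[OF summable_jpsi[OF L A] summable_jpsi[OF L B]], of 0])
      show "norm \<bar>c (Suc n) * cf (A x v ^ Suc n - B x v ^ Suc n) k l\<bar>
        \<le> \<bar>c (Suc n) * cf (A x v ^ Suc n) k l\<bar> + \<bar>c (Suc n) * cf (B x v ^ Suc n) k l\<bar>" for n
        by (simp add: right_diff_distrib abs_triangle_ineq4 del: power_Suc)
    qed
  qed
  note le = this
  have "(\<Sum>n. ennreal \<bar>c (Suc n)\<bar> * norm_W L (\<lambda>x v. A x v ^ Suc n - B x v ^ Suc n))
      \<le> (\<Sum>n. ennreal \<bar>c (Suc n)\<bar> * (of_nat (Suc n) * ennreal M ^ n) * norm_W L ?D)"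
    using wnorm_W_power_diff[OF L A B] by (intro suminf_le summableI) (simp only: mult.assoc, intro mult_left_mono, auto simp: mult.assoc)
  also have "\<dots> = ennreal P1 * norm_W L ?D"
    by (simp only: ennreal_suminf_multc ennreal_P1)
  finally show "norm_W L (\<lambda>x v. jpsi c A x v - jpsi c B x v) \<le> ennreal P1 * norm_W L ?D"
    using le by (rule order_trans[rotated])
  assume Q: "seminorm_W L A \<le> Q" "seminorm_W L B \<le> Q"
  have "(\<Sum>n. ennreal \<bar>c (Suc n)\<bar> * seminorm_W L (\<lambda>x v. A x v ^ Suc n - B x v ^ Suc n))
      \<le> (\<Sum>n. ennreal \<bar>c (Suc n)\<bar> * (of_nat (Suc n) * ennreal M ^ n) * seminorm_W L ?D
          + ennreal \<bar>c (Suc n)\<bar> * (of_nat (n * Suc n) * ennreal M ^ (n - 1)) * (Q * norm_W L ?D))"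
  proof (intro suminf_le summableI)
    fix n
    show "ennreal \<bar>c (Suc n)\<bar> * seminorm_W L (\<lambda>x v. A x v ^ Suc n - B x v ^ Suc n)
      \<le> ennreal \<bar>c (Suc n)\<bar> * (of_nat (Suc n) * ennreal M ^ n) * seminorm_W L ?D
          + ennreal \<bar>c (Suc n)\<bar> * (of_nat (n * Suc n) * ennreal M ^ (n - 1)) * (Q * norm_W L ?D)"
      using mult_left_mono[OF wnorm_W'_power_diff[OF L A B Q, of n], of "ennreal \<bar>c (Suc n)\<bar>"]
      by (simp only: distrib_left mult.assoc zero_le)
  qed
  also have "\<dots> = ennreal P1 * seminorm_W L ?D + ennreal P2 * (Q * norm_W L ?D)"
    by (subst suminf_add[symmetric]) (simp_all only: summableI ennreal_suminf_multc ennreal_P1 ennreal_P2)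
  finally show "seminorm_W L (\<lambda>x v. jpsi c A x v - jpsi c B x v)
      \<le> ennreal P1 * seminorm_W L ?D + ennreal P2 * Q * norm_W L ?D"
    using le by (simp add: mult.assoc) (rule order_trans)
qed

text \<open>The norm bound keeps the values of \<open>A\<close> within \<open>M\<close>, inside the
  disc of convergence. Comparing values suffices: derivatives of the composition are then read off
  from the smooth jet \<open>jpsi\<close>.\<close>

lemma cf_jpsi_0:
  assumes "0 \<le> L" "norm_W L A \<le> ennreal M"
  shows "\<Phi> (cf (A x v) 0 0) = \<Phi> 0 + cf (jpsi c A x v) 0 0"
proof -
  let ?z = "cf (A x v) 0 0"
  have "\<bar>?z\<bar> \<le> M" using abs_cf_le_real[OF assms, of x v 0 0] M0 by simp
  then have "\<bar>?z\<bar> < R" "\<bar>0 :: real\<bar> < R"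
    using MR M0 by auto
  then have "(\<lambda>n. c n * ?z ^ n) sums \<Phi> ?z" and 0: "(\<lambda>n. c n * 0 ^ n) sums \<Phi> 0"
    using power_series unfolding has_power_series_def by blast+
  then have "(\<Sum>n. c n * ?z ^ n) = \<Phi> ?z" "\<Phi> 0 = c 0" "summable (\<lambda>n. c n * ?z ^ n)"
    using 0[unfolded powser_sums_zero_iff] by (auto simp: sums_iff)
  with suminf_split_head[of "\<lambda>n. c n * ?z ^ n"] show ?thesis
    by (simp add: cf_jpsi fps_nth_power_0 del: power_Suc)
qed

section \<open>Estimates of the force term\<close>

definition force :: "(real \<Rightarrow> real \<Rightarrow> real fps fps) \<Rightarrow> real \<Rightarrow> real \<Rightarrow> real fps fps" where
  "force J x v = dX (jpsi c (jrho J) x v) * (dV (J x v) + jalpha x v * J x v)"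

text \<open>The potential \<open>P\<close> is independent of \<open>J\<close> here, so that both
  halves of a difference of forces are instances.\<close>

lemma wnorm_force_product:
  assumes L: "0 \<le> L"
  shows "norm_W L (\<lambda>x v. dX (P x v) * (dV (J x v) + jalpha x v * J x v))
    \<le> seminorm_W L P * norm_W L J + norm_W L P * seminorm_W L J
      + seminorm_W L P * (norm_W L jalpha * norm_W L J)"
proof -
  have "norm_W L (\<lambda>x v. dX (P x v) * (dV (J x v) + jalpha x v * J x v))
      \<le> norm_W L (\<lambda>x v. dX (P x v) * dV (J x v)) + norm_W L (\<lambda>x v. dX (P x v) * (jalpha x v * J x v))"
    unfolding distrib_left by (rule wnorm_am_add)
  also have "\<dots> \<le> (seminorm_W L P * norm_W L J + norm_W L P * seminorm_W L J)
      + seminorm_W L P * (norm_W L jalpha * norm_W L J)"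
    by (intro add_mono wnorm_W_dX_dV[OF L] order_trans[OF wnorm_W_mult[OF L]] mult_mono wnorm_W_dX[OF L] wnorm_W_mult[OF L]) auto
  finally show ?thesis .
qed

lemma wnorm_jrho:
  "smooth_jet J \<Longrightarrow> wnorm w (am (jrho (J p))) \<le> wnorm w (am (J p))"
  by (intro wnorm_mono am_jrho order_refl)

text \<open>In \<open>2 + alpha0 L\<close>, the 2 comes from the product of the two derivatives,
  where either factor may carry the seminorm, and \<open>alpha0 L\<close> from the multiplication by
  \<alpha>, which costs no derivative.\<close>

lemma wnorm_force:
  assumes L: "0 \<le> L" "L < 1" and J: "smooth_jet J" and N: "norm_W L (J p) \<le> ennreal M"
  shows "norm_W L (force (J p))
    \<le> ennreal ((2 + alpha0 L) * P1) * norm_W L (J p) * seminorm_W L (J p)"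
proof -
  let ?N = "\<lambda>J. norm_W L J" and ?N' = "\<lambda>J. seminorm_W L J"
  note \<rho> = wnorm_jrho[OF J]
  have M\<rho>: "?N (jrho (J p)) \<le> ennreal M" using \<rho> N by (rule order_trans)
  have 1: "?N (jpsi c (jrho (J p))) \<le> ennreal P1 * ?N (J p)"
    by (rule order_trans[OF wnorm_W_jpsi[OF L(1) M\<rho>]]) (intro mult_left_mono \<rho>, simp)
  have 2: "?N' (jpsi c (jrho (J p))) \<le> ennreal P1 * ?N' (J p)"
    by (rule order_trans[OF wnorm_W'_jpsi[OF L(1) M\<rho>]]) (intro mult_left_mono \<rho>, simp)
  have "?N (force (J p)) \<le> ?N' (jpsi c (jrho (J p))) * ?N (J p) + ?N (jpsi c (jrho (J p))) * ?N' (J p)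
      + ?N' (jpsi c (jrho (J p))) * (?N jalpha * ?N (J p))"
    unfolding force_def[abs_def] by (rule wnorm_force_product[OF L(1)])
  also have "\<dots> \<le> (ennreal P1 * ?N' (J p)) * ?N (J p) + (ennreal P1 * ?N (J p)) * ?N' (J p)
      + (ennreal P1 * ?N' (J p)) * (ennreal (alpha0 L) * ?N (J p))"
    by (intro add_mono mult_mono 1 2) (auto simp: alpha0_eq[OF L])
  also have "\<dots> = (2 + ennreal (alpha0 L)) * ennreal P1 * ?N (J p) * ?N' (J p)"
    by (simp add: algebra_simps mult_2)
  also have "2 + ennreal (alpha0 L) = ennreal (2 + alpha0 L)"
    by (simp add: ennreal_plus alpha0_def)
  finally show ?thesis
    using P1_nonneg by (simp add: ennreal_mult alpha0_def mult.assoc)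
qed

lemma jrho_diff:
  assumes A: "smooth_jet A" "\<And>x v k. \<bar>cf (A p x v) k 0\<bar> \<le> b k" and B: "smooth_jet B" "\<And>x v k. \<bar>cf (B p x v) k 0\<bar> \<le> b' k"
  shows "(\<lambda>x v. jrho (A p) x v - jrho (B p) x v) = jrho (\<lambda>x v. A p x v - B p x v)"
proof (intro ext fps_fps_eqI)
  fix x v k l
  have "integrable lborel (\<lambda>w. omega w * cf (A p x w) k 0)"
    by (rule integrable_omega_mult[OF smooth_jet_continuous_on[OF A(1)] A(2)]) (auto intro: continuous_intros)
  moreover have "integrable lborel (\<lambda>w. omega w * cf (B p x w) k 0)"
    by (rule integrable_omega_mult[OF smooth_jet_continuous_on[OF B(1)] B(2)]) (auto intro: continuous_intros)
  ultimately show "cf (jrho (A p) x v - jrho (B p) x v) k l = cf (jrho (\<lambda>x v. A p x v - B p x v) x v) k l"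
    by (simp add: jrho_def right_diff_distrib)
qed

text \<open>Bilinear splitting: the potential of \<open>G\<close> acts on the difference, and the
  difference of the potentials acts on \<open>H\<close>. The bound \<open>Q\<close> on the seminorms
  of \<open>G\<close> and \<open>H\<close> multiplies the norm of the difference, which forces these
  seminorms to be controlled at each time.\<close>

lemma wnorm_force_diff:
  assumes L: "0 \<le> L" "L < 1" and G: "smooth_jet G" "norm_W L (G p) \<le> ennreal M" "seminorm_W L (G p) \<le> ennreal Q"
    and H: "smooth_jet H" "norm_W L (H p) \<le> ennreal M" "seminorm_W L (H p) \<le> ennreal Q" and Q: "0 \<le> Q"
  shows "norm_W L (\<lambda>x v. force (G p) x v - force (H p) x v)
    \<le> ennreal (((2 + alpha0 L) * P1 + (1 + alpha0 L) * P2 * M) * Q) * norm_W L (\<lambda>x v. G p x v - H p x v)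
      + ennreal ((2 + alpha0 L) * P1 * M) * seminorm_W L (\<lambda>x v. G p x v - H p x v)"
proof -
  let ?N = "\<lambda>J. norm_W L J" and ?N' = "\<lambda>J. seminorm_W L J"
  let ?D = "\<lambda>x v. G p x v - H p x v"
  let ?a = "ennreal (alpha0 L)" and ?P = "\<lambda>J. jpsi c (jrho J)"
  let ?S = "\<lambda>x v. ?P (G p) x v - ?P (H p) x v"
  have SD: "smooth_jet (\<lambda>p x v. G p x v - H p x v)"
    by (rule smooth_jet_diff[OF G(1) H(1)])
  have \<rho>D: "(\<lambda>x v. jrho (G p) x v - jrho (H p) x v) = jrho ?D"
    using abs_cf_le_real[OF L(1) G(2)] abs_cf_le_real[OF L(1) H(2)] M0
    by (intro jrho_diff[OF G(1) _ H(1)]) (simp_all add: less_imp_le)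
  have \<rho>: "?N (jrho (G p)) \<le> ennreal M" "?N (jrho (H p)) \<le> ennreal M" "?N' (jrho (G p)) \<le> ennreal Q" "?N' (jrho (H p)) \<le> ennreal Q"
    by (rule order_trans[OF wnorm_jrho[OF G(1)] G(2)] order_trans[OF wnorm_jrho[OF G(1)] G(3)]
      order_trans[OF wnorm_jrho[OF H(1)] H(2)] order_trans[OF wnorm_jrho[OF H(1)] H(3)])+
  have NG: "?N (?P (G p)) \<le> ennreal P1 * ennreal M"
    by (rule order_trans[OF wnorm_W_jpsi[OF L(1) \<rho>(1)] mult_left_mono[OF \<rho>(1)]]) simp
  have N'G: "?N' (?P (G p)) \<le> ennreal P1 * ennreal Q"
    by (rule order_trans[OF wnorm_W'_jpsi[OF L(1) \<rho>(1)] mult_left_mono[OF \<rho>(3)]]) simp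
  have NS: "?N ?S \<le> ennreal P1 * ?N ?D"
    by (rule order_trans[OF wnorm_W_jpsi_diff[OF L(1) \<rho>(1,2)]]) (unfold \<rho>D, intro mult_left_mono wnorm_jrho[OF SD], simp)
  have N'S: "?N' ?S \<le> ennreal P1 * ?N' ?D + ennreal P2 * ennreal Q * ?N ?D"
    by (rule order_trans[OF wnorm_W'_jpsi_diff[OF L(1) \<rho>]])
      (unfold \<rho>D, intro add_mono mult_left_mono wnorm_jrho[OF SD], simp_all)
  have "(\<lambda>x v. force (G p) x v - force (H p) x v)
      = (\<lambda>x v. dX (?P (G p) x v) * (dV (?D x v) + jalpha x v * ?D x v) + dX (?S x v) * (dV (H p x v) + jalpha x v * H p x v))"
    by (simp add: force_def dX_diff dV_diff algebra_simps)
  then have "?N (\<lambda>x v. force (G p) x v - force (H p) x v)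
      \<le> ?N (\<lambda>x v. dX (?P (G p) x v) * (dV (?D x v) + jalpha x v * ?D x v)) + ?N (\<lambda>x v. dX (?S x v) * (dV (H p x v) + jalpha x v * H p x v))"
    by (simp only: wnorm_am_add)
  also have "\<dots> \<le> (?N' (?P (G p)) * ?N ?D + ?N (?P (G p)) * ?N' ?D + ?N' (?P (G p)) * (?N jalpha * ?N ?D))
      + (?N' ?S * ?N (H p) + ?N ?S * ?N' (H p) + ?N' ?S * (?N jalpha * ?N (H p)))"
    by (intro add_mono wnorm_force_product[OF L(1)])
  also have "\<dots> \<le> ((ennreal P1 * ennreal Q) * ?N ?D + (ennreal P1 * ennreal M) * ?N' ?D + (ennreal P1 * ennreal Q) * (?a * ?N ?D))
      + ((ennreal P1 * ?N' ?D + ennreal P2 * ennreal Q * ?N ?D) * ennreal M + (ennreal P1 * ?N ?D) * ennreal Q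
        + (ennreal P1 * ?N' ?D + ennreal P2 * ennreal Q * ?N ?D) * (?a * ennreal M))"
    by (intro add_mono mult_mono NG N'G NS N'S G H) (auto simp: alpha0_eq[OF L])
  also have "\<dots> = ((2 + ?a) * ennreal P1 + (1 + ?a) * ennreal P2 * ennreal M) * ennreal Q * ?N ?D
      + (2 + ?a) * ennreal P1 * ennreal M * ?N' ?D"
    by (simp add: algebra_simps mult_2)
  also have "\<dots> = ennreal (((2 + alpha0 L) * P1 + (1 + alpha0 L) * P2 * M) * Q) * ?N ?D + ennreal ((2 + alpha0 L) * P1 * M) * ?N' ?D"
  proof -
    have "2 + ?a = ennreal (2 + alpha0 L)" "1 + ?a = ennreal (1 + alpha0 L)"
      by (simp_all add: ennreal_plus alpha0_def)
    then show ?thesis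
      using P1_nonneg P2_nonneg M0 Q by (simp add: ennreal_mult ennreal_plus alpha0_def)
  qed
  finally show ?thesis .
qed

end

section \<open>Picard iteration\<close>

lemma am_diff: "am (\<lambda>x v. A x v - B x v) m \<le> am A m + am B m"
proof -
  have "am (\<lambda>x v. - B x v) m = am B m"
    by (simp add: am_def amp_def)
  then show ?thesis using am_add[of A "\<lambda>x v. - B x v" m] by simp
qed

lemma wnorm_am_diff: "wnorm w (am (\<lambda>x v. A x v - B x v)) \<le> wnorm w (am A) + wnorm w (am B)"
  unfolding wnorm_add[symmetric] by (intro wnorm_mono am_diff) auto

lemma wnorm_am_triangle:
  "wnorm w (am (\<lambda>x v. A x v - C x v)) \<le> wnorm w (am (\<lambda>x v. A x v - B x v)) + wnorm w (am (\<lambda>x v. B x v - C x v))"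
  using wnorm_am_add[of w "\<lambda>x v. A x v - B x v" "\<lambda>x v. B x v - C x v"] by simp

lemma ennreal_add_leD:
  fixes a b c :: ennreal
  assumes "a + b \<le> c"
  shows "a \<le> c" "b \<le> c"
  using assms by (meson add_increasing add_increasing2 order_refl order_trans zero_le)+

lemma ennreal_cmult_le_iff:
  assumes "0 < k" "0 \<le> a"
  shows "ennreal k * I \<le> ennreal a \<longleftrightarrow> I \<le> ennreal (a / k)"
proof
  have k: "ennreal (1 / k) * ennreal k = 1" "ennreal k * ennreal (a / k) = ennreal a" "ennreal (1 / k) * ennreal a = ennreal (a / k)"
    using assms by (simp_all add: ennreal_mult[symmetric])
  show "I \<le> ennreal (a / k)" if "ennreal k * I \<le> ennreal a"
    using mult_left_mono[OF that, of "ennreal (1 / k)"] k by (simp add: mult.assoc[symmetric])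
  show "ennreal k * I \<le> ennreal a" if "I \<le> ennreal (a / k)"
    using mult_left_mono[OF that, of "ennreal k"] k by simp
qed

lemma alpha0_nonneg: "0 \<le> alpha0 L"
  by (simp add: alpha0_def)

lemma alpha0_mono:
  assumes "0 \<le> L" "L \<le> L'" "L' < 1"
  shows "alpha0 L \<le> alpha0 L'"
proof -
  have "ennreal (alpha0 L) \<le> ennreal (alpha0 L')"
    using assms by (simp add: alpha0_eq wnorm_mono W_mono)
  then show ?thesis by (simp add: alpha0_nonneg)
qed

text \<open>Amplitudes are suprema, hence lower semicontinuous under pointwise limits; Fatou's lemma
  for counting measure handles the sums. Bounds thus pass to a limit without convergence in the norm
  itself.\<close>

lemma wnorm_liminf:
  assumes "\<And>x v k l. (\<lambda>j. cf (A j x v) k l) \<longlonglongrightarrow> cf (H x v) k l"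
  shows "wnorm w (am H) \<le> liminf (\<lambda>j. wnorm w (am (A j)))"
proof -
  have eq: "wnorm w (am J) = (\<integral>\<^sup>+k. \<integral>\<^sup>+l. ennreal (w (k + l)) * amp J k l \<partial>count_space UNIV \<partial>count_space UNIV)" for J
  proof -
    have "wnorm w (am J) = (\<Sum>m. \<Sum>k\<le>m. ennreal (w (k + (m - k))) * amp J k (m - k))"
      unfolding wnorm_def am_def by (intro suminf_cong) (simp add: sum_distrib_left)
    also have "\<dots> = (\<Sum>k. \<Sum>l. ennreal (w (k + l)) * amp J k l)"
      by (rule suminf_ennreal_triangle)
    finally show ?thesis by (simp add: nn_integral_count_space_nat)
  qed
  have amp: "ennreal (w (k + l)) * amp H k l \<le> liminf (\<lambda>j. ennreal (w (k + l)) * amp (A j) k l)" for k l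
    unfolding amp_def[of H] SUP_mult_left_ennreal
  proof (rule SUP_least, clarify)
    fix x v
    have "(\<lambda>j. ennreal (w (k + l)) * ennreal \<bar>cf (A j x v) k l\<bar>) \<longlonglongrightarrow> ennreal (w (k + l)) * ennreal \<bar>cf (H x v) k l\<bar>"
      by (intro ennreal_tendsto_cmult tendsto_ennrealI tendsto_intros assms) simp
    then have "ennreal (w (k + l)) * ennreal \<bar>cf (H x v) k l\<bar> = liminf (\<lambda>j. ennreal (w (k + l)) * ennreal \<bar>cf (A j x v) k l\<bar>)"
      by (simp add: lim_imp_Liminf)
    also have "\<dots> \<le> liminf (\<lambda>j. ennreal (w (k + l)) * amp (A j) k l)"
      by (intro Liminf_mono always_eventually allI mult_left_mono le_amp) auto
    finally show "ennreal (w (k + l)) * ennreal \<bar>cf (H x v) k l\<bar> \<le> \<dots>" .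
  qed
  have "wnorm w (am H) \<le> (\<integral>\<^sup>+k. \<integral>\<^sup>+l. liminf (\<lambda>j. ennreal (w (k + l)) * amp (A j) k l) \<partial>count_space UNIV \<partial>count_space UNIV)"
    unfolding eq by (intro nn_integral_mono amp)
  also have "\<dots> \<le> (\<integral>\<^sup>+k. liminf (\<lambda>j. \<integral>\<^sup>+l. ennreal (w (k + l)) * amp (A j) k l \<partial>count_space UNIV) \<partial>count_space UNIV)"
    by (intro nn_integral_mono nn_integral_liminf) simp
  also have "\<dots> \<le> liminf (\<lambda>j. \<integral>\<^sup>+k. \<integral>\<^sup>+l. ennreal (w (k + l)) * amp (A j) k l \<partial>count_space UNIV \<partial>count_space UNIV)"
    by (intro nn_integral_liminf) simp
  finally show ?thesis unfolding eq .
qed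

lemma liminf_le_const: "(\<And>j. X j \<le> (B::ennreal)) \<Longrightarrow> liminf X \<le> B"
  using Liminf_mono[of X "\<lambda>_. B" sequentially] by (simp add: Liminf_const)

lemma wnorm_limit_le:
  assumes "\<And>x v k l. (\<lambda>j. cf (A j x v) k l) \<longlonglongrightarrow> cf (H x v) k l"
    and "\<And>j. wnorm w (am (A j)) \<le> B"
  shows "wnorm w (am H) \<le> B"
  by (rule order_trans[OF wnorm_liminf[OF assms(1)] liminf_le_const[OF assms(2)]])

text \<open>Fatou once more, now in time; smoothness of the jets \<open>A j\<close> provides the
  measurability.\<close>

lemma nn_integral_wnorm_limit_le:
  assumes lim: "\<And>s x v k l. s \<in> S \<Longrightarrow> (\<lambda>j. cf (A j s x v) k l) \<longlonglongrightarrow> cf (H s x v) k l"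
    and B: "\<And>j. (\<integral>\<^sup>+s\<in>S. wnorm (w s) (am (A j s)) \<partial>lborel) \<le> B"
    and S: "S \<in> sets borel" and A: "\<And>j. smooth_jet (A j)" and w: "\<And>m. continuous_on UNIV (\<lambda>s. w s m)"
  shows "(\<integral>\<^sup>+s\<in>S. wnorm (w s) (am (H s)) \<partial>lborel) \<le> B"
proof -
  note [measurable] = borel_measurable_wnorm[OF A w]
  have "(\<integral>\<^sup>+s\<in>S. wnorm (w s) (am (H s)) \<partial>lborel) \<le> (\<integral>\<^sup>+s. liminf (\<lambda>j. wnorm (w s) (am (A j s)) * indicator S s) \<partial>lborel)"
  proof (intro nn_integral_mono)
    fix s
    show "wnorm (w s) (am (H s)) * indicator S s \<le> liminf (\<lambda>j. wnorm (w s) (am (A j s)) * indicator S s)"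
      using wnorm_liminf[OF lim] by (cases "s \<in> S") auto
  qed
  also have "\<dots> \<le> liminf (\<lambda>j. \<integral>\<^sup>+s\<in>S. wnorm (w s) (am (A j s)) \<partial>lborel)"
    using S by (intro nn_integral_liminf) simp
  also have "\<dots> \<le> B"
    by (rule liminf_le_const[OF B])
  finally show ?thesis .
qed

text \<open>Sum of \<open>mode_energy\<close> over \<open>m\<close>. The initial amplitude
  \<open>a\<close> is a free sequence: that of the datum for an iterate, zero for a difference of
  iterates.\<close>

lemma wnorm_energy:
  fixes K L0 l0 t :: real
  defines "lam \<equiv> \<lambda>t. l0 - (K + 1) * t"
  assumes t: "0 \<le> t" and lam0: "0 \<le> lam t" and l0: "l0 \<le> L0" and K: "0 \<le> K" "L0 \<le> K"
    and F: "smooth_jet F" and A: "smooth_jet A"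
    and le: "\<And>r m. 0 \<le> r \<Longrightarrow> r \<le> t \<Longrightarrow> am (A r) m \<le> ennreal ((1 + r) ^ m) * a m
          + (\<integral>\<^sup>+s\<in>{0..r}. ennreal ((1 + (r - s)) ^ m) * am (F s) m \<partial>lborel)"
  shows "norm_W (lam t) (A t) + ennreal (K - L0) * (\<integral>\<^sup>+r\<in>{0..t}. seminorm_W (lam r) (A r) \<partial>lborel)
    \<le> wnorm (W l0) a + (\<integral>\<^sup>+s\<in>{0..t}. norm_W (lam s) (F s) \<partial>lborel)"
proof -
  have cW': "continuous_on UNIV (\<lambda>r. W' (lam r) m)" and cW: "continuous_on UNIV (\<lambda>r. W (lam r) m)" for m
    unfolding lam_def by (intro continuous_intros)+
  note [measurable] = borel_measurable_continuous_onI[OF cW'] borel_measurable_continuous_onI[OF cW]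
    borel_measurable_am[OF F] borel_measurable_am[OF A]
  have swap: "(\<integral>\<^sup>+r\<in>{0..t}. wnorm (w r) (am (J r)) \<partial>lborel) = (\<Sum>m. \<integral>\<^sup>+r\<in>{0..t}. ennreal (w r m) * am (J r) m \<partial>lborel)"
    if [measurable]: "\<And>m. (\<lambda>r. w r m) \<in> borel_measurable borel" "\<And>m. (\<lambda>r. am (J r) m) \<in> borel_measurable borel" for w J
    unfolding wnorm_def ennreal_suminf_multc[symmetric] by (rule nn_integral_suminf) measurable
  have "norm_W (lam t) (A t) + ennreal (K - L0) * (\<integral>\<^sup>+r\<in>{0..t}. seminorm_W (lam r) (A r) \<partial>lborel)
      = (\<Sum>m. ennreal (W (lam t) m) * am (A t) m + ennreal (K - L0) * (\<integral>\<^sup>+r\<in>{0..t}. ennreal (W' (lam r) m) * am (A r) m \<partial>lborel))"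
    by (subst swap) (simp_all add: wnorm_def suminf_add[symmetric])
  also have "\<dots> \<le> (\<Sum>m. ennreal (W l0 m) * a m + (\<integral>\<^sup>+s\<in>{0..t}. ennreal (W (lam s) m) * am (F s) m \<partial>lborel))"
  proof (intro suminf_le summableI)
    fix m
    show "ennreal (W (lam t) m) * am (A t) m + ennreal (K - L0) * (\<integral>\<^sup>+r\<in>{0..t}. ennreal (W' (lam r) m) * am (A r) m \<partial>lborel)
        \<le> ennreal (W l0 m) * a m + (\<integral>\<^sup>+s\<in>{0..t}. ennreal (W (lam s) m) * am (F s) m \<partial>lborel)"
      unfolding lam_def by (rule mode_energy) (use t lam0 l0 K le borel_measurable_am[OF F] in \<open>auto simp: lam_def\<close>)
  qed
  also have "\<dots> = wnorm (W l0) a + (\<integral>\<^sup>+s\<in>{0..t}. norm_W (lam s) (F s) \<partial>lborel)"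
    by (subst swap) (simp_all add: wnorm_def suminf_add[symmetric])
  finally show ?thesis .
qed

locale vlasov = analytic_nonlinearity R \<Phi> c M for R \<Phi> c M +
  fixes lambda0 K T :: real and f\<^sub>0 :: "real \<Rightarrow> real \<Rightarrow> real" and G0 :: "real \<Rightarrow> real \<Rightarrow> real fps fps"
  assumes T0: "0 < T" and lambda0: "0 < lambda0" "lambda0 < 1" and K0: "0 < K" "K < lambda0 / T - 1"
    and smallness: "2 * (1 + alpha0 lambda0) * M * (P1 + 2 * M * T * P2) * exp (alpha0 lambda0 * P1 * M * T) < 1"
    and K_large: "1 \<le> K - lambda0 - 5 * P1 * M"
    and G0: "smooth_jet (\<lambda>p::real. G0)" and G0_f0: "\<And>x v. cf (G0 x v) 0 0 = f\<^sub>0 x v / omega v"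
    and G0_norm: "norm_W lambda0 G0 \<le> ennreal (M / 2 * exp (- (5 + alpha0 lambda0) * P1 * M))"
begin

abbreviation lam :: "real \<Rightarrow> real" where "lam t \<equiv> lambda0 - (K + 1) * t"
abbreviation a0 :: real where "a0 \<equiv> alpha0 lambda0"
abbreviation kap :: real where "kap \<equiv> K - lambda0"
abbreviation cl :: "real \<Rightarrow> real" where "cl \<equiv> clamp_time T"

text \<open>The loss of radius \<open>eps\<close> bounds seminorms at radius \<open>lame t\<close> by norms at radius \<open>lam t\<close>, uniformly in \<open>t\<close>.\<close>

definition eps :: real where "eps = lam T"
abbreviation lame :: "real \<Rightarrow> real" where "lame t \<equiv> (lambda0 - eps) - (K + 1) * t"

lemma eps_pos: "0 < eps"
proof -
  have "(K + 1) * T < lambda0" using K0(2) T0 by (simp add: field_simps)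
  then show ?thesis by (simp add: eps_def)
qed

text \<open>The choice \<open>eps = lam T\<close> spends the whole radius left at the final time:
  \<open>lame T = 0\<close>.\<close>

lemma lame_nonneg: "t \<in> {0..T} \<Longrightarrow> 0 \<le> lame t"
  using K0(1) mult_left_mono[of t T "K + 1"] by (simp add: eps_def)

lemma lam_bounds: "t \<in> {0..T} \<Longrightarrow> 0 < lam t" "t \<in> {0..T} \<Longrightarrow> lam t \<le> lambda0"
  using lame_nonneg[of t] eps_pos K0(1) by auto

lemma lame_le: "t \<in> {0..T} \<Longrightarrow> lame t \<le> lambda0"
  using lam_bounds(2)[of t] eps_pos by auto

text \<open>The exponential is at least 1 and the \<open>P2\<close> term is nonnegative, so the left
  side of the smallness condition dominates \<open>2 (1 + a0) M P1\<close>.\<close>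

lemma P_small: "(1 + a0) * (P1 * M) < 1 / 2"
proof -
  have "2 * (1 + a0) * M * P1 * 1 \<le> 2 * (1 + a0) * M * (P1 + 2 * M * T * P2) * exp (a0 * P1 * M * T)"
    using M0 T0 P1_nonneg P2_nonneg alpha0_nonneg[of lambda0]
    by (intro mult_mono) (auto intro!: mult_nonneg_nonneg add_nonneg_nonneg)
  with smallness show ?thesis by (simp add: mult_ac)
qed

lemma kap_ge: "1 \<le> kap"
proof -
  have "0 \<le> 5 * P1 * M" using P1_nonneg M0 by simp
  with K_large show ?thesis by linarith
qed

lemma K_ge: "lambda0 \<le> K" using kap_ge by simp

text \<open>Uniqueness needs only the supremum part of the norm of \<open>X_space\<close>. Functions are constant in time
  outside \<open>{0..T}\<close>, so that smoothness can be required for all times.\<close>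

definition admissible :: "(real \<Rightarrow> real \<Rightarrow> real \<Rightarrow> real fps fps) \<Rightarrow> bool" where
  "admissible g \<longleftrightarrow> smooth_jet g \<and> (\<forall>t. g (cl t) = g t) \<and> (\<forall>t\<in>{0..T}. norm_W (lam t) (g t) \<le> ennreal M)"

definition step :: "(real \<Rightarrow> real \<Rightarrow> real \<Rightarrow> real fps fps) \<Rightarrow> real \<Rightarrow> real \<Rightarrow> real \<Rightarrow> real fps fps" where
  "step g t x v = transport (cl t) G0 x v + duhamel (\<lambda>s. force (g s)) (cl t) x v"

text \<open>The two parts are bounded separately because each passes to limits by its own use of
  Fatou. As \<open>kap \<ge> 1\<close>, they add up to the \<open>M\<close> of
  \<open>X_space\<close>.\<close>

definition small_ball :: "(real \<Rightarrow> real \<Rightarrow> real \<Rightarrow> real fps fps) \<Rightarrow> bool" where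
  "small_ball g \<longleftrightarrow> smooth_jet g \<and> (\<forall>t. g (cl t) = g t) \<and>
    (\<forall>t\<in>{0..T}. norm_W (lam t) (g t) \<le> ennreal (M / 2) \<and>
      ennreal kap * (\<integral>\<^sup>+r\<in>{0..t}. seminorm_W (lam r) (g r) \<partial>lborel) \<le> ennreal (M / 2))"

lemma cl_in: "cl t \<in> {0..T}"
  using clamp_time_in[of T t] T0 by simp

lemma small_ball_admissible: "small_ball g \<Longrightarrow> admissible g"
  unfolding small_ball_def admissible_def using M0 by (auto intro: order_trans ennreal_leI)

lemma admissible_norm:
  assumes "admissible g"
  shows "norm_W (lam (cl t)) (g t) \<le> ennreal M"
  using assms cl_in[of t] unfolding admissible_def by metis

section \<open>The Picard step and the invariant ball\<close>

lemma smooth_jet_potential: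
  assumes g: "admissible g"
  shows "smooth_jet (\<lambda>t. jpsi c (jrho (g t)))"
proof -
  have sg: "smooth_jet g" using g by (simp add: admissible_def)
  have L: "0 \<le> lam (cl t)" for t using lam_bounds(1)[OF cl_in, of t] by simp
  have "smooth_jet (\<lambda>t. jrho (g t))"
  proof (rule smooth_jet_jrho[OF sg], intro exI allI)
    show "\<bar>cf (g p x v) k 0\<bar> \<le> fact k * M" for k p x v
      using abs_cf_le_real[OF L[of p] admissible_norm[OF g, of p], of x v k 0] M0 by simp
  qed
  then show ?thesis
    by (rule smooth_jet_jpsi[where L = "\<lambda>t. lam (cl t)"])
      (use L order_trans[OF wnorm_jrho[OF sg] admissible_norm[OF g]] in auto)
qed

lemma smooth_jet_force:
  assumes g: "admissible g"
  shows "smooth_jet (\<lambda>t. force (g t))"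
  unfolding force_def[abs_def] using g
  by (intro smooth_jet_mult smooth_jet_add smooth_jet_dX smooth_jet_dV smooth_jet_jalpha smooth_jet_potential)
    (auto simp: admissible_def)

lemma smooth_jet_step:
  assumes g: "admissible g"
  shows "smooth_jet (step g)"
proof -
  have "smooth_jet (\<lambda>t. transport (cl t) G0)"
    by (rule smooth_jet_transport[OF G0 continuous_clamp_time])
  moreover have "smooth_jet (\<lambda>t. duhamel (\<lambda>s. force (g s)) (cl t))"
    by (rule smooth_jet_reparam[OF smooth_jet_duhamel[OF smooth_jet_force[OF g]] continuous_clamp_time])
  ultimately show ?thesis
    unfolding step_def[abs_def] by (rule smooth_jet_add)
qed

lemma step_clamp: "step g (cl t) = step g t"
  by (simp add: step_def fun_eq_iff)

lemma am_step:
  assumes g: "admissible g" and r: "r \<in> {0..T}"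
  shows "am (step g r) m \<le> ennreal ((1 + r) ^ m) * am G0 m
    + (\<integral>\<^sup>+s\<in>{0..r}. ennreal ((1 + (r - s)) ^ m) * am (force (g s)) m \<partial>lborel)"
proof -
  have "step g r = (\<lambda>x v. transport r G0 x v + duhamel (\<lambda>s. force (g s)) r x v)"
    using clamp_time_eq[OF r] by (simp add: step_def fun_eq_iff)
  then have "am (step g r) m \<le> am (transport r G0) m + am (duhamel (\<lambda>s. force (g s)) r) m"
    by (simp only: am_add)
  also have "\<dots> \<le> ennreal ((1 + r) ^ m) * am G0 m + (\<integral>\<^sup>+s\<in>{0..r}. ennreal ((1 + (r - s)) ^ m) * am (force (g s)) m \<partial>lborel)"
    using r by (intro add_mono am_transport am_duhamel smooth_jet_force[OF g]) auto
  finally show ?thesis .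
qed

text \<open>With \<open>z = (2 + a0) P1 M\<close>, division by \<open>M / 2\<close> leaves at most
  \<open>exp (-z) + z / (2 kap) \<le> 1 / (1 + z) + z / 2\<close>, and this is at most 1 for
  \<open>0 \<le> z \<le> 1\<close>. The range of \<open>z\<close> comes from \<open>P_small\<close>,
  since \<open>z \<le> 2 (1 + a0) P1 M\<close>.\<close>

lemma small_ball_arith:
  "M / 2 * exp (- (5 + a0) * P1 * M) + (2 + a0) * P1 * (M / 2) * (M / 2 / kap) \<le> M / 2"
proof -
  define P where "P = P1 * M"
  define z where "z = (2 + a0) * P"
  have P: "0 \<le> P" using P1_nonneg M0 by (simp add: P_def)
  have "P \<le> (1 + a0) * P"
    using mult_right_mono[of 1 "1 + a0" P] P alpha0_nonneg[of lambda0] by simp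
  then have z: "0 \<le> z" "z \<le> 1"
    using P P_small alpha0_nonneg[of lambda0] by (auto simp: z_def P_def algebra_simps)
  have "z \<le> (5 + a0) * P"
    using P by (simp add: z_def algebra_simps)
  then have "exp (- ((5 + a0) * P)) \<le> exp (- z)" by simp
  also have "\<dots> \<le> 1 / (1 + z)"
    using exp_ge_add_one_self[of z] z by (simp add: exp_minus divide_simps)
  finally have e: "exp (- (5 + a0) * P1 * M) \<le> 1 / (1 + z)"
    by (simp add: P_def algebra_simps)
  define y where "y = z / kap"
  have "z / kap \<le> z / 1"
    using z kap_ge by (intro divide_left_mono) auto
  then have y: "y \<le> z" by (simp add: y_def)
  have "1 / (1 + z) + z / 2 \<le> 1"
  proof -
    have "z * z \<le> z * 1" using z by (intro mult_left_mono) auto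
    then show ?thesis using z by (simp add: divide_simps algebra_simps)
  qed
  then have "exp (- (5 + a0) * P1 * M) + y / 2 \<le> 1"
    using e y by linarith
  then have "M / 2 * (exp (- (5 + a0) * P1 * M) + y / 2) \<le> M / 2 * 1"
    using M0 by (intro mult_left_mono) auto
  moreover have "M / 2 * (y / 2) = (2 + a0) * P1 * (M / 2) * (M / 2 / kap)"
    unfolding y_def z_def P_def by (simp only: divide_inverse mult_ac)
  ultimately show ?thesis by (simp only: distrib_left mult_1_right)
qed

text \<open>In the bound of the force by norm times seminorm, the ball gives \<open>M / 2\<close>
  for the norm at each time and \<open>M / (2 kap)\<close> for the integral of the seminorm; the
  energy inequality returns both quantities for the next iterate.\<close>

lemma small_ball_step:
  assumes g: "small_ball g"
  shows "small_ball (step g)"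
proof -
  note adm = small_ball_admissible[OF g]
  have sg: "smooth_jet g" using g by (simp add: small_ball_def)
  let ?N = "\<lambda>s. norm_W (lam s) (g s)" and ?N' = "\<lambda>s. seminorm_W (lam s) (g s)"
  note [measurable] = borel_measurable_wnorm[OF sg, of "\<lambda>s. W' (lam s)"]
  have main: "norm_W (lam t) (step g t) + ennreal kap * (\<integral>\<^sup>+r\<in>{0..t}. seminorm_W (lam r) (step g r) \<partial>lborel) \<le> ennreal (M / 2)"
    if t: "t \<in> {0..T}" for t
  proof -
    have "norm_W (lam t) (step g t) + ennreal kap * (\<integral>\<^sup>+r\<in>{0..t}. seminorm_W (lam r) (step g r) \<partial>lborel)
      \<le> norm_W lambda0 G0 + (\<integral>\<^sup>+s\<in>{0..t}. norm_W (lam s) (force (g s)) \<partial>lborel)"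
      using t lam_bounds(1)[OF t] K0 K_ge
      by (intro wnorm_energy smooth_jet_force smooth_jet_step adm am_step) auto
    also have "\<dots> \<le> ennreal (M / 2 * exp (- (5 + a0) * P1 * M)) + ennreal ((2 + a0) * P1 * (M / 2) * (M / 2 / kap))"
    proof (intro add_mono G0_norm)
      have V: "(\<integral>\<^sup>+s\<in>{0..t}. ?N' s \<partial>lborel) \<le> ennreal (M / 2 / kap)"
        using g t kap_ge M0 by (subst ennreal_cmult_le_iff[symmetric]) (auto simp: small_ball_def)
      have "(\<integral>\<^sup>+s\<in>{0..t}. norm_W (lam s) (force (g s)) \<partial>lborel)
          \<le> (\<integral>\<^sup>+s. ennreal ((2 + a0) * P1 * (M / 2)) * (?N' s * indicator {0..t} s) \<partial>lborel)"
      proof (intro nn_integral_mono)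
        fix s
        show "norm_W (lam s) (force (g s)) * indicator {0..t} s
          \<le> ennreal ((2 + a0) * P1 * (M / 2)) * (?N' s * indicator {0..t} s)"
        proof (cases "s \<in> {0..t}")
          case True
          then have s: "s \<in> {0..T}" using t by auto
          note L = lam_bounds[OF s]
          have "norm_W (lam s) (force (g s)) \<le> ennreal ((2 + alpha0 (lam s)) * P1) * ?N s * ?N' s"
            using L lambda0 admissible_norm[OF adm, of s] clamp_time_eq[OF s]
            by (intro wnorm_force sg) auto
          also have "\<dots> \<le> ennreal ((2 + a0) * P1) * ennreal (M / 2) * ?N' s"
            using g s L lambda0 P1_nonneg
            by (intro mult_mono ennreal_leI mult_right_mono add_mono alpha0_mono) (auto simp: small_ball_def)
          also have "\<dots> = ennreal ((2 + a0) * P1 * (M / 2)) * ?N' s"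
            using P1_nonneg M0 alpha0_nonneg[of lambda0] by (subst ennreal_mult) auto
          finally show ?thesis using True by simp
        qed simp
      qed
      also have "\<dots> = ennreal ((2 + a0) * P1 * (M / 2)) * (\<integral>\<^sup>+s\<in>{0..t}. ?N' s \<partial>lborel)"
        by (intro nn_integral_cmult borel_measurable_times_ennreal) (auto intro!: borel_measurable_wnorm[OF sg] continuous_intros)
      also have "\<dots> \<le> ennreal ((2 + a0) * P1 * (M / 2)) * ennreal (M / 2 / kap)"
        by (intro mult_left_mono V) simp
      also have "\<dots> = ennreal ((2 + a0) * P1 * (M / 2) * (M / 2 / kap))"
        using P1_nonneg M0 alpha0_nonneg[of lambda0] kap_ge by (intro ennreal_mult[symmetric]) auto
      finally show "(\<integral>\<^sup>+s\<in>{0..t}. norm_W (lam s) (force (g s)) \<partial>lborel) \<le> \<dots>" .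
    qed
    also have "\<dots> = ennreal (M / 2 * exp (- (5 + a0) * P1 * M) + (2 + a0) * P1 * (M / 2) * (M / 2 / kap))"
      using P1_nonneg M0 alpha0_nonneg[of lambda0] kap_ge by (intro ennreal_plus[symmetric]) auto
    also have "\<dots> \<le> ennreal (M / 2)"
      by (intro ennreal_leI small_ball_arith)
    finally show ?thesis .
  qed
  show ?thesis
    unfolding small_ball_def using smooth_jet_step[OF adm] step_clamp main by (blast intro: ennreal_add_leD)
qed

section \<open>Contraction at the reduced radius\<close>

definition E :: "(real \<Rightarrow> real \<Rightarrow> real \<Rightarrow> real fps fps) \<Rightarrow> (real \<Rightarrow> real \<Rightarrow> real \<Rightarrow> real fps fps) \<Rightarrow> real \<Rightarrow> ennreal" where
  "E g h t = norm_W (lame t) (\<lambda>x v. g t x v - h t x v)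
     + ennreal kap * (\<integral>\<^sup>+r\<in>{0..t}. seminorm_W (lame r) (\<lambda>x v. g r x v - h r x v) \<partial>lborel)"

text \<open>\<open>C1\<close> and \<open>q\<close> bound the coefficients in
  \<open>wnorm_force_diff\<close> for \<open>Q = M / eps\<close>. The weight \<open>mu\<close> makes
  \<open>C1 / mu\<close> at most \<open>(1 - q) / 2\<close>, so that together with
  \<open>q / kap \<le> q\<close> the total stays below
  \<open>ratio = (1 - q) / 2 + q\<close>.\<close>

definition q :: real where "q = (2 + a0) * P1 * M"
definition C1 :: real where "C1 = ((2 + a0) * P1 + (1 + a0) * P2 * M) * (M / eps)"
definition mu :: real where "mu = 2 * (C1 + 1) / (1 - q)"
definition ratio :: real where "ratio = (1 + q) / 2"

definition close :: "(real \<Rightarrow> real \<Rightarrow> real \<Rightarrow> real fps fps) \<Rightarrow> (real \<Rightarrow> real \<Rightarrow> real \<Rightarrow> real fps fps) \<Rightarrow> real \<Rightarrow> bool" where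
  "close g h C \<longleftrightarrow> (\<forall>t\<in>{0..T}. E g h t \<le> ennreal (C * exp (mu * t)))"

lemma q_bounds: "0 \<le> q" "q < 1"
proof -
  show "0 \<le> q" using P1_nonneg M0 alpha0_nonneg[of lambda0] by (simp add: q_def)
  have "P1 * M \<le> (1 + a0) * (P1 * M)"
    using mult_right_mono[of 1 "1 + a0" "P1 * M"] P1_nonneg M0 alpha0_nonneg[of lambda0] by simp
  then show "q < 1" using P_small by (simp add: q_def algebra_simps)
qed

lemma C1_nonneg: "0 \<le> C1"
  using P1_nonneg P2_nonneg M0 alpha0_nonneg[of lambda0] eps_pos by (simp add: C1_def)

lemma mu_pos: "0 < mu"
  using C1_nonneg q_bounds by (simp add: mu_def)

lemma ratio_bounds: "0 < ratio" "ratio < 1"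
  using q_bounds by (auto simp: ratio_def)

lemma C1_mu: "C1 / mu + q / kap \<le> ratio"
proof -
  have "C1 / mu \<le> (1 - q) / 2"
    using C1_nonneg q_bounds by (simp add: mu_def divide_simps)
  moreover have "q / kap \<le> q / 1"
    using q_bounds kap_ge by (intro divide_left_mono) auto
  ultimately show ?thesis by (simp add: ratio_def field_simps)
qed

text \<open>The margin \<open>eps\<close> between the radii converts the norm bound at the full
  radius into a seminorm bound, by \<open>wnorm_W'_le_W\<close>.\<close>

lemma admissible_norm_e:
  assumes g: "admissible g" and t: "t \<in> {0..T}"
  shows "norm_W (lame t) (g t) \<le> ennreal M" "seminorm_W (lame t) (g t) \<le> ennreal (M / eps)"
proof -
  have N: "norm_W (lam t) (g t) \<le> ennreal M"
    using g t by (simp add: admissible_def)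
  show "norm_W (lame t) (g t) \<le> ennreal M"
    by (rule order_trans[OF wnorm_mono[OF W_mono order_refl] N]) (use lame_nonneg[OF t] eps_pos in auto)
  have "ennreal eps * seminorm_W (lame t) (g t) \<le> ennreal M"
    using wnorm_W'_le_W[OF lame_nonneg[OF t] less_imp_le[OF eps_pos], of "am (g t)"] N by simp
  then show "seminorm_W (lame t) (g t) \<le> ennreal (M / eps)"
    using eps_pos M0 by (simp add: ennreal_cmult_le_iff)
qed

text \<open>The transported datum cancels, and Duhamel's formula is linear in the source.\<close>

lemma am_step_diff:
  assumes g: "admissible g" and h: "admissible h" and r: "r \<in> {0..T}"
  shows "am (\<lambda>x v. step g r x v - step h r x v) m
    \<le> (\<integral>\<^sup>+s\<in>{0..r}. ennreal ((1 + (r - s)) ^ m) * am (\<lambda>x v. force (g s) x v - force (h s) x v) m \<partial>lborel)"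
proof -
  let ?F = "\<lambda>s x v. force (g s) x v - force (h s) x v"
  have sF: "smooth_jet ?F"
    by (rule smooth_jet_diff[OF smooth_jet_force[OF g] smooth_jet_force[OF h]])
  have "(\<lambda>x v. step g r x v - step h r x v) = duhamel ?F r"
  proof (intro ext fps_fps_eqI)
    fix x v k l
    have r0: "0 \<le> r" using r by simp
    have "cf (step g r x v - step h r x v) k l
        = integral {0..r} (\<lambda>s. cf (transport (r - s) (force (g s)) x v) k l) - integral {0..r} (\<lambda>s. cf (transport (r - s) (force (h s)) x v) k l)"
      using clamp_time_eq[OF r] by (simp add: step_def cf_duhamel(1)[OF smooth_jet_force[OF g] r0] cf_duhamel(1)[OF smooth_jet_force[OF h] r0])
    also have "\<dots> = integral {0..r} (\<lambda>s. cf (transport (r - s) (force (g s)) x v) k l - cf (transport (r - s) (force (h s)) x v) k l)"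
      by (intro Henstock_Kurzweil_Integration.integral_diff[symmetric] integrable_continuous_real
        cf_duhamel(2)[OF smooth_jet_force[OF g] r0] cf_duhamel(2)[OF smooth_jet_force[OF h] r0])
    also have "\<dots> = integral {0..r} (\<lambda>s. cf (transport (r - s) (?F s) x v) k l)"
      by (simp add: cf_transport right_diff_distrib sum_subtractf)
    also have "\<dots> = cf (duhamel ?F r x v) k l"
      by (rule cf_duhamel(1)[OF sF r0, symmetric])
    finally show "cf (step g r x v - step h r x v) k l = cf (duhamel ?F r x v) k l" .
  qed
  then show ?thesis using am_duhamel[OF sF, of r m] r by simp
qed

lemma nn_integral_exp_le:
  assumes "0 \<le> t" "0 \<le> C"
  shows "(\<integral>\<^sup>+s\<in>{0..t}. ennreal (C * exp (mu * s)) \<partial>lborel) \<le> ennreal (C * exp (mu * t) / mu)"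
proof -
  have "((\<lambda>s. C * exp (mu * s)) has_integral (C * exp (mu * t) / mu - C * exp (mu * 0) / mu)) {0..t}"
    using mu_pos assms by (intro fundamental_theorem_of_calculus)
      (auto simp: has_real_derivative_iff_has_vector_derivative[symmetric] intro!: derivative_eq_intros)
  then have "(\<integral>\<^sup>+s\<in>{0..t}. ennreal (C * exp (mu * s)) \<partial>lborel) = ennreal (C * exp (mu * t) / mu - C * exp (mu * 0) / mu)"
    using assms by (intro nn_integral_has_integral_lebesgue') auto
  also have "\<dots> \<le> ennreal (C * exp (mu * t) / mu)"
    using assms mu_pos by (intro ennreal_leI) simp
  finally show ?thesis .
qed

text \<open>The energy inequality has zero initial amplitude here. The norm part of the source is
  integrated against the exponential, which gains \<open>1 / mu\<close>; the seminorm part is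
  already an integral contained in \<open>E\<close>, up to the factor \<open>kap\<close>.\<close>

lemma close_step:
  assumes g: "admissible g" and h: "admissible h" and C: "0 \<le> C" and gh: "close g h C"
  shows "close (step g) (step h) (ratio * C)"
  unfolding close_def
proof
  fix t assume t: "t \<in> {0..T}"
  let ?D = "\<lambda>s x v. g s x v - h s x v" and ?F = "\<lambda>s x v. force (g s) x v - force (h s) x v"
  let ?N = "\<lambda>s. norm_W (lame s) (?D s)" and ?N' = "\<lambda>s. seminorm_W (lame s) (?D s)"
  have sg: "smooth_jet g" "smooth_jet h" using g h by (auto simp: admissible_def)
  have sD: "smooth_jet ?D" by (rule smooth_jet_diff[OF sg])
  have cW: "continuous_on UNIV (\<lambda>s. W (lame s) m)" "continuous_on UNIV (\<lambda>s. W' (lame s) m)" for m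
    by (intro continuous_intros)+
  note [measurable] = borel_measurable_wnorm[OF sD cW(1)] borel_measurable_wnorm[OF sD cW(2)]
  have "E (step g) (step h) t \<le> wnorm (W (lambda0 - eps)) (\<lambda>_. 0) + (\<integral>\<^sup>+s\<in>{0..t}. norm_W (lame s) (?F s) \<partial>lborel)"
    unfolding E_def
    using t lame_nonneg[OF t] eps_pos K0 K_ge am_step_diff[OF g h]
    by (intro wnorm_energy smooth_jet_diff smooth_jet_force smooth_jet_step g h) auto
  also have "\<dots> = (\<integral>\<^sup>+s\<in>{0..t}. norm_W (lame s) (?F s) \<partial>lborel)"
    by (simp add: wnorm_def)
  also have "\<dots> \<le> (\<integral>\<^sup>+s. ennreal C1 * (?N s * indicator {0..t} s) + ennreal q * (?N' s * indicator {0..t} s) \<partial>lborel)"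
  proof (intro nn_integral_mono)
    fix s
    show "norm_W (lame s) (?F s) * indicator {0..t} s
        \<le> ennreal C1 * (?N s * indicator {0..t} s) + ennreal q * (?N' s * indicator {0..t} s)"
    proof (cases "s \<in> {0..t}")
      case True
      then have s: "s \<in> {0..T}" using t by auto
      have a: "alpha0 (lame s) \<le> a0"
        using lame_nonneg[OF s] lame_le[OF s] lambda0 by (intro alpha0_mono) auto
      have "norm_W (lame s) (?F s)
          \<le> ennreal (((2 + alpha0 (lame s)) * P1 + (1 + alpha0 (lame s)) * P2 * M) * (M / eps)) * ?N s
            + ennreal ((2 + alpha0 (lame s)) * P1 * M) * ?N' s"
        using lame_nonneg[OF s] lame_le[OF s] lambda0 eps_pos M0
        by (intro wnorm_force_diff sg admissible_norm_e[OF g s] admissible_norm_e[OF h s]) auto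
      also have "\<dots> \<le> ennreal C1 * ?N s + ennreal q * ?N' s"
        unfolding C1_def q_def using a P1_nonneg P2_nonneg M0 eps_pos
        by (intro add_mono mult_right_mono ennreal_leI) auto
      finally show ?thesis using True by simp
    qed simp
  qed
  also have "\<dots> = ennreal C1 * (\<integral>\<^sup>+s\<in>{0..t}. ?N s \<partial>lborel) + ennreal q * (\<integral>\<^sup>+s\<in>{0..t}. ?N' s \<partial>lborel)"
    by (simp add: nn_integral_add nn_integral_cmult)
  also have "\<dots> \<le> ennreal C1 * ennreal (C * exp (mu * t) / mu) + ennreal q * ennreal (C * exp (mu * t) / kap)"
  proof (intro add_mono mult_left_mono)
    have "(\<integral>\<^sup>+s\<in>{0..t}. ?N s \<partial>lborel) \<le> (\<integral>\<^sup>+s\<in>{0..t}. ennreal (C * exp (mu * s)) \<partial>lborel)"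
    proof (intro nn_integral_mono)
      fix s
      show "?N s * indicator {0..t} s \<le> ennreal (C * exp (mu * s)) * indicator {0..t} s"
      proof (cases "s \<in> {0..t}")
        case True
        then have "?N s \<le> E g h s" by (simp add: E_def)
        also have "\<dots> \<le> ennreal (C * exp (mu * s))"
          using gh True t by (auto simp: close_def)
        finally show ?thesis using True by simp
      qed simp
    qed
    also have "\<dots> \<le> ennreal (C * exp (mu * t) / mu)"
      using t C by (intro nn_integral_exp_le) auto
    finally show "(\<integral>\<^sup>+s\<in>{0..t}. ?N s \<partial>lborel) \<le> ennreal (C * exp (mu * t) / mu)" .
    have "ennreal kap * (\<integral>\<^sup>+s\<in>{0..t}. ?N' s \<partial>lborel) \<le> E g h t" by (simp add: E_def)
    also have "\<dots> \<le> ennreal (C * exp (mu * t))" using gh t by (simp add: close_def)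
    finally show "(\<integral>\<^sup>+s\<in>{0..t}. ?N' s \<partial>lborel) \<le> ennreal (C * exp (mu * t) / kap)"
      using kap_ge C by (simp add: ennreal_cmult_le_iff)
  qed auto
  also have "\<dots> = ennreal ((C1 / mu + q / kap) * (C * exp (mu * t)))"
    using C1_nonneg C q_bounds mu_pos kap_ge by (simp add: ennreal_mult[symmetric] ennreal_plus[symmetric] algebra_simps del: ennreal_plus)
  also have "\<dots> \<le> ennreal (ratio * (C * exp (mu * t)))"
    using C1_mu C by (intro ennreal_leI mult_right_mono) auto
  finally show "E (step g) (step h) t \<le> ennreal (ratio * C * exp (mu * t))"
    by (simp add: mult.assoc)
qed

lemma close_triangle:
  assumes "smooth_jet g" "smooth_jet h" "smooth_jet k" and C: "0 \<le> C" "0 \<le> C'" and gh: "close g h C" and hk: "close h k C'"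
  shows "close g k (C + C')"
  unfolding close_def
proof
  fix t assume t: "t \<in> {0..T}"
  have cW: "continuous_on UNIV (\<lambda>s. W' (lame s) m)" for m
    by (intro continuous_intros)
  note [measurable] = borel_measurable_wnorm[OF smooth_jet_diff[OF assms(1,2)] cW]
    borel_measurable_wnorm[OF smooth_jet_diff[OF assms(2,3)] cW]
  let ?D = "\<lambda>g h s x v. g s x v - h s x v"
  have "(\<integral>\<^sup>+r\<in>{0..t}. seminorm_W (lame r) (?D g k r) \<partial>lborel)
      \<le> (\<integral>\<^sup>+r. seminorm_W (lame r) (?D g h r) * indicator {0..t} r + seminorm_W (lame r) (?D h k r) * indicator {0..t} r \<partial>lborel)"
    unfolding distrib_right[symmetric] by (intro nn_integral_mono mult_right_mono wnorm_am_triangle) auto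
  also have "\<dots> = (\<integral>\<^sup>+r\<in>{0..t}. seminorm_W (lame r) (?D g h r) \<partial>lborel) + (\<integral>\<^sup>+r\<in>{0..t}. seminorm_W (lame r) (?D h k r) \<partial>lborel)"
    by (rule nn_integral_add) auto
  finally have "E g k t \<le> (norm_W (lame t) (?D g h t) + norm_W (lame t) (?D h k t))
      + ennreal kap * ((\<integral>\<^sup>+r\<in>{0..t}. seminorm_W (lame r) (?D g h r) \<partial>lborel) + (\<integral>\<^sup>+r\<in>{0..t}. seminorm_W (lame r) (?D h k r) \<partial>lborel))"
    unfolding E_def by (intro add_mono mult_left_mono wnorm_am_triangle) auto
  also have "\<dots> = E g h t + E h k t"
    by (simp add: E_def distrib_left add_ac)
  also have "\<dots> \<le> ennreal (C * exp (mu * t)) + ennreal (C' * exp (mu * t))"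
    using gh hk t by (intro add_mono) (auto simp: close_def)
  also have "\<dots> = ennreal ((C + C') * exp (mu * t))"
    using C by (simp add: ennreal_plus[symmetric] distrib_right del: ennreal_plus)
  finally show "E g k t \<le> ennreal ((C + C') * exp (mu * t))" .
qed

lemma close_commute: "close g h C \<Longrightarrow> close h g C"
proof -
  have "am (\<lambda>x v. g r x v - h r x v) = am (\<lambda>x v. h r x v - g r x v)" for r
    by (rule ext) (rule am_diff_commute)
  then have "E g h t = E h g t" for t by (simp add: E_def)
  then show "close g h C \<Longrightarrow> close h g C" by (simp add: close_def)
qed

text \<open>The constant doubles because the two parts of \<open>E\<close> pass to the limit
  separately. This is harmless as the constants in use tend to 0.\<close>

lemma close_limit:
  assumes "\<And>j. smooth_jet (A j)" "smooth_jet h" and C: "0 \<le> C" and cl: "\<And>j. close (A j) h C"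
    and lim: "\<And>t x v k l. (\<lambda>j. cf (A j t x v) k l) \<longlonglongrightarrow> cf (g t x v) k l"
  shows "close g h (2 * C)"
  unfolding close_def
proof
  fix t assume t: "t \<in> {0..T}"
  have lim': "(\<lambda>j. cf (A j t x v - h t x v) k l) \<longlonglongrightarrow> cf (g t x v - h t x v) k l" for t x v k l
    using lim by (auto intro!: tendsto_intros)
  let ?B = "ennreal (C * exp (mu * t))"
  have cW: "continuous_on UNIV (\<lambda>s. W' (lame s) m)" for m
    by (intro continuous_intros)
  have le: "norm_W (lame t) (\<lambda>x v. A j t x v - h t x v) \<le> ?B"
    "ennreal kap * (\<integral>\<^sup>+r\<in>{0..t}. seminorm_W (lame r) (\<lambda>x v. A j r x v - h r x v) \<partial>lborel) \<le> ?B" for j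
  proof -
    have "E (A j) h t \<le> ?B" using cl[of j] t by (simp add: close_def)
    then show "norm_W (lame t) (\<lambda>x v. A j t x v - h t x v) \<le> ?B"
      "ennreal kap * (\<integral>\<^sup>+r\<in>{0..t}. seminorm_W (lame r) (\<lambda>x v. A j r x v - h r x v) \<partial>lborel) \<le> ?B"
      unfolding E_def by (rule ennreal_add_leD)+
  qed
  have "norm_W (lame t) (\<lambda>x v. g t x v - h t x v) \<le> ?B"
    by (rule wnorm_limit_le[OF lim' le(1)])
  moreover have "(\<integral>\<^sup>+r\<in>{0..t}. seminorm_W (lame r) (\<lambda>x v. g r x v - h r x v) \<partial>lborel) \<le> ennreal (C * exp (mu * t) / kap)"
  proof (rule nn_integral_wnorm_limit_le[where A = "\<lambda>j s x v. A j s x v - h s x v" and w = "\<lambda>s. W' (lame s)"])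
    show "(\<integral>\<^sup>+s\<in>{0..t}. seminorm_W (lame s) (\<lambda>x v. A j s x v - h s x v) \<partial>lborel) \<le> ennreal (C * exp (mu * t) / kap)" for j
      using le(2)[of j] C kap_ge by (simp add: ennreal_cmult_le_iff)
    show "smooth_jet (\<lambda>s x v. A j s x v - h s x v)" for j
      by (rule smooth_jet_diff[OF assms(1,2)])
  qed (use cW in \<open>auto intro!: tendsto_diff lim\<close>)
  ultimately have "E g h t \<le> ?B + ?B"
    unfolding E_def using C kap_ge by (intro add_mono) (simp_all add: ennreal_cmult_le_iff)
  also have "\<dots> = ennreal (2 * C * exp (mu * t))"
    using C by (simp add: ennreal_plus[symmetric] del: ennreal_plus)
  finally show "E g h t \<le> \<dots>" .
qed

lemma close_imp_abs_cf_le: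
  assumes "close g h C" "0 \<le> C" and g: "\<And>t. g (cl t) = g t" and h: "\<And>t. h (cl t) = h t"
  shows "\<bar>cf (g t x v) k l - cf (h t x v) k l\<bar> \<le> fact (k + l) * (C * exp (mu * T))"
proof -
  let ?t = "cl t"
  have "norm_W (lame ?t) (\<lambda>x v. g ?t x v - h ?t x v) \<le> E g h ?t"
    by (simp add: E_def)
  also have "\<dots> \<le> ennreal (C * exp (mu * ?t))"
    using assms(1) cl_in unfolding close_def by blast
  also have "\<dots> \<le> ennreal (C * exp (mu * T))"
    using assms(2) cl_in[of t] mu_pos by (intro ennreal_leI mult_left_mono) auto
  finally have "\<bar>cf (g ?t x v - h ?t x v) k l\<bar> \<le> fact (k + l) * (C * exp (mu * T))"
    using assms(2) by (intro abs_cf_le_real[OF lame_nonneg[OF cl_in]]) auto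
  then show ?thesis by (simp add: g h)
qed

lemma close_zero_imp_eq:
  assumes "X \<longlonglongrightarrow> 0" "\<And>n. close g h (X n)" "\<And>n. 0 \<le> X n"
    and g: "\<And>t. g (cl t) = g t" and h: "\<And>t. h (cl t) = h t"
  shows "g = h"
proof (intro ext fps_fps_eqI)
  fix t x v k l
  have "(\<lambda>n. fact (k + l) * (X n * exp (mu * T))) \<longlonglongrightarrow> fact (k + l) * (0 * exp (mu * T))"
    by (intro tendsto_intros assms)
  then have "\<bar>cf (g t x v) k l - cf (h t x v) k l\<bar> \<le> fact (k + l) * (0 * exp (mu * T))"
    by (rule LIMSEQ_le_const) (use close_imp_abs_cf_le[OF assms(2,3) g h] in blast)
  then show "cf (g t x v) k l = cf (h t x v) k l" by simp
qed

text \<open>A priori bound of \<open>E\<close> between admissible functions: \<open>2 M\<close> for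
  the norm and \<open>2 M / eps\<close> at each time for the seminorm.\<close>

definition C0 :: real where "C0 = 2 * M + kap * (2 * M / eps * T)"

lemma C0_nonneg: "0 \<le> C0"
  using M0 kap_ge eps_pos T0 by (simp add: C0_def)

lemma close_admissible:
  assumes g: "admissible g" and h: "admissible h"
  shows "close g h C0"
  unfolding close_def
proof
  fix t assume t: "t \<in> {0..T}"
  have N: "norm_W (lame s) (\<lambda>x v. g s x v - h s x v) \<le> ennreal (2 * M)"
    and N': "seminorm_W (lame s) (\<lambda>x v. g s x v - h s x v) \<le> ennreal (2 * M / eps)" if s: "s \<in> {0..T}" for s
  proof -
    have "norm_W (lame s) (\<lambda>x v. g s x v - h s x v) \<le> ennreal M + ennreal M"
      by (rule order_trans[OF wnorm_am_diff]) (intro add_mono admissible_norm_e g h s)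
    then show "norm_W (lame s) (\<lambda>x v. g s x v - h s x v) \<le> ennreal (2 * M)"
      using M0 by (simp add: ennreal_plus[symmetric] del: ennreal_plus)
    have "seminorm_W (lame s) (\<lambda>x v. g s x v - h s x v) \<le> ennreal (M / eps) + ennreal (M / eps)"
      by (rule order_trans[OF wnorm_am_diff]) (intro add_mono admissible_norm_e g h s)
    then show "seminorm_W (lame s) (\<lambda>x v. g s x v - h s x v) \<le> ennreal (2 * M / eps)"
      using M0 eps_pos by (simp add: ennreal_plus[symmetric] del: ennreal_plus)
  qed
  have "(\<integral>\<^sup>+r\<in>{0..t}. seminorm_W (lame r) (\<lambda>x v. g r x v - h r x v) \<partial>lborel)
      \<le> (\<integral>\<^sup>+r. ennreal (2 * M / eps) * indicator {0..t} r \<partial>lborel)"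
    using N' t by (intro nn_integral_mono) (auto simp: indicator_def)
  also have "\<dots> = ennreal (2 * M / eps) * ennreal t"
    using t by (simp add: nn_integral_cmult)
  also have "\<dots> \<le> ennreal (2 * M / eps) * ennreal T"
    using t by (intro mult_left_mono ennreal_leI) auto
  finally have "E g h t \<le> ennreal (2 * M) + ennreal kap * (ennreal (2 * M / eps) * ennreal T)"
    unfolding E_def by (intro add_mono mult_left_mono N t) auto
  also have "\<dots> = ennreal (C0 * 1)"
    using M0 kap_ge eps_pos T0 by (simp add: C0_def ennreal_mult[symmetric] ennreal_plus[symmetric] del: ennreal_plus)
  also have "\<dots> \<le> ennreal (C0 * exp (mu * t))"
    using C0_nonneg mu_pos t by (intro ennreal_leI mult_left_mono) auto
  finally show "E g h t \<le> ennreal (C0 * exp (mu * t))" .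
qed

lemma fixed_point_unique:
  assumes g: "admissible g" "step g = g" and h: "admissible h" "step h = h"
  shows "g = h"
proof (rule close_zero_imp_eq)
  show "close g h (ratio ^ n * C0)" for n
  proof (induction n)
    case (Suc n)
    from close_step[OF g(1) h(1) _ this] show ?case
      using g h C0_nonneg ratio_bounds by (simp add: mult.assoc)
  qed (simp add: close_admissible g h)
  have "(\<lambda>n. ratio ^ n * C0) \<longlonglongrightarrow> 0 * C0"
    using ratio_bounds by (intro tendsto_intros LIMSEQ_power_zero) auto
  then show "(\<lambda>n. ratio ^ n * C0) \<longlonglongrightarrow> 0" by simp
qed (use g h C0_nonneg ratio_bounds in \<open>auto simp: admissible_def\<close>)

text \<open>The iterates are Cauchy at the reduced radius only. Their limit satisfies the bounds of
  the ball at the full radius by lower semicontinuity, and so is admissible itself, which allows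
  \<open>step\<close> to be applied to it.\<close>

lemma fixed_point_exists: "\<exists>g. small_ball g \<and> step g = g"
proof -
  define gs where "gs n = (step ^^ n) (\<lambda>t x v. 0)" for n
  have am0: "am (\<lambda>x v. 0) m = 0" for m
    using am_const[of 0 m] by simp
  have ball: "small_ball (gs n)" for n
  proof (induction n)
    case 0
    show ?case
      using smooth_jet_const[of 0] by (simp add: gs_def small_ball_def am0 wnorm_def)
  next
    case (Suc n)
    then show ?case using small_ball_step[OF Suc] by (simp add: gs_def)
  qed
  note adm = small_ball_admissible[OF ball]
  have sm: "smooth_jet (gs n)" and gcl: "gs n (cl t) = gs n t" for n t
    using ball[of n] by (auto simp: small_ball_def)
  \<comment> \<open>Chosen so that the sum of \<open>C0 * ratio ^ i\<close> over
    \<open>n \<le> i < n + j\<close> is exactly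
    \<open>B * ratio ^ n * (1 - ratio ^ j)\<close>.\<close>
  define B where "B = C0 / (1 - ratio)"
  have B: "0 \<le> B" "C0 = B * (1 - ratio)" using C0_nonneg ratio_bounds by (auto simp: B_def)
  have one: "close (gs (Suc n)) (gs n) (C0 * ratio ^ n)" for n
  proof (induction n)
    case (Suc n)
    have "0 \<le> C0 * ratio ^ n" using C0_nonneg ratio_bounds by simp
    from close_step[OF adm adm this Suc] show ?case by (simp add: gs_def mult_ac)
  qed (simp add: close_admissible adm)
  have many: "close (gs (n + j)) (gs n) (B * ratio ^ n * (1 - ratio ^ j))" for n j
  proof (induction j)
    case 0
    have "E (gs n) (gs n) t = 0" for t
      by (simp add: E_def am0 wnorm_def)
    then show ?case by (simp add: close_def)
  next
    case (Suc j)
    have "close (gs (n + Suc j)) (gs n) (C0 * ratio ^ (n + j) + B * ratio ^ n * (1 - ratio ^ j))"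
      using one[of "n + j"] B C0_nonneg ratio_bounds
      by (intro close_triangle[OF sm sm sm _ _ _ Suc]) (auto simp: power_le_one)
    also have "C0 * ratio ^ (n + j) + B * ratio ^ n * (1 - ratio ^ j) = B * ratio ^ n * (1 - ratio ^ Suc j)"
      unfolding B(2) by (simp add: power_add algebra_simps)
    finally show ?case .
  qed
  have many': "close (gs (n + j)) (gs n) (B * ratio ^ n)" for n j
  proof -
    have "B * ratio ^ n * (1 - ratio ^ j) \<le> B * ratio ^ n * 1"
      using B ratio_bounds by (intro mult_left_mono) auto
    then have "ennreal (B * ratio ^ n * (1 - ratio ^ j) * exp (mu * t)) \<le> ennreal (B * ratio ^ n * exp (mu * t))" for t
      by (intro ennreal_leI mult_right_mono) auto
    then show ?thesis
      using many[of n j] unfolding close_def by (blast intro: order_trans)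
  qed
  let ?b = "\<lambda>n. B * ratio ^ n"
  have b0: "0 \<le> ?b n" for n using B ratio_bounds by simp
  have blim: "?b \<longlonglongrightarrow> 0"
    using ratio_bounds by (intro tendsto_mult_right_zero LIMSEQ_power_zero) auto
  have cauchy: "\<bar>cf (gs (n + j) t x v) k l - cf (gs n t x v) k l\<bar> \<le> fact (k + l) * (?b n * exp (mu * T))" for n j t x v k l
    by (rule close_imp_abs_cf_le[OF many' b0]) (simp_all add: gcl)
  have blim': "(\<lambda>n. fact (k + l) * (?b n * exp (mu * T))) \<longlonglongrightarrow> 0" for k l
    using tendsto_mult_right_zero[OF tendsto_mult_left_zero[OF blim, of "exp (mu * T)"], of "fact (k + l)"] by simp
  have conv: "convergent (\<lambda>n. cf (gs n t x v) k l)" for t x v k l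
    unfolding Cauchy_convergent_iff[symmetric]
  proof (rule CauchyI')
    fix e :: real assume "0 < e"
    from order_tendstoD(2)[OF blim'[of k l] this] obtain N
      where N: "\<And>n. n \<ge> N \<Longrightarrow> fact (k + l) * (?b n * exp (mu * T)) < e"
      by (auto simp: eventually_sequentially)
    have "dist (cf (gs n t x v) k l) (cf (gs m t x v) k l) < e" if "n \<ge> N" "n < m" for n m
      using cauchy[of n "m - n" t x v k l] N[OF that(1)] that by (simp add: dist_real_def abs_minus_commute)
    then show "\<exists>M. \<forall>m\<ge>M. \<forall>n>m. dist (cf (gs m t x v) k l) (cf (gs n t x v) k l) < e" by blast
  qed
  define g where "g t x v = Abs_fps (\<lambda>k. Abs_fps (\<lambda>l. lim (\<lambda>n. cf (gs n t x v) k l)))" for t x v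
  have lim: "(\<lambda>n. cf (gs n t x v) k l) \<longlonglongrightarrow> cf (g t x v) k l" for t x v k l
    using conv[of t x v k l] by (simp add: g_def convergent_LIMSEQ_iff)
  have limj: "(\<lambda>j. cf (gs (n + j) t x v) k l) \<longlonglongrightarrow> cf (g t x v) k l" for n t x v k l
    using LIMSEQ_ignore_initial_segment[OF lim, of n] by (simp add: add.commute)
  have smg: "smooth_jet g"
  proof (rule smooth_jet_limit[OF sm], intro exI conjI allI)
    fix k l n t x v
    have "(\<lambda>j. \<bar>cf (gs n t x v) k l - cf (gs (n + j) t x v) k l\<bar>) \<longlonglongrightarrow> \<bar>cf (gs n t x v) k l - cf (g t x v) k l\<bar>"
      by (intro tendsto_intros limj)
    then show "\<bar>cf (gs n t x v) k l - cf (g t x v) k l\<bar> \<le> fact (k + l) * (?b n * exp (mu * T))"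
      by (rule LIMSEQ_le_const2) (use cauchy in \<open>auto simp: abs_minus_commute\<close>)
  qed (rule blim')
  have gcl': "g (cl t) = g t" for t
    unfolding g_def by (simp add: gcl)
  have ballg: "small_ball g"
    unfolding small_ball_def
  proof (intro conjI allI ballI smg gcl')
    fix t assume t: "t \<in> {0..T}"
    show "norm_W (lam t) (g t) \<le> ennreal (M / 2)"
      by (rule wnorm_limit_le[OF lim]) (use ball t in \<open>auto simp: small_ball_def\<close>)
    have cW: "continuous_on UNIV (\<lambda>s. W' (lam s) m)" for m
      by (intro continuous_intros)
    have "(\<integral>\<^sup>+r\<in>{0..t}. seminorm_W (lam r) (gs n r) \<partial>lborel) \<le> ennreal (M / 2 / kap)" for n
      using ball[of n] t kap_ge M0 by (subst ennreal_cmult_le_iff[symmetric]) (auto simp: small_ball_def)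
    then have "(\<integral>\<^sup>+r\<in>{0..t}. seminorm_W (lam r) (g r) \<partial>lborel) \<le> ennreal (M / 2 / kap)"
      by (rule nn_integral_wnorm_limit_le[where A = gs and w = "\<lambda>s. W' (lam s)", OF lim _ _ sm cW]) simp
    then show "ennreal kap * (\<integral>\<^sup>+r\<in>{0..t}. seminorm_W (lam r) (g r) \<partial>lborel) \<le> ennreal (M / 2)"
      using kap_ge M0 by (subst ennreal_cmult_le_iff) auto
  qed
  have close_g: "close g (gs n) (2 * ?b n)" for n
    by (rule close_limit[OF sm sm b0 many' limj])
  \<comment> \<open>Both sides are close to the iterate of index \<open>Suc n\<close>: the left by
    contraction, the right by convergence.\<close>
  have "step g = g"
  proof (rule close_zero_imp_eq)
    show "close (step g) g (ratio * (2 * ?b n) + 2 * ?b (Suc n))" for n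
    proof (rule close_triangle)
      show "close (step g) (gs (Suc n)) (ratio * (2 * ?b n))"
        using close_step[OF small_ball_admissible[OF ballg] adm _ close_g] b0 by (simp add: gs_def)
      show "close (gs (Suc n)) g (2 * ?b (Suc n))"
        by (rule close_commute[OF close_g])
    qed (use smg sm smooth_jet_step[OF small_ball_admissible[OF ballg]] b0 B ratio_bounds in auto)
    have "(\<lambda>n. ratio * (2 * ?b n) + 2 * ?b (Suc n)) \<longlonglongrightarrow> ratio * (2 * 0) + 2 * 0"
      by (intro tendsto_intros blim LIMSEQ_Suc[OF blim])
    then show "(\<lambda>n. ratio * (2 * ?b n) + 2 * ?b (Suc n)) \<longlonglongrightarrow> 0" by simp
  qed (use b0 ratio_bounds B step_clamp gcl' in auto)
  with ballg show ?thesis by blast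
qed

end

section \<open>The equation along characteristics\<close>

text \<open>For free transport \<open>v\<close> is a mere parameter, and along
  \<open>y + s v\<close> the equation becomes an ordinary one with right side \<open>F\<close>. The
  fundamental theorem of calculus gives one direction; the other differentiates the integral and
  undoes the change of variable.\<close>

lemma characteristics_iff:
  fixes \<phi> \<phi>x F :: "real \<Rightarrow> real \<Rightarrow> real"
  assumes T: "0 \<le> T"
    and \<phi>x: "\<And>s y. s \<in> {0..T} \<Longrightarrow> (\<phi> s has_real_derivative \<phi>x s y) (at y)"
    and cont: "continuous_on UNIV (\<lambda>(s, y). \<phi>x s y)" "continuous_on UNIV (\<lambda>(s, y). F s y)"
  shows "(\<forall>x. \<phi> 0 x = \<phi>0 x) \<and> (\<forall>t\<in>{0..T}. \<forall>x. ((\<lambda>s. \<phi> s x) has_real_derivative F t x - v * \<phi>x t x) (at t within {0..T}))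
    \<longleftrightarrow> (\<forall>t\<in>{0..T}. \<forall>x. \<phi> t x = \<phi>0 (x - t * v) + integral {0..t} (\<lambda>s. F s (x - (t - s) * v)))"
    (is "?init \<and> ?pde \<longleftrightarrow> ?duh")
proof
  assume "?init \<and> ?pde"
  then have init: ?init and pde: ?pde by blast+
  show ?duh
  proof (intro ballI allI)
    fix t x assume t: "t \<in> {0..T}"
    let ?y = "x - t * v"
    have "((\<lambda>s. \<phi> s (?y + s * v)) has_real_derivative F s (x - (t - s) * v)) (at s within {0..t})" if s: "s \<in> {0..t}" for s
    proof -
      have s': "s \<in> {0..T}" using s t by auto
      have "((\<lambda>s. \<phi> s (?y + s * v)) has_real_derivative
          (F s (?y + s * v) - v * \<phi>x s (?y + s * v)) + \<phi>x s (?y + s * v) * v) (at s within {0..T})"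
        using s' pde \<phi>x continuous_on_subset[OF cont(1)]
        by (intro has_real_derivative_along_curve[where S = "{0..T}" and uy = \<phi>x]) (auto intro!: derivative_eq_intros)
      then have "((\<lambda>s. \<phi> s (?y + s * v)) has_real_derivative F s (x - (t - s) * v)) (at s within {0..T})"
        by (simp add: algebra_simps)
      then show ?thesis
        by (rule DERIV_subset) (use t in auto)
    qed
    then have "((\<lambda>s. F s (x - (t - s) * v)) has_integral \<phi> t (?y + t * v) - \<phi> 0 (?y + 0 * v)) {0..t}"
      using t by (intro fundamental_theorem_of_calculus) (auto simp: has_real_derivative_iff_has_vector_derivative[symmetric])
    then show "\<phi> t x = \<phi>0 (x - t * v) + integral {0..t} (\<lambda>s. F s (x - (t - s) * v))"
      using init by (simp add: integral_unique)
  qed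
next
  assume duh: ?duh
  have ?init using duh[rule_format, of 0] T by simp
  moreover have ?pde
  proof (intro ballI allI)
    fix t x assume t: "t \<in> {0..T}"
    \<comment> \<open>\<open>h s y\<close> is the value on the characteristic starting from
      \<open>y\<close>. Duhamel's formula makes it an antiderivative in \<open>s\<close>, and
      \<open>\<phi> s x\<close> is recovered as \<open>h s (x - s * v)\<close>.\<close>
    define h where "h s y = \<phi> s (y + s * v)" for s y
    let ?y = "x - t * v"
    have "((\<lambda>s. h s (x - s * v)) has_real_derivative F t (?y + t * v) + \<phi>x t (?y + t * v) * (- v)) (at t within {0..T})"
    proof (rule has_real_derivative_along_curve[where S = "{0..T}" and u = h and uy = "\<lambda>s y. \<phi>x s (y + s * v)" and \<phi> = "\<lambda>s. x - s * v"])
      have eq: "h s ?y = \<phi>0 ?y + integral {0..s} (\<lambda>r. F r (?y + r * v))" if "s \<in> {0..T}" for s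
        using duh[rule_format, OF that, of "?y + s * v"] by (simp add: h_def algebra_simps)
      have "continuous_on {0..T} (\<lambda>r. F r (?y + r * v))"
      proof -
        have "continuous_on {0..T} (\<lambda>r. (r, ?y + r * v))" by (intro continuous_intros)
        from continuous_on_compose2[OF cont(2) this] show ?thesis by simp
      qed
      then have "((\<lambda>s. \<phi>0 ?y + integral {0..s} (\<lambda>r. F r (?y + r * v))) has_real_derivative 0 + F t (?y + t * v)) (at t within {0..T})"
        by (intro DERIV_add DERIV_const integral_has_real_derivative t)
      then show "((\<lambda>s. h s (x - t * v)) has_real_derivative F t (?y + t * v)) (at t within {0..T})"
        by (subst has_field_derivative_cong_eventually[where g = "\<lambda>s. \<phi>0 ?y + integral {0..s} (\<lambda>r. F r (?y + r * v))"])
          (use t in \<open>auto simp: eventually_at_filter eq simp del: atLeastAtMost_iff\<close>)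
      show "(h s has_real_derivative \<phi>x s (y + s * v)) (at y)" if "s \<in> {0..T}" for s y
      proof -
        have "((\<lambda>y. y + s * v) has_real_derivative 1) (at y)"
          by (auto intro!: derivative_eq_intros)
        from DERIV_chain2[OF \<phi>x[OF that] this] show ?thesis by (simp add: h_def[abs_def])
      qed
      show "continuous_on ({0..T} \<times> UNIV) (\<lambda>(s, y). \<phi>x s (y + s * v))"
      proof -
        have "continuous_on ({0..T} \<times> UNIV) (\<lambda>z. (fst z, snd z + fst z * v))" by (intro continuous_intros)
        from continuous_on_compose2[OF cont(1) this] show ?thesis by (simp add: case_prod_beta')
      qed
    qed (use t in \<open>auto intro!: derivative_eq_intros\<close>)
    then show "((\<lambda>s. \<phi> s x) has_real_derivative F t x - v * \<phi>x t x) (at t within {0..T})"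
      by (simp add: h_def mult.commute)
  qed
  ultimately show "?init \<and> ?pde" ..
qed

section \<open>Equivalence of the problems for \<open>f\<close> and for \<open>g\<close>\<close>

lemma cf_jet_of_0: "cf (jet_of f x v) 0 0 = f x v"
  by (simp add: cf_jet_of pd_def)

lemma DERIV_omega: "(omega has_real_derivative alpha v * omega v) (at v)"
proof -
  have "1 + v\<^sup>2 \<noteq> 0" using zero_le_power2[of v] by linarith
  then have "omega field_differentiable (at v)"
    unfolding omega_def[abs_def] by (auto intro!: derivative_intros simp: field_differentiable_power)
  then have "(omega has_real_derivative deriv omega v) (at v)"
    by (simp add: field_differentiable_derivI)
  then show ?thesis using omega_pos[of v] by (simp add: alpha_def)
qed

text \<open>As \<alpha> is the logarithmic derivative of the weight,
  \<open>pd_v (omega g) = omega (pd_v g + alpha g)\<close>: the equation for \<open>f\<close> is the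
  one for \<open>g\<close> multiplied by the positive weight. The densities coincide.\<close>

lemma solves_f_of_solves_g:
  assumes g: "solves_g \<Phi> T f\<^sub>0 g"
  shows "solves_f \<Phi> T f\<^sub>0 (\<lambda>t x v. omega v * g t x v)"
  unfolding solves_f_def
proof (intro conjI allI ballI)
  let ?f = "\<lambda>t x v. omega v * g t x v"
  note om = omega_pos[THEN less_imp_neq, THEN not_sym]
  show "?f 0 x v = f\<^sub>0 x v" for x v
    using g om[of v] by (simp add: solves_g_def Let_def)
  fix t x assume t: "t \<in> {0..T}"
  note sg = g[unfolded solves_g_def Let_def, THEN conjunct2, rule_format, OF t, of x]
  show "integrable lborel (?f t x)" "(\<lambda>y. \<Phi> (rho ?f t y)) differentiable at x"
    using sg by blast+
  fix v
  have gx: "((\<lambda>y. g t y v) has_real_derivative pd_x (g t) x v) (at x)"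
    and gv: "((\<lambda>w. g t x w) has_real_derivative pd_v (g t) x v) (at v)"
    using sg unfolding pd_x_def pd_v_def by (metis DERIV_deriv_iff_real_differentiable)+
  obtain gt where gt: "((\<lambda>s. g s x v) has_real_derivative gt) (at t within {0..T})"
    "gt + v * pd_x (g t) x v - deriv (\<lambda>y. \<Phi> (rho ?f t y)) x * (pd_v (g t) x v + alpha v * g t x v) = 0"
    using sg by blast
  have fx: "((\<lambda>y. ?f t y v) has_real_derivative omega v * pd_x (g t) x v) (at x)"
    by (rule DERIV_cmult[OF gx])
  have fv: "((\<lambda>w. ?f t x w) has_real_derivative omega v * (pd_v (g t) x v + alpha v * g t x v)) (at v)"
    using DERIV_mult[OF DERIV_omega gv] by (simp add: algebra_simps)
  show "(\<lambda>y. ?f t y v) differentiable at x" "(\<lambda>w. ?f t x w) differentiable at v"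
    using fx fv unfolding real_differentiable_def by blast+
  have pd: "pd_x (?f t) x v = omega v * pd_x (g t) x v" "pd_v (?f t) x v = omega v * (pd_v (g t) x v + alpha v * g t x v)"
    unfolding pd_x_def[of "?f t"] pd_v_def[of "?f t"] using fx fv by (auto intro: DERIV_imp_deriv)
  have "omega v * gt + v * pd_x (?f t) x v - deriv (\<lambda>y. \<Phi> (rho ?f t y)) x * pd_v (?f t) x v
      = omega v * (gt + v * pd_x (g t) x v - deriv (\<lambda>y. \<Phi> (rho ?f t y)) x * (pd_v (g t) x v + alpha v * g t x v))"
    unfolding pd by (simp add: algebra_simps)
  then show "\<exists>f_t. ((\<lambda>s. ?f s x v) has_real_derivative f_t) (at t within {0..T}) \<and>
      f_t + v * pd_x (?f t) x v - deriv (\<lambda>y. \<Phi> (rho ?f t y)) x * pd_v (?f t) x v = 0"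
    using DERIV_cmult[OF gt(1), of "omega v"] gt(2) by auto
qed

lemma solves_g_of_solves_f:
  assumes f: "solves_f \<Phi> T f\<^sub>0 f"
  shows "solves_g \<Phi> T f\<^sub>0 (\<lambda>t x v. f t x v / omega v)"
proof -
  let ?g = "\<lambda>t x v. f t x v / omega v"
  note om = omega_pos[THEN less_imp_neq, THEN not_sym]
  have fg: "(\<lambda>t x v. omega v * ?g t x v) = f"
    using om by auto
  show ?thesis
    unfolding solves_g_def Let_def fg
  proof (intro conjI allI ballI)
    show "?g 0 x v = f\<^sub>0 x v / omega v" for x v
      using f by (simp add: solves_f_def)
    fix t x assume t: "t \<in> {0..T}"
    note sf = f[unfolded solves_f_def, THEN conjunct2, rule_format, OF t, of x]
    show "integrable lborel (\<lambda>v. omega v * ?g t x v)" "(\<lambda>y. \<Phi> (rho f t y)) differentiable at x"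
      using sf om by auto
    fix v
    have fx: "((\<lambda>y. f t y v) has_real_derivative pd_x (f t) x v) (at x)"
      and fv: "((\<lambda>w. f t x w) has_real_derivative pd_v (f t) x v) (at v)"
      using sf unfolding pd_x_def pd_v_def by (metis DERIV_deriv_iff_real_differentiable)+
    obtain ft where ft: "((\<lambda>s. f s x v) has_real_derivative ft) (at t within {0..T})"
      "ft + v * pd_x (f t) x v - deriv (\<lambda>y. \<Phi> (rho f t y)) x * pd_v (f t) x v = 0"
      using sf by blast
    have gx: "((\<lambda>y. ?g t y v) has_real_derivative pd_x (f t) x v / omega v) (at x)"
      by (rule DERIV_cdivide[OF fx])
    have gv: "((\<lambda>w. ?g t x w) has_real_derivative pd_v (f t) x v / omega v - alpha v * ?g t x v) (at v)"
    proof -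
      have "(pd_v (f t) x v * omega v - f t x v * (alpha v * omega v)) / (omega v * omega v)
          = pd_v (f t) x v / omega v - alpha v * ?g t x v"
        using om[of v] by (simp add: field_simps)
      with DERIV_divide[OF fv DERIV_omega om] show ?thesis by simp
    qed
    show "(\<lambda>y. ?g t y v) differentiable at x" "(\<lambda>w. ?g t x w) differentiable at v"
      using gx gv unfolding real_differentiable_def by blast+
    have pd: "pd_x (?g t) x v = pd_x (f t) x v / omega v" "pd_v (?g t) x v = pd_v (f t) x v / omega v - alpha v * ?g t x v"
      unfolding pd_x_def[of "?g t"] pd_v_def[of "?g t"] using gx gv by (auto intro: DERIV_imp_deriv)
    have "ft / omega v + v * pd_x (?g t) x v - deriv (\<lambda>y. \<Phi> (rho f t y)) x * (pd_v (?g t) x v + alpha v * ?g t x v)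
        = (ft + v * pd_x (f t) x v - deriv (\<lambda>y. \<Phi> (rho f t y)) x * pd_v (f t) x v) / omega v"
      unfolding pd by (simp add: diff_divide_distrib add_divide_distrib)
    then show "\<exists>g_t. ((\<lambda>s. ?g s x v) has_real_derivative g_t) (at t within {0..T}) \<and>
        g_t + v * pd_x (?g t) x v - deriv (\<lambda>y. \<Phi> (rho f t y)) x * (pd_v (?g t) x v + alpha v * ?g t x v) = 0"
      using DERIV_cdivide[OF ft(1), of "omega v"] ft(2) by auto
  qed
qed

text \<open>Time derivatives are taken within \<open>{0..T}\<close>, so values at other times are
  irrelevant. This allows a solution to be replaced by its extension constant in time.\<close>

lemma solves_g_cong:
  assumes h: "\<And>t. t \<in> {0..T} \<Longrightarrow> h t = h' t" and T: "0 \<le> T" and sol: "solves_g \<Phi> T f\<^sub>0 h"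
  shows "solves_g \<Phi> T f\<^sub>0 h'"
proof -
  have \<rho>: "rho (\<lambda>t x v. omega v * h t x v) t = rho (\<lambda>t x v. omega v * h' t x v) t" if "t \<in> {0..T}" for t
    using h[OF that] by (simp add: rho_def fun_eq_iff)
  have d: "((\<lambda>s. h' s x v) has_real_derivative D) (at t within {0..T})"
    if "((\<lambda>s. h s x v) has_real_derivative D) (at t within {0..T})" "t \<in> {0..T}" for t x v D
    using has_field_derivative_transform_within[OF that(1) zero_less_one that(2)] h by simp
  show ?thesis
    unfolding solves_g_def Let_def
  proof (intro conjI allI ballI)
    show "h' 0 x v = f\<^sub>0 x v / omega v" for x v
      using sol h[of 0] T by (simp add: solves_g_def Let_def)
    fix t x assume t: "t \<in> {0..T}"
    note sol' = sol[unfolded solves_g_def Let_def, THEN conjunct2, rule_format, OF t, of x, unfolded h[OF t] \<rho>[OF t]]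
    show "integrable lborel (\<lambda>v. omega v * h' t x v)"
      "(\<lambda>y. \<Phi> (rho (\<lambda>t x v. omega v * h' t x v) t y)) differentiable at x"
      "(\<lambda>y. h' t y v) differentiable at x" "(\<lambda>w. h' t x w) differentiable at v" for v
      using sol' by blast+
    show "\<exists>g_t. ((\<lambda>s. h' s x v) has_real_derivative g_t) (at t within {0..T}) \<and>
        g_t + v * pd_x (h' t) x v - deriv (\<lambda>y. \<Phi> (rho (\<lambda>t x v. omega v * h' t x v) t y)) x
          * (pd_v (h' t) x v + alpha v * h' t x v) = 0" for v
      using sol' d[OF _ t] by blast
  qed
qed

section \<open>Solutions as fixed points of the Picard map\<close>

context vlasov
begin

context
  fixes g :: "real \<Rightarrow> real \<Rightarrow> real \<Rightarrow> real fps fps"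
  assumes g: "admissible g"
begin

lemma smooth_g: "smooth_jet g"
  using g by (simp add: admissible_def)

lemma rho_eq: "rho (\<lambda>t x v. omega v * cf (g t x v) 0 0) t x = cf (jrho (g t) x v) 0 0"
  by (simp add: rho_def jrho_def)

lemma DERIV_potential:
  "((\<lambda>y. \<Phi> (rho (\<lambda>t x v. omega v * cf (g t x v) 0 0) t y)) has_real_derivative cf (dX (jpsi c (jrho (g t)) x v)) 0 0) (at x)"
proof -
  have L: "0 \<le> lam (cl t)" using lam_bounds(1)[OF cl_in, of t] by simp
  have "\<Phi> (rho (\<lambda>t x v. omega v * cf (g t x v) 0 0) t y) = \<Phi> 0 + cf (jpsi c (jrho (g t)) y v) 0 0" for y
    unfolding rho_eq[of t y v] by (rule cf_jpsi_0[OF L order_trans[OF wnorm_jrho[OF smooth_g] admissible_norm[OF g]]])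
  then show ?thesis
    using DERIV_add[OF DERIV_const smooth_jet_x[OF smooth_jet_potential[OF g]], of "\<Phi> 0" t v 0 0 x] by simp
qed

lemma pd_x_g: "pd_x (\<lambda>x v. cf (g t x v) 0 0) x v = cf (g t x v) (Suc 0) 0"
  and pd_v_g: "pd_v (\<lambda>x v. cf (g t x v) 0 0) x v = cf (g t x v) 0 (Suc 0)"
  unfolding pd_x_def pd_v_def
  using smooth_jet_x[OF smooth_g, of t v 0 0 x] smooth_jet_v[OF smooth_g, of t x 0 0 v] by (auto intro: DERIV_imp_deriv)

lemma cf_force: "cf (force (g t) x v) 0 0
  = cf (dX (jpsi c (jrho (g t)) x v)) 0 0 * (cf (g t x v) 0 (Suc 0) + alpha v * cf (g t x v) 0 0)"
  by (simp add: force_def cf_jalpha_0)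

lemma integrable_g: "integrable lborel (\<lambda>v. omega v * cf (g t x v) 0 0)"
proof (rule integrable_omega_mult)
  show "continuous_on UNIV (\<lambda>v. cf (g t x v) 0 0)"
    by (intro smooth_jet_continuous_on[OF smooth_g] continuous_intros)
  show "\<bar>cf (g t x w) 0 0\<bar> \<le> M" for w
    using abs_cf_le_real[OF _ admissible_norm[OF g, of t], of x w 0 0] lam_bounds(1)[OF cl_in, of t] M0 by simp
qed

lemma cf_step:
  assumes t: "t \<in> {0..T}"
  shows "cf (step g t x v) 0 0 = f\<^sub>0 (x - t * v) v / omega v + integral {0..t} (\<lambda>s. cf (force (g s) (x - (t - s) * v) v) 0 0)"
  using clamp_time_eq[OF t] t cf_duhamel(1)[OF smooth_jet_force[OF g], of t x v 0 0]
  by (simp add: step_def cf_transport G0_f0)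

text \<open>The characteristics lemma for each \<open>v\<close> gives equality of the values of
  \<open>step g\<close> and \<open>g\<close> on \<open>{0..T}\<close>. Smoothness upgrades this to
  all coefficients, and clamping to all times.\<close>

lemma solves_g_iff: "solves_g \<Phi> T f\<^sub>0 (\<lambda>t x v. cf (g t x v) 0 0) \<longleftrightarrow> step g = g"
proof -
  let ?\<phi> = "\<lambda>v t x. cf (g t x v) 0 0" and ?F = "\<lambda>v t x. cf (force (g t) x v) 0 0"
  have "solves_g \<Phi> T f\<^sub>0 (\<lambda>t x v. cf (g t x v) 0 0) \<longleftrightarrow>
      (\<forall>v. (\<forall>x. ?\<phi> v 0 x = f\<^sub>0 x v / omega v) \<and> (\<forall>t\<in>{0..T}. \<forall>x.
        ((\<lambda>s. ?\<phi> v s x) has_real_derivative ?F v t x - v * cf (g t x v) (Suc 0) 0) (at t within {0..T})))"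
  proof -
    have d1: "(\<lambda>y. \<Phi> (rho (\<lambda>t x v. omega v * cf (g t x v) 0 0) t y)) differentiable (at x)" for t x
      using DERIV_potential unfolding real_differentiable_def by blast
    have d2: "(\<lambda>y. cf (g t y v) 0 0) differentiable (at x)" "(\<lambda>w. cf (g t x w) 0 0) differentiable (at v)" for t x v
      using smooth_jet_x[OF smooth_g] smooth_jet_v[OF smooth_g] unfolding real_differentiable_def by blast+
    have dp: "deriv (\<lambda>y. \<Phi> (rho (\<lambda>t x v. omega v * cf (g t x v) 0 0) t y)) x = cf (dX (jpsi c (jrho (g t)) x v)) 0 0" for t x v
      by (rule DERIV_imp_deriv[OF DERIV_potential])
    have eq: "(\<exists>g_t. (f has_real_derivative g_t) (at t within {0..T}) \<and> g_t + v * pd_x (\<lambda>x v. cf (g t x v) 0 0) x v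
          - deriv (\<lambda>y. \<Phi> (rho (\<lambda>t x v. omega v * cf (g t x v) 0 0) t y)) x
            * (pd_v (\<lambda>x v. cf (g t x v) 0 0) x v + alpha v * cf (g t x v) 0 0) = 0)
        \<longleftrightarrow> (f has_real_derivative ?F v t x - v * cf (g t x v) (Suc 0) 0) (at t within {0..T})" for f t x v
    proof -
      have "gt + v * pd_x (\<lambda>x v. cf (g t x v) 0 0) x v
          - deriv (\<lambda>y. \<Phi> (rho (\<lambda>t x v. omega v * cf (g t x v) 0 0) t y)) x
            * (pd_v (\<lambda>x v. cf (g t x v) 0 0) x v + alpha v * cf (g t x v) 0 0) = 0
        \<longleftrightarrow> gt = ?F v t x - v * cf (g t x v) (Suc 0) 0" for gt
        unfolding pd_x_g pd_v_g cf_force dp[of t x v] by linarith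
      then show ?thesis by simp
    qed
    show ?thesis
      unfolding solves_g_def Let_def eq using d1 d2 integrable_g by blast
  qed
  also have "\<dots> \<longleftrightarrow> (\<forall>v. \<forall>t\<in>{0..T}. \<forall>x. ?\<phi> v t x = f\<^sub>0 (x - t * v) v / omega v + integral {0..t} (\<lambda>s. ?F v s (x - (t - s) * v)))"
  proof (intro arg_cong[where f = All] ext characteristics_iff)
    fix v
    show "0 \<le> T" using T0 by simp
    show "((\<lambda>x. ?\<phi> v s x) has_real_derivative cf (g s y v) (Suc 0) 0) (at y)" for s y
      using smooth_jet_x[OF smooth_g, of s v 0 0 y] by simp
    show "continuous_on UNIV (\<lambda>(s, y). cf (g s y v) (Suc 0) 0)"
      unfolding case_prod_beta' by (intro smooth_jet_continuous_on[OF smooth_g] continuous_intros)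
    show "continuous_on UNIV (\<lambda>(s, y). ?F v s y)"
      unfolding case_prod_beta' by (intro smooth_jet_continuous_on[OF smooth_jet_force[OF g]] continuous_intros)
  qed
  also have "\<dots> \<longleftrightarrow> (\<forall>t\<in>{0..T}. \<forall>x v. cf (step g t x v) 0 0 = cf (g t x v) 0 0)"
    using cf_step by (auto simp del: atLeastAtMost_iff)
  also have "\<dots> \<longleftrightarrow> step g = g"
  proof
    assume eq: "\<forall>t\<in>{0..T}. \<forall>x v. cf (step g t x v) 0 0 = cf (g t x v) 0 0"
    show "step g = g"
    proof
      fix t
      have "step g (cl t) = g (cl t)"
        using eq cl_in[of t] by (intro smooth_jet_eqI[OF smooth_jet_step[OF g] smooth_g]) blast
      then show "step g t = g t" using step_clamp g by (simp add: admissible_def)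
    qed
  qed simp
  finally show ?thesis .
qed

end

lemma X_space_small_ball:
  assumes g: "small_ball g"
  shows "(\<lambda>t x v. cf (g t x v) 0 0) \<in> X_space lambda0 K T M"
proof -
  have sg: "smooth_jet g" using g by (simp add: small_ball_def)
  have pd: "pd k l (\<lambda>x v. cf (g t x v) 0 0) x v = fact k * fact l * cf (g t x v) k l" for t k l x v
    by (simp add: pd_smooth_jet[OF sg])
  have nH: "norm_H (lam t) (\<lambda>x v. cf (g t x v) 0 0) = norm_W (lam t) (g t)"
    "seminorm_H (lam t) (\<lambda>x v. cf (g t x v) 0 0) = seminorm_W (lam t) (g t)" if "t \<in> {0..T}" for t
    using lam_bounds(1)[OF that] by (auto intro!: norm_H_jet seminorm_H_jet pd)
  have "(SUP t\<in>{0..T}. norm_H (lam t) (\<lambda>x v. cf (g t x v) 0 0)) \<le> ennreal (M / 2)"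
    using g nH by (intro SUP_least) (auto simp: small_ball_def)
  moreover have "(\<integral>\<^sup>+t\<in>{0..T}. seminorm_H (lam t) (\<lambda>x v. cf (g t x v) 0 0) \<partial>lborel) \<le> ennreal (M / 2)"
  proof -
    \<comment> \<open>The factor 1 is written out to be replaced by \<open>kap\<close>.\<close>
    have "(\<integral>\<^sup>+t\<in>{0..T}. seminorm_H (lam t) (\<lambda>x v. cf (g t x v) 0 0) \<partial>lborel)
        = 1 * (\<integral>\<^sup>+t\<in>{0..T}. seminorm_W (lam t) (g t) \<partial>lborel)"
      using nH(2) by (auto intro!: nn_integral_cong simp: indicator_def)
    also have "\<dots> \<le> ennreal kap * (\<integral>\<^sup>+t\<in>{0..T}. seminorm_W (lam t) (g t) \<partial>lborel)"
      using kap_ge by (intro mult_right_mono) (auto simp: ennreal_1[symmetric] simp del: ennreal_1 intro!: ennreal_leI)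
    also have "\<dots> \<le> ennreal (M / 2)"
      using g T0 by (simp add: small_ball_def)
    finally show ?thesis .
  qed
  ultimately have "(SUP t\<in>{0..T}. norm_H (lam t) (\<lambda>x v. cf (g t x v) 0 0))
      + (\<integral>\<^sup>+t\<in>{0..T}. seminorm_H (lam t) (\<lambda>x v. cf (g t x v) 0 0) \<partial>lborel) \<le> ennreal (M / 2) + ennreal (M / 2)"
    by (rule add_mono)
  then show ?thesis
    using C_time_C_inf_smooth_jet[OF sg] M0 by (simp add: X_space_def ennreal_plus[symmetric] del: ennreal_plus)
qed

lemma X_space_admissible:
  assumes h: "h \<in> X_space lambda0 K T M"
  shows "admissible (\<lambda>t. jet_of (h (cl t)))"
  unfolding admissible_def
proof (intro conjI allI ballI)
  show "smooth_jet (\<lambda>t. jet_of (h (cl t)))"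
    using h T0 by (intro smooth_jet_C_time_C_inf) (auto simp: X_space_def)
  fix t assume t: "t \<in> {0..T}"
  have "norm_H (lam t) (h t) \<le> (SUP t\<in>{0..T}. norm_H (lam t) (h t))"
    using t by (rule SUP_upper)
  also have "\<dots> \<le> ennreal M"
    using h unfolding X_space_def by (auto intro: ennreal_add_leD)
  finally have "norm_H (lam t) (h t) \<le> ennreal M" .
  moreover have "norm_H (lam t) (h t) = norm_W (lam t) (jet_of (h t))"
    using lam_bounds(1)[OF t] by (intro norm_H_jet) (auto simp: cf_jet_of)
  ultimately show "norm_W (lam t) (jet_of (h (cl t))) \<le> ennreal M"
    by (simp add: clamp_time_eq[OF t])
qed simp

lemma solution_exists_unique:
  "\<exists>g. g \<in> X_space lambda0 K T M \<and> solves_g \<Phi> T f\<^sub>0 g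
     \<and> (\<forall>h. h \<in> X_space lambda0 K T M \<and> solves_g \<Phi> T f\<^sub>0 h \<longrightarrow> (\<forall>t\<in>{0..T}. h t = g t))"
proof -
  obtain g where g: "small_ball g" "step g = g" using fixed_point_exists by blast
  note adm = small_ball_admissible[OF g(1)]
  let ?g = "\<lambda>t x v. cf (g t x v) 0 0"
  have "h t = ?g t" if h: "h \<in> X_space lambda0 K T M" "solves_g \<Phi> T f\<^sub>0 h" and t: "t \<in> {0..T}" for h t
  proof -
    \<comment> \<open>An arbitrary solution is turned into an admissible family of jets with the
      same values on \<open>{0..T}\<close>.\<close>
    let ?J = "\<lambda>t. jet_of (h (cl t))"
    note admJ = X_space_admissible[OF h(1)]
    have "solves_g \<Phi> T f\<^sub>0 (\<lambda>t x v. cf (?J t x v) 0 0)"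
      by (rule solves_g_cong[OF _ _ h(2)]) (use T0 in \<open>auto simp: cf_jet_of_0 clamp_time_eq\<close>)
    then have "?J = g"
      using solves_g_iff[OF admJ] fixed_point_unique[OF admJ _ adm g(2)] by blast
    then have "cf (?J t x v) 0 0 = ?g t x v" for x v by metis
    then show ?thesis using clamp_time_eq[OF t] by (simp add: cf_jet_of_0 fun_eq_iff)
  qed
  then show ?thesis
    using X_space_small_ball[OF g(1)] solves_g_iff[OF adm] g(2) by blast
qed

end

text \<open>Jet of the polynomial \<open>pi * (1 + v\<^sup>2)\<close>, the inverse weight, whose
  Taylor expansion ends at order 2.\<close>

definition jinv_omega :: "real \<Rightarrow> real \<Rightarrow> real fps fps" where
  "jinv_omega x v = Abs_fps (\<lambda>k. Abs_fps (\<lambda>l. if k \<noteq> 0 then 0 else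
     if l = 0 then pi * (1 + v\<^sup>2) else if l = 1 then 2 * pi * v else if l = 2 then pi else 0))"

lemma smooth_jet_jinv_omega: "smooth_jet (\<lambda>p :: 'a :: topological_space. jinv_omega)"
proof (rule smooth_jetI)
  fix k l
  show "continuous_on UNIV (\<lambda>(p :: 'a, x, v). cf (jinv_omega x v) k l)"
    unfolding case_prod_beta' jinv_omega_def
    by (cases "k = 0"; cases "l = 0"; cases "l = 1"; cases "l = 2") (auto intro!: continuous_intros)
next
  fix x v k l
  show "((\<lambda>w. cf (jinv_omega x w) k l) has_real_derivative real (Suc l) * cf (jinv_omega x v) k (Suc l)) (at v)"
    unfolding jinv_omega_def by (auto intro!: derivative_eq_intros simp: numeral_2_eq_2)
qed (simp add: jinv_omega_def)

theorem theorem4p2: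
  fixes R lambda0 K T M :: real
    and \<Phi> :: "real \<Rightarrow> real"
    and c :: "nat \<Rightarrow> real"
    and f\<^sub>0 :: "real \<Rightarrow> real \<Rightarrow> real"
  assumes "0 < R" and "has_power_series \<Phi> c R"
    and "0 < T" and "T < 1"
    and "T < lambda0" and "lambda0 < 1"
    and "0 < K" and "K < lambda0 / T - 1"
    and "0 < M" and "M < R"
    and "2 * (1 + alpha0 lambda0) * M * (majorant_d1 c M + 2 * M * T * majorant_d2 c M)
           * exp (alpha0 lambda0 * majorant_d1 c M * M * T) < 1"
    and "1 \<le> K - lambda0 - 5 * majorant_d1 c M * M"
    and "C_inf f\<^sub>0"
    and "norm_H lambda0 (\<lambda>x v. pi * (1 + v\<^sup>2) * f\<^sub>0 x v)
           \<le> ennreal (M / 2 * exp (- (5 + alpha0 lambda0) * majorant_d1 c M * M))"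
  shows "\<exists>g. g \<in> X_space lambda0 K T M \<and> solves_g \<Phi> T f\<^sub>0 g
           \<and> (\<forall>h. h \<in> X_space lambda0 K T M \<and> solves_g \<Phi> T f\<^sub>0 h \<longrightarrow> (\<forall>t\<in>{0..T}. h t = g t))
           \<and> solves_f \<Phi> T f\<^sub>0 (\<lambda>t x v. omega v * g t x v)
           \<and> (\<forall>f. solves_f \<Phi> T f\<^sub>0 f \<and> (\<lambda>t x v. f t x v / omega v) \<in> X_space lambda0 K T M
                \<longrightarrow> (\<forall>t\<in>{0..T}. f t = (\<lambda>x v. omega v * g t x v)))"
proof -
  \<comment> \<open>Taking the product of jets instead of the jet of the product gives all
    derivatives of \<open>f\<^sub>0 / omega\<close> at once, by
    \<open>pd_smooth_jet\<close>.\<close>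
  define G0 where "G0 x v = jinv_omega x v * jet_of f\<^sub>0 x v" for x v
  have val: "cf (G0 x v) 0 0 = pi * (1 + v\<^sup>2) * f\<^sub>0 x v" for x v
    by (simp add: G0_def jinv_omega_def cf_jet_of_0 power2_eq_square)
  have "smooth_jet (\<lambda>p::real. jet_of f\<^sub>0)"
  proof (rule smooth_jet_jet_of)
    show "continuous_on UNIV (\<lambda>(p::real, x, v). pd k l f\<^sub>0 x v)" for k l
      unfolding case_prod_beta' by (intro C_inf_continuous_on[OF C_inf_pd[OF assms(13)]] continuous_intros)
  qed (rule assms)
  then have smooth: "smooth_jet (\<lambda>p::real. G0)"
    unfolding G0_def[abs_def] by (intro smooth_jet_mult smooth_jet_jinv_omega)
  have "norm_H lambda0 (\<lambda>x v. pi * (1 + v\<^sup>2) * f\<^sub>0 x v) = norm_W lambda0 G0"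
  proof (rule norm_H_jet)
    show "pd k l (\<lambda>x v. pi * (1 + v\<^sup>2) * f\<^sub>0 x v) x v = fact k * fact l * cf (G0 x v) k l" for k l x v
      using pd_smooth_jet[OF smooth, of k l] by (simp add: val)
  qed (use assms in simp)
  then interpret vlasov R \<Phi> c M lambda0 K T f\<^sub>0 G0
    using assms smooth val by unfold_locales (auto simp: omega_def)
  obtain g where g: "g \<in> X_space lambda0 K T M" "solves_g \<Phi> T f\<^sub>0 g"
    and unique: "\<And>h t. h \<in> X_space lambda0 K T M \<Longrightarrow> solves_g \<Phi> T f\<^sub>0 h \<Longrightarrow> t \<in> {0..T} \<Longrightarrow> h t = g t"
    using solution_exists_unique by blast
  have "f t = (\<lambda>x v. omega v * g t x v)"
    if "solves_f \<Phi> T f\<^sub>0 f" "(\<lambda>t x v. f t x v / omega v) \<in> X_space lambda0 K T M" "t \<in> {0..T}" for f t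
  proof -
    have "(\<lambda>x v. f t x v / omega v) = g t"
      using unique[OF that(2) solves_g_of_solves_f[OF that(1)] that(3)] .
    then show ?thesis using omega_pos by (auto simp: fun_eq_iff field_simps less_imp_neq[THEN not_sym])
  qed
  with g unique solves_f_of_solves_g[OF g(2)] show ?thesis by blast
qed

end
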